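(* There are solutions of the monocharge relativistic Vlasov-Maxwell problem described in the context (global in time, $t\ge0$, with initial data as described there) for which there exist $x_0\in\mathbb{R}$ and $C>0$ such that $$\int_{x_0+t}^\infty\rho(t,x)\,dx>C\qquad\text{for all } t\ge0.$$ Furthermore, for these solutions there exists $C>0$ such that $$\|\rho(t,\cdot)\|_{L^p(\mathbb{R})}>C\qquad\text{for all } t\ge0\text{ and all } p\in[1,\infty].$$
   Context: The monocharge relativistic Vlasov-Maxwell problem, for $t\ge0$, $x\in\mathbb{R}$, $v=(v_1,v_2)\in\mathbb{R}^2$, is $$\partial_t f+\hat v_1\partial_x f+(E_1+\hat v_2 B)\partial_{v_1}f+(E_2-\hat v_1 B)\partial_{v_2}f=0,$$ $$\rho(t,x)=\int f(t,x,v)\,dv,\qquad j(t,x)=\int f(t,x,v)\hat v\,dv,$$ $$E_1(t,x)=\tfrac12\int_{-\infty}^x\rho(t,y)\,dy-\tfrac12\int_x^\infty\rho(t,y)\,dy,\qquad \partial_tE_2+\partial_xB=-j_2,\qquad \partial_tB+\partial_xE_2=0,$$ where $\hat v=v/\sqrt{1+|v|^2}$ and $v$-integrals are over $\mathbb{R}^2$ (one species with charge $1$ and mass $1$). Initial data: $f(0,x,v)=f_0(x,v)\ge0$, $E_2(0,x)=E_{20}(x)$, $B(0,x)=B_0(x)$, where $f_0\in C_0^1(\mathbb{R}^3)$ is nonnegative and compactly supported and $E_{20},B_0\in C_0^1(\mathbb{R})$ are compactly supported. Solutions are understood to be global $C^1$ solutions on $t\ge 0$. *)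

theory Defs
  imports "HOL-Analysis.Analysis" "HOL-Probability.Essential_Supremum"
begin

text \<open>
  On the half space \<open>t \<ge> 0\<close> the derivatives are taken within the closed set, so that \<open>C\<^sup>1\<close>
  includes the boundary \<open>t = 0\<close> (one-sided time derivatives).
\<close>

definition C1_on :: "'a::real_normed_vector set \<Rightarrow> ('a \<Rightarrow> real) \<Rightarrow> bool" where
  "C1_on S g \<longleftrightarrow>
     (\<exists>g' :: 'a \<Rightarrow> 'a \<Rightarrow>\<^sub>L real.
        (\<forall>z\<in>S. (g has_derivative blinfun_apply (g' z)) (at z within S)) \<and> continuous_on S g')"

definition compactly_supported :: "('a::topological_space \<Rightarrow> real) \<Rightarrow> bool" where
  "compactly_supported g \<longleftrightarrow> compact (closure {z. g z \<noteq> 0})"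

definition time_deriv :: "(real \<Rightarrow> real) \<Rightarrow> real \<Rightarrow> real" where
  "time_deriv g t = vector_derivative g (at t within {0..})"

definition vhat :: "real \<times> real \<Rightarrow> real \<times> real" where
  "vhat v = v /\<^sub>R sqrt (1 + (norm v)\<^sup>2)"

type_synonym density = "real \<Rightarrow> real \<Rightarrow> real \<times> real \<Rightarrow> real"
type_synonym field = "real \<Rightarrow> real \<Rightarrow> real"

definition rho :: "density \<Rightarrow> real \<Rightarrow> real \<Rightarrow> real" where
  "rho f t x = (LINT v|lborel. f t x v)"

definition current :: "density \<Rightarrow> real \<Rightarrow> real \<Rightarrow> real \<times> real" where
  "current f t x = (LINT v|lborel. f t x v *\<^sub>R vhat v)"

definition admissible_data ::
  "(real \<Rightarrow> real \<times> real \<Rightarrow> real) \<Rightarrow> (real \<Rightarrow> real) \<Rightarrow> (real \<Rightarrow> real) \<Rightarrow> bool" where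
  "admissible_data f0 E20 B0 \<longleftrightarrow>
     C1_on UNIV (\<lambda>(x, v). f0 x v) \<and> compactly_supported (\<lambda>(x, v). f0 x v) \<and>
     (\<forall>x v. f0 x v \<ge> 0) \<and>
     C1_on UNIV E20 \<and> compactly_supported E20 \<and>
     C1_on UNIV B0 \<and> compactly_supported B0"

text \<open>
  Bochner integrals of non-integrable functions are \<open>0\<close> by convention; the two integrability
  conditions ensure that \<open>rho\<close>, \<open>current\<close> (as \<open>|vhat v| < 1\<close>) and the integrals defining
  \<open>E1\<close> are genuine. Nothing is required of the functions at negative times.
\<close>

definition monocharge_RVM_solution ::
  "(real \<Rightarrow> real \<times> real \<Rightarrow> real) \<Rightarrow> (real \<Rightarrow> real) \<Rightarrow> (real \<Rightarrow> real) \<Rightarrow>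
   density \<Rightarrow> field \<Rightarrow> field \<Rightarrow> field \<Rightarrow> bool" where
  "monocharge_RVM_solution f0 E20 B0 f E1 E2 B \<longleftrightarrow>
     C1_on ({0..} \<times> UNIV) (\<lambda>(t, x, v). f t x v) \<and>
     C1_on ({0..} \<times> UNIV) (\<lambda>(t, x). E1 t x) \<and>
     C1_on ({0..} \<times> UNIV) (\<lambda>(t, x). E2 t x) \<and>
     C1_on ({0..} \<times> UNIV) (\<lambda>(t, x). B t x) \<and>
     (\<forall>t\<ge>0. \<forall>x. integrable lborel (f t x)) \<and>
     (\<forall>t\<ge>0. integrable lborel (rho f t)) \<and>
     (\<forall>t\<ge>0. \<forall>x v1 v2.
        time_deriv (\<lambda>s. f s x (v1, v2)) t
        + fst (vhat (v1, v2)) * deriv (\<lambda>y. f t y (v1, v2)) x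
        + (E1 t x + snd (vhat (v1, v2)) * B t x) * deriv (\<lambda>u. f t x (u, v2)) v1
        + (E2 t x - fst (vhat (v1, v2)) * B t x) * deriv (\<lambda>u. f t x (v1, u)) v2 = 0) \<and>
     (\<forall>t\<ge>0. \<forall>x.
        E1 t x = 1/2 * (LINT y:{..x}|lborel. rho f t y) - 1/2 * (LINT y:{x..}|lborel. rho f t y)) \<and>
     (\<forall>t\<ge>0. \<forall>x. time_deriv (\<lambda>s. E2 s x) t + deriv (\<lambda>y. B t y) x = - snd (current f t x)) \<and>
     (\<forall>t\<ge>0. \<forall>x. time_deriv (\<lambda>s. B s x) t + deriv (\<lambda>y. E2 t y) x = 0) \<and>
     (\<forall>x v. f 0 x v = f0 x v) \<and> (\<forall>x. E2 0 x = E20 x) \<and> (\<forall>x. B 0 x = B0 x)"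

definition Lp_norm :: "ennreal \<Rightarrow> (real \<Rightarrow> real) \<Rightarrow> ennreal" where
  "Lp_norm p g =
     (if p = \<infinity> then esssup lborel (\<lambda>x. ennreal \<bar>g x\<bar>)
      else (let I = (\<integral>\<^sup>+x. ennreal (\<bar>g x\<bar> powr enn2real p) \<partial>lborel)
            in if I = \<infinity> then \<infinity> else ennreal (enn2real I powr (1 / enn2real p))))"

definition mass_stays_ahead :: "density \<Rightarrow> bool" where
  "mass_stays_ahead f \<longleftrightarrow>
     (\<exists>x0. \<exists>C>0. \<forall>t\<ge>0. (LINT x:{x0 + t..}|lborel. rho f t x) > C)"

end

theory Submission
  imports Defs
begin

text \<open>
  The fields \<open>E2\<close> and \<open>B\<close> can be kept identically zero: if \<open>f0\<close> is even in \<open>v2\<close> and \<open>E20 = B0 = 0\<close>,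
  the solution stays even in \<open>v2\<close> and carries no transverse current. What remains is a
  one-dimensional relativistic Vlasov-Poisson problem for \<open>f\<close> and \<open>E = E1\<close>, in which \<open>v2\<close> is
  conserved along characteristics.

  This problem is solved globally by a fixed point argument on the field. A field that is Lipschitz
  in \<open>x\<close> has a flow, the flow transports \<open>f0\<close>, and the transported density induces a new field. The
  support of the density stays in a box of known size, so the induced field obeys a priori bounds
  that define an invariant class of fields, and with a weight that grows fast enough in time the map
  is a contraction for all times at once (\<open>self_consistent_field_exists\<close>). Smoothness comes afterwards:
  the density transported by a Lipschitz flow is Lipschitz, hence so is the charge density
  \<open>rho = \<partial>\<^sub>x E\<close>. The force thus has a Lipschitz derivative, its flow is \<open>C\<^sup>1\<close>, and so is \<open>f\<close>. Integrating
  the Vlasov equation gives \<open>\<partial>\<^sub>t E = - j1\<close>, which makes \<open>E\<close> a \<open>C\<^sup>1\<close> function as well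
  (\<open>monocharge_solution\<close>).

  Charge stays ahead of a light ray for the following reason. Along \<open>x = x0 + t\<close> the field does not
  decrease, because \<open>\<partial>\<^sub>t E + \<partial>\<^sub>x E = rho - j1 \<ge> 0\<close>, and it is nondecreasing in \<open>x\<close>. If it is at least \<open>c > 0\<close> at \<open>x0\<close>
  initially, it is at least \<open>c\<close> ahead of the ray forever. A particle in such a field gains energy so
  quickly that its total lag behind the speed of light is bounded:
  \<open>1 - X' \<le> - (\<gamma> - V1)' / c\<close> with \<open>\<gamma> = sqrt (1 + |V|\<^sup>2)\<close>. So a cloud that starts far enough ahead of \<open>x0\<close>
  is never caught by the ray, while particles behind the ray cannot catch up with it. For data that
  consist of a large cloud behind \<open>x0\<close> and a distant smaller cloud ahead of it no particle ever meets
  the ray (\<open>no_charge_on_light_ray\<close>), and the charge ahead of it is constant in time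
  (\<open>charge_ahead_conserved\<close>).

  The lower bounds for the Lebesgue norms hold for every solution with charge ahead of a light ray.
  By finite propagation speed (\<open>finite_propagation_speed\<close>) that charge sits in an interval
  \<open>[x0 + t, R + t]\<close> of fixed length, and charge concentrated on a bounded interval forces a lower bound
  that is uniform in the exponent (\<open>Lp_norm_greater_if_concentrated\<close>).
\<close>
section \<open>Fixed points, differentiability and comparison\<close>

lemma abs_fst_le_norm: "\<bar>fst p\<bar> \<le> norm p" for p :: "real \<times> 'a::real_normed_vector"
  using norm_fst_le[of "fst p" "snd p"] by simp

lemma norm_snd_le_norm: "norm (snd p) \<le> norm p" for p :: "'a::real_normed_vector \<times> 'b::real_normed_vector"
  using norm_snd_le[of "snd p" "fst p"] by simp

text \<open>
  One-sided derivatives on the half line are therefore unique, also at its end point.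
\<close>

lemma at_within_half_line_nontrivial: "0 \<le> t \<Longrightarrow> at t within {0..} \<noteq> (bot::real filter)"
proof
  assume t: "0 \<le> t" and "at t within {0..} = bot"
  moreover have "at_right t \<le> at t within {0..}" using t by (intro at_le) auto
  ultimately show False using trivial_limit_at_right_real[of t] by (simp add: bot.extremum_unique)
qed

text \<open>
  Banach's fixed point theorem for the weighted supremum norm \<open>sup |u i| / w i\<close>. Volterra operators are
  contractions for a weight that grows fast enough in time, so this form yields solutions on the whole
  half line \<open>t \<ge> 0\<close> without continuation from one bounded interval to the next. Restricting to a class
  \<open>P\<close> that is closed in this norm avoids a function space as a type.
\<close>

lemma weighted_contraction_fixed_point:
  fixes T :: "('i \<Rightarrow> 'a::banach) \<Rightarrow> 'i \<Rightarrow> 'a" and w :: "'i \<Rightarrow> real"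
  assumes start: "P u0" "\<And>i. i \<in> S \<Longrightarrow> norm (T u0 i - u0 i) \<le> D * w i"
    and D: "D \<ge> 0"
    and step: "\<And>u. P u \<Longrightarrow> P (T u)"
    and contr: "\<And>u v c. \<lbrakk>P u; P v; 0 \<le> c; \<And>i. i \<in> S \<Longrightarrow> norm (u i - v i) \<le> c * w i\<rbrakk>
                  \<Longrightarrow> \<forall>i\<in>S. norm (T u i - T v i) \<le> c / 2 * w i"
    and closed: "\<And>u U c. \<lbrakk>\<And>n. P (u n); \<And>n i. i \<in> S \<Longrightarrow> norm (u n i - U i) \<le> c * (1/2)^n * w i\<rbrakk>
                  \<Longrightarrow> P U"
  shows "\<exists>U. P U \<and> (\<forall>i\<in>S. T U i = U i)"
proof -
  define u where "u n = (T ^^ n) u0" for n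
  have u_Suc: "u (Suc n) = T (u n)" for n by (simp add: u_def)
  have Pu: "P (u n)" for n
    by (induction n) (use start step in \<open>auto simp: u_def\<close>)
  have diff: "\<forall>i\<in>S. norm (u (Suc n) i - u n i) \<le> D * (1/2)^n * w i" for n
  proof (induction n)
    case 0
    then show ?case using start by (simp add: u_def)
  next
    case (Suc n)
    have "\<forall>i\<in>S. norm (T (u (Suc n)) i - T (u n) i) \<le> D * (1/2)^n / 2 * w i"
      by (rule contr) (use Pu D Suc in auto)
    then show ?case by (simp add: u_Suc)
  qed
  have dist: "norm (u (n + k) i - u n i) \<le> 2 * D * (1/2)^n * w i * (1 - (1/2)^k)" if "i \<in> S" for n k i
  proof (induction k)
    case (Suc k)
    have "norm (u (n + Suc k) i - u n i) \<le> norm (u (Suc (n + k)) i - u (n + k) i) + norm (u (n + k) i - u n i)"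
      by (metis add_Suc_right diff_add_cancel add_diff_eq norm_triangle_ineq)
    also have "\<dots> \<le> D * (1/2)^(n+k) * w i + 2 * D * (1/2)^n * w i * (1 - (1/2)^k)"
      using diff that Suc by (intro add_mono) auto
    also have "\<dots> = 2 * D * (1/2)^n * w i * (1 - (1/2)^Suc k)"
      by (simp add: power_add algebra_simps)
    finally show ?case .
  qed simp
  have Dw: "0 \<le> D * w i" if "i \<in> S" for i
    using start(2)[OF that] norm_ge_zero order_trans by blast
  have dist': "norm (u (n + k) i - u n i) \<le> 2 * D * (1/2)^n * w i" if "i \<in> S" for n k i
  proof -
    have "2 * D * (1/2)^n * w i * (1 - (1/2)^k) \<le> 2 * D * (1/2)^n * w i * 1"
      using Dw[OF that] by (intro mult_left_mono) (auto simp: mult.assoc mult.left_commute[of D] zero_le_mult_iff)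
    then show ?thesis using dist[OF that, of n k] by simp
  qed
  have tail0: "(\<lambda>n. C * (1/2)^n * w i) \<longlonglongrightarrow> 0" for C i
  proof -
    have "(\<lambda>n. C * (1/2::real)^n * w i) \<longlonglongrightarrow> C * 0 * w i"
      by (intro tendsto_intros LIMSEQ_power_zero) auto
    then show ?thesis by simp
  qed
  have "\<exists>l. (\<lambda>n. u n i) \<longlonglongrightarrow> l" if "i \<in> S" for i
  proof -
    have "Cauchy (\<lambda>n. u n i)"
    proof (rule metric_CauchyI)
      fix e :: real assume "e > 0"
      have "\<forall>\<^sub>F n in sequentially. 2 * D * (1/2)^n * w i < e / 2"
        by (rule order_tendstoD(2)[OF tail0]) (use \<open>e > 0\<close> in auto)
      then obtain N where N: "2 * D * (1/2)^N * w i < e / 2"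
        by (auto simp: eventually_sequentially)
      have "dist (u m i) (u N i) < e / 2" if "m \<ge> N" for m
        using dist'[OF \<open>i \<in> S\<close>, of N "m - N"] that N by (simp add: dist_norm)
      then show "\<exists>M. \<forall>m\<ge>M. \<forall>n\<ge>M. dist (u m i) (u n i) < e"
        by (meson dist_triangle_half_l)
    qed
    then show ?thesis using Cauchy_convergent convergent_def by blast
  qed
  then obtain U where U: "\<And>i. i \<in> S \<Longrightarrow> (\<lambda>n. u n i) \<longlonglongrightarrow> U i" by metis
  have close: "norm (u n i - U i) \<le> 2 * D * (1/2)^n * w i" if "i \<in> S" for n i
  proof -
    have "(\<lambda>k. norm (u (k + n) i - u n i)) \<longlonglongrightarrow> norm (U i - u n i)"
      by (intro tendsto_intros LIMSEQ_ignore_initial_segment U that)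
    then have "norm (U i - u n i) \<le> 2 * D * (1/2)^n * w i"
      by (rule LIMSEQ_le_const2) (use dist'[OF that, of n] in \<open>auto simp: add.commute\<close>)
    then show ?thesis by (simp add: norm_minus_commute)
  qed
  have PU: "P U" by (rule closed[of u U "2 * D"]) (use Pu close in auto)
  have "T U i = U i" if "i \<in> S" for i
  proof -
    have *: "norm (T (u n) i - T U i) \<le> D * (1/2)^n * w i" for n
      using contr[OF Pu[of n] PU, of "2 * D * (1/2)^n"] close D that by simp
    have "(\<lambda>n. T (u n) i - T U i) \<longlonglongrightarrow> 0"
      by (rule Lim_null_comparison[OF _ tail0[of D i]]) (use * in auto)
    then have "(\<lambda>n. u (Suc n) i) \<longlonglongrightarrow> T U i"
      by (simp add: u_Suc LIM_zero_iff)
    then show ?thesis using LIMSEQ_Suc[OF U[OF that]] LIMSEQ_unique by blast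
  qed
  then show ?thesis using PU by blast
qed

lemma has_derivative_if_quadratic_remainder:
  fixes g :: "'a::real_normed_vector \<Rightarrow> 'b::real_normed_vector"
  assumes D: "bounded_linear D"
    and rem: "\<And>y. norm (g y - g x - D (y - x)) \<le> Q * (norm (y - x))\<^sup>2"
  shows "(g has_derivative D) (at x within S)"
proof -
  have "(g has_derivative D) (at x)"
    unfolding has_derivative_within_alt
  proof (intro conjI allI impI D)
    fix e :: real assume e: "0 < e"
    show "\<exists>d>0. \<forall>y\<in>UNIV. norm (y - x) < d \<longrightarrow> norm (g y - g x - D (y - x)) \<le> e * norm (y - x)"
    proof (intro exI[of _ "e / (\<bar>Q\<bar> + 1)"] conjI ballI impI)
      fix y assume y: "norm (y - x) < e / (\<bar>Q\<bar> + 1)"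
      have "norm (g y - g x - D (y - x)) \<le> Q * norm (y - x) * norm (y - x)"
        using rem[of y] by (simp add: power2_eq_square mult.assoc)
      also have "\<dots> \<le> e * norm (y - x)"
      proof (rule mult_right_mono)
        have "Q * norm (y - x) \<le> (\<bar>Q\<bar> + 1) * norm (y - x)" by (intro mult_right_mono) auto
        also have "\<dots> \<le> e" using y by (simp add: field_simps)
        finally show "Q * norm (y - x) \<le> e" .
      qed simp
      finally show "norm (g y - g x - D (y - x)) \<le> e * norm (y - x)" .
    qed (use e in auto)
  qed
  then show ?thesis by (rule has_derivative_at_withinI)
qed

lemma nondecreasing_if_derivative_nonneg:
  fixes g :: "real \<Rightarrow> real"
  assumes "a \<le> b"
    and g: "\<And>s. s \<in> {a..b} \<Longrightarrow> (g has_real_derivative g' s) (at s within {a..b})"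
    and nonneg: "\<And>s. s \<in> {a..b} \<Longrightarrow> 0 \<le> g' s"
  shows "g a \<le> g b"
proof (rule DERIV_nonneg_imp_increasing_open[OF \<open>a \<le> b\<close>])
  show "\<exists>z. (g has_real_derivative z) (at x) \<and> 0 \<le> z" if "a < x" "x < b" for x
    using g[of x] nonneg[of x] that at_within_Icc_at[OF that] by (intro exI[of _ "g' x"]) auto
  show "continuous_on {a..b} g"
    using g DERIV_continuous continuous_on_eq_continuous_within by blast
qed

text \<open>
  The bound on \<open>y'\<close> only says that \<open>|y|\<close> is at most \<open>\<alpha> + K H\<close> with \<open>H\<close> the integral of \<open>|y|\<close>; since
  \<open>H' = |y|\<close>, the product of \<open>\<alpha> + K H\<close> with \<open>exp (- K s)\<close> cannot grow. The inhomogeneity is given by an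
  antiderivative \<open>d\<close>, which the applications know in closed form. The case \<open>K = 0\<close> is a mean value
  inequality.
\<close>

lemma gronwall_forward:
  fixes y :: "real \<Rightarrow> 'a::real_normed_vector"
  assumes "a \<le> b" "0 \<le> K"
    and y: "\<And>s. s \<in> {a..b} \<Longrightarrow> (y has_vector_derivative y' s) (at s within {a..b})"
    and d: "\<And>s. s \<in> {a..b} \<Longrightarrow> (d has_real_derivative d' s) (at s within {a..b})"
    and d_nonneg: "\<And>s. s \<in> {a..b} \<Longrightarrow> 0 \<le> d' s"
    and bound: "\<And>s. s \<in> {a..b} \<Longrightarrow> norm (y' s) \<le> K * norm (y s) + d' s"
  shows "norm (y b) \<le> (norm (y a) + (d b - d a)) * exp (K * (b - a))"
proof (cases "a = b")
  case False
  then have "a < b" using assms by auto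
  have conty: "continuous_on {a..b} y"
    using y has_vector_derivative_continuous continuous_on_eq_continuous_within by blast
  define H where "H s = integral {a..s} (\<lambda>r. norm (y r))" for s
  have H: "(H has_real_derivative norm (y s)) (at s within {a..b})" if "s \<in> {a..b}" for s
    using integral_has_vector_derivative[of a b "\<lambda>r. norm (y r)" s] conty that
    unfolding H_def has_real_derivative_iff_has_vector_derivative by (auto intro: continuous_intros)
  have contH: "continuous_on {a..b} H"
    using H DERIV_continuous continuous_on_eq_continuous_within by blast
  have contd: "continuous_on {a..b} d"
    using d DERIV_continuous continuous_on_eq_continuous_within by blast
  have at: "at s within {a..b} = at s" if "a < s" "s < b" for s
    using that by (intro at_within_Icc_at) auto
  have dmono: "d s \<le> d b" if "s \<in> {a..b}" for s
  proof (rule nondecreasing_if_derivative_nonneg[where g = d and g' = d'])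
    show "(d has_real_derivative d' r) (at r within {s..b})" if "r \<in> {s..b}" for r
      using that \<open>s \<in> {a..b}\<close> by (intro DERIV_subset[OF d]) auto
  qed (use that d_nonneg in auto)
  define \<alpha> where "\<alpha> = norm (y a) + (d b - d a)"
  have y_le: "norm (y s) \<le> \<alpha> + K * H s" if s: "s \<in> {a..b}" for s
  proof (cases "s = a")
    case True
    then show ?thesis using dmono[of a] \<open>a < b\<close> by (simp add: \<alpha>_def H_def)
  next
    case False
    then have "a < s" using s by auto
    have "norm (y s - y a) \<le> (K * H s + d s) - (K * H a + d a)"
    proof (rule differentiable_bound_general[OF \<open>a < s\<close>, where f' = y' and \<phi>' = "\<lambda>s. K * norm (y s) + d' s"])
      show "continuous_on {a..s} y" "continuous_on {a..s} (\<lambda>x. K * H x + d x)"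
        using conty contH contd s by (auto intro!: continuous_intros elim!: continuous_on_subset)
      fix x assume x: "a < x" "x < s"
      then have x': "x \<in> {a..b}" "a < x" "x < b" using s by auto
      show "(y has_vector_derivative y' x) (at x)" using y[of x] at x' by simp
      have "((\<lambda>x. K * H x + d x) has_real_derivative K * norm (y x) + d' x) (at x)"
        using H[of x] d[of x] at x' by (auto intro!: derivative_eq_intros)
      then show "((\<lambda>x. K * H x + d x) has_vector_derivative K * norm (y x) + d' x) (at x)"
        by (simp add: has_real_derivative_iff_has_vector_derivative)
      show "norm (y' x) \<le> K * norm (y x) + d' x" using bound x' by auto
    qed
    moreover have "H a = 0" by (simp add: H_def)
    moreover have "norm (y s) \<le> norm (y s - y a) + norm (y a)"
      by (metis diff_add_cancel norm_triangle_ineq)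
    ultimately show ?thesis using dmono[OF s] by (simp add: \<alpha>_def)
  qed
  have "(\<alpha> + K * H b) * exp (- K * b) \<le> (\<alpha> + K * H a) * exp (- K * a)"
  proof (rule DERIV_nonpos_imp_decreasing_open[of a b "\<lambda>s. (\<alpha> + K * H s) * exp (- K * s)"])
    show "a \<le> b" by fact
    show "continuous_on {a..b} (\<lambda>s. (\<alpha> + K * H s) * exp (- K * s))"
      by (intro continuous_intros contH)
    fix x assume x: "a < x" "x < b"
    then have x': "x \<in> {a..b}" by auto
    have "((\<lambda>s. (\<alpha> + K * H s) * exp (- K * s)) has_real_derivative
        K * norm (y x) * exp (- K * x) + (\<alpha> + K * H x) * (exp (- K * x) * - K)) (at x)"
      using H[OF x'] at[OF x] by (auto intro!: derivative_eq_intros)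
    moreover have "K * norm (y x) * exp (- K * x) + (\<alpha> + K * H x) * (exp (- K * x) * - K)
        = K * exp (- K * x) * (norm (y x) - (\<alpha> + K * H x))"
      by (simp add: algebra_simps)
    moreover have "\<dots> \<le> 0" using y_le[OF x'] \<open>0 \<le> K\<close>
      by (intro mult_nonneg_nonpos) auto
    ultimately show "\<exists>z. ((\<lambda>s. (\<alpha> + K * H s) * exp (- K * s)) has_real_derivative z) (at x) \<and> z \<le> 0"
      by auto
  qed
  then have "(\<alpha> + K * H b) * exp (- K * b) * exp (K * b) \<le> \<alpha> * exp (- K * a) * exp (K * b)"
    by (intro mult_right_mono) (auto simp: H_def)
  then have "\<alpha> + K * H b \<le> \<alpha> * exp (K * (b - a))"
    by (simp add: mult.assoc flip: exp_add) (simp add: algebra_simps)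
  then show ?thesis using y_le[of b] \<open>a < b\<close> by (simp add: \<alpha>_def)
qed simp

text \<open>
  Time reversal of the previous bound, used where characteristics are traced back to the initial time.
\<close>

lemma gronwall_backward:
  fixes y :: "real \<Rightarrow> 'a::real_normed_vector"
  assumes "a \<le> b" "0 \<le> K"
    and y: "\<And>s. s \<in> {a..b} \<Longrightarrow> (y has_vector_derivative y' s) (at s within {a..b})"
    and d: "\<And>s. s \<in> {a..b} \<Longrightarrow> (d has_real_derivative d' s) (at s within {a..b})"
    and d_nonneg: "\<And>s. s \<in> {a..b} \<Longrightarrow> 0 \<le> d' s"
    and bound: "\<And>s. s \<in> {a..b} \<Longrightarrow> norm (y' s) \<le> K * norm (y s) + d' s"
  shows "norm (y a) \<le> (norm (y b) + (d b - d a)) * exp (K * (b - a))"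
proof -
  let ?r = "\<lambda>s. a + b - s"
  have im: "?r ` {a..b} = {a..b}"
    by (auto simp: image_def intro!: bexI[of _ "a + b - _"])
  have "norm (y (?r b)) \<le> (norm (y (?r a)) + (- d (?r b) - - d (?r a))) * exp (K * (b - a))"
  proof (rule gronwall_forward[OF assms(1,2)])
    fix s assume s: "s \<in> {a..b}"
    then have rs: "?r s \<in> {a..b}" by auto
    have "((y \<circ> ?r) has_vector_derivative (-1) *\<^sub>R y' (?r s)) (at s within {a..b})"
    proof (rule vector_diff_chain_within)
      show "(?r has_vector_derivative -1) (at s within {a..b})"
        by (auto intro!: derivative_eq_intros)
      show "(y has_vector_derivative y' (?r s)) (at (?r s) within ?r ` {a..b})"
        unfolding im by (rule y[OF rs])
    qed
    then show "((\<lambda>s. y (?r s)) has_vector_derivative - y' (?r s)) (at s within {a..b})"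
      by (simp add: o_def)
    have "((d \<circ> ?r) has_real_derivative d' (?r s) * (-1)) (at s within {a..b})"
    proof (rule DERIV_image_chain)
      show "(?r has_real_derivative -1) (at s within {a..b})"
        by (auto intro!: derivative_eq_intros)
      show "(d has_real_derivative d' (?r s)) (at (?r s) within ?r ` {a..b})"
        unfolding im by (rule d[OF rs])
    qed
    from DERIV_minus[OF this] show "((\<lambda>s. - d (?r s)) has_real_derivative d' (?r s)) (at s within {a..b})"
      by (simp add: o_def)
    show "0 \<le> d' (?r s)" "norm (- y' (?r s)) \<le> K * norm (y (?r s)) + d' (?r s)"
      using d_nonneg[OF rs] bound[OF rs] by auto
  qed
  then show ?thesis by simp
qed

section \<open>Differential equations with a Lipschitz right-hand side\<close>

lemma continuous_on_half_line_if_locally_uniform_limit: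
  fixes u :: "nat \<Rightarrow> real \<Rightarrow> 'a::real_normed_vector"
  assumes u: "\<And>n. continuous_on {0..} (u n)"
    and close: "\<And>N. 0 \<le> N \<Longrightarrow> \<exists>C. \<forall>n. \<forall>s\<in>{0..N}. norm (u n s - U s) \<le> C * (1/2)^n"
  shows "continuous_on {0..} U"
  unfolding continuous_on_eq_continuous_within
proof
  fix s :: real assume s: "s \<in> {0..}"
  have "continuous_on {0..s+1} U"
  proof (rule uniform_limit_theorem[where F = sequentially])
    show "\<forall>\<^sub>F n in sequentially. continuous_on {0..s+1} (u n)"
      by (intro always_eventually allI continuous_on_subset[OF u]) auto
    obtain C where "\<forall>n. \<forall>r\<in>{0..s+1}. norm (u n r - U r) \<le> C * (1/2)^n"
      using close[of "s + 1"] s by auto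
    then have C: "norm (u n r - U r) \<le> C * (1/2)^n" if "r \<in> {0..s+1}" for n r using that by blast
    show "uniform_limit {0..s+1} u U sequentially"
    proof (rule uniform_limitI)
      fix e :: real assume e: "e > 0"
      have "(\<lambda>n. C * (1/2::real)^n) \<longlonglongrightarrow> C * 0"
        by (intro tendsto_intros LIMSEQ_power_zero) auto
      then have "\<forall>\<^sub>F n in sequentially. C * (1/2)^n < e"
        by (rule order_tendstoD(2)) (use e in auto)
      then show "\<forall>\<^sub>F n in sequentially. \<forall>r\<in>{0..s+1}. dist (u n r) (U r) < e"
        by eventually_elim (use le_less_trans[OF C] in \<open>auto simp: dist_norm\<close>)
    qed
  qed simp
  then have "continuous (at s within {0..s+1}) U"
    using s by (simp add: continuous_on_eq_continuous_within)
  moreover have "at s within {0..s+1} = at s within {0..}"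
    by (rule at_within_nhd[of s "{..<s+1}"]) (use s in auto)
  ultimately show "continuous (at s within {0..}) U" by simp
qed

text \<open>
  A bound \<open>K\<close> that may grow with time, instead of a constant, allows one to treat all times \<open>t \<ge> 0\<close>
  together; the same function bounds the right-hand side at the origin.
\<close>

locale lipschitz_ode =
  fixes F :: "real \<Rightarrow> 'a::banach \<Rightarrow> 'a" and K :: "real \<Rightarrow> real"
  assumes cont_F: "continuous_on ({0..} \<times> UNIV) (\<lambda>(t, z). F t z)"
    and K_mono: "\<And>s t. 0 \<le> s \<Longrightarrow> s \<le> t \<Longrightarrow> K s \<le> K t"
    and K_pos: "\<And>t. 0 \<le> t \<Longrightarrow> 0 < K t"
    and lip_F: "\<And>t y z. 0 \<le> t \<Longrightarrow> norm (F t y - F t z) \<le> K t * norm (y - z)"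
    and F_zero: "\<And>t. 0 \<le> t \<Longrightarrow> norm (F t 0) \<le> K t"
begin

definition solves :: "(real \<Rightarrow> 'a) \<Rightarrow> bool" where
  "solves u \<longleftrightarrow> (\<forall>s\<ge>0. (u has_vector_derivative F s (u s)) (at s within {0..}))"

lemma continuous_along:
  assumes "continuous_on {0..} u"
  shows "continuous_on {0..} (\<lambda>s. F s (u s))"
proof -
  have "continuous_on {0..} ((\<lambda>(t, z). F t z) \<circ> (\<lambda>s. (s, u s)))"
    by (rule continuous_on_compose)
       (auto intro!: continuous_intros assms continuous_on_subset[OF cont_F])
  then show ?thesis by (simp add: o_def)
qed

lemma solves_within: "solves u \<Longrightarrow> 0 \<le> s \<Longrightarrow> S \<subseteq> {0..} \<Longrightarrow> (u has_vector_derivative F s (u s)) (at s within S)"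
  unfolding solves_def by (meson has_vector_derivative_within_subset)

lemma solves_cont: "solves u \<Longrightarrow> continuous_on {0..} u"
  unfolding solves_def continuous_on_eq_continuous_within
  using has_vector_derivative_continuous by fastforce

text \<open>
  Gronwall's inequality in both directions of time. It yields uniqueness, and Lipschitz dependence of
  the flow on the initial value.
\<close>

lemma solutions_apart:
  assumes "solves u" "solves v" "0 \<le> s" "0 \<le> t"
  shows "norm (u s - v s) \<le> norm (u t - v t) * exp (K (max s t) * \<bar>s - t\<bar>)"
proof -
  have ge: "norm (u b - v b) \<le> (norm (u a - v a) + (0 - 0)) * exp (K b * (b - a))"
    and le: "norm (u a - v a) \<le> (norm (u b - v b) + (0 - 0)) * exp (K b * (b - a))"
    if ab: "0 \<le> a" "a \<le> b" for a b
  proof -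
    have d: "((\<lambda>s. u s - v s) has_vector_derivative F r (u r) - F r (v r)) (at r within {a..b})"
      if "r \<in> {a..b}" for r
      using that ab assms(1,2) by (intro has_vector_derivative_diff solves_within) auto
    have bd: "norm (F r (u r) - F r (v r)) \<le> K b * norm (u r - v r) + 0" if "r \<in> {a..b}" for r
    proof -
      have "norm (F r (u r) - F r (v r)) \<le> K r * norm (u r - v r)" using that ab by (intro lip_F) auto
      also have "\<dots> \<le> K b * norm (u r - v r)" using that ab by (intro mult_right_mono K_mono) auto
      finally show ?thesis by simp
    qed
    have K0: "0 \<le> K b" using K_pos[of b] ab by auto
    show "norm (u b - v b) \<le> (norm (u a - v a) + (0 - 0)) * exp (K b * (b - a))"
      by (rule gronwall_forward[OF ab(2) K0 d _ _ bd]) (auto intro!: derivative_eq_intros)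
    show "norm (u a - v a) \<le> (norm (u b - v b) + (0 - 0)) * exp (K b * (b - a))"
      by (rule gronwall_backward[OF ab(2) K0 d _ _ bd]) (auto intro!: derivative_eq_intros)
  qed
  show ?thesis
    using ge[of t s] le[of s t] assms by (cases "s \<le> t") (auto simp: max_def)
qed

lemma solution_unique: "solves u \<Longrightarrow> solves v \<Longrightarrow> 0 \<le> s \<Longrightarrow> 0 \<le> t \<Longrightarrow> u t = v t \<Longrightarrow> u s = v s"
  using solutions_apart[of u v s t] by simp

definition picard :: "real \<Rightarrow> 'a \<Rightarrow> (real \<Rightarrow> 'a) \<Rightarrow> real \<Rightarrow> 'a" where
  "picard t0 z u s = z + (integral {0..s} (\<lambda>r. F r (u r)) - integral {0..t0} (\<lambda>r. F r (u r)))"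

text \<open>
  The weight grows away from \<open>t0\<close> at twice the Lipschitz rate. Integrating it once from \<open>t0\<close> gains the
  factor \<open>1 / (2 K)\<close>, which turns the Lipschitz constant \<open>K\<close> into the contraction factor \<open>1/2\<close>.
\<close>

definition weight :: "real \<Rightarrow> real \<Rightarrow> real" where
  "weight t0 s = exp (2 * K (max s t0) * \<bar>s - t0\<bar>)"

lemma picard_start: "picard t0 z u t0 = z"
  by (simp add: picard_def)

lemma picard_derivative:
  assumes u: "continuous_on {0..} u" and s: "0 \<le> s" "S \<subseteq> {0..}"
  shows "(picard t0 z u has_vector_derivative F s (u s)) (at s within S)"
proof -
  have "((\<lambda>s. integral {0..s} (\<lambda>r. F r (u r))) has_vector_derivative F s (u s)) (at s within {0..s+1})"
    using s by (intro integral_has_vector_derivative continuous_on_subset[OF continuous_along[OF u]]) auto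
  then have "(picard t0 z u has_vector_derivative F s (u s)) (at s within {0..s+1})"
    unfolding picard_def[abs_def] by (auto intro!: derivative_eq_intros)
  moreover have "at s within {0..s+1} = at s within {0..}"
    by (rule at_within_nhd[of s "{..<s+1}"]) auto
  ultimately show ?thesis using has_vector_derivative_within_subset[OF _ s(2)] by simp
qed

lemma picard_continuous:
  assumes "continuous_on {0..} u"
  shows "continuous_on {0..} (picard t0 z u)"
  unfolding continuous_on_eq_continuous_within
  using has_vector_derivative_continuous[OF picard_derivative[OF assms]] by auto

lemma picard_of_constant_bound:
  assumes t0: "0 \<le> t0" and s: "0 \<le> s"
  shows "norm (picard t0 z (\<lambda>_. z) s - z) \<le> (norm z + 1) * weight t0 s"
proof -
  define M where "M = max s t0"
  have M: "0 \<le> M" "s \<le> M" "t0 \<le> M" using t0 by (auto simp: M_def)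
  let ?T = "picard t0 z (\<lambda>_. z)"
  have bd: "norm (F r z) \<le> K M * (norm z + 1)" if "0 \<le> r" "r \<le> M" for r
  proof -
    have "norm (F r z) \<le> norm (F r z - F r 0) + norm (F r 0)"
      using norm_triangle_ineq[of "F r z - F r 0" "F r 0"] by simp
    also have "\<dots> \<le> K r * norm (z - 0) + K r" using that by (intro add_mono lip_F F_zero)
    also have "\<dots> = K r * (norm z + 1)" by (simp add: algebra_simps)
    also have "\<dots> \<le> K M * (norm z + 1)" using that by (intro mult_right_mono K_mono) auto
    finally show ?thesis .
  qed
  have "norm (?T s - ?T t0) \<le> K M * (norm z + 1) * norm (s - t0)"
  proof (rule differentiable_bound[of "{0..M}"])
    show "(?T has_derivative (\<lambda>h. h *\<^sub>R F x z)) (at x within {0..M})" if "x \<in> {0..M}" for x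
      using picard_derivative[of "\<lambda>_. z" x "{0..M}"] that unfolding has_vector_derivative_def by auto
    show "onorm (\<lambda>h. h *\<^sub>R F x z) \<le> K M * (norm z + 1)" if "x \<in> {0..M}" for x
      using bd[of x] that by (simp add: onorm_scaleR_left onorm_id)
  qed (use s M t0 in auto)
  moreover have "K M * (norm z + 1) * norm (s - t0) \<le> (norm z + 1) * weight t0 s"
  proof -
    have "K M * \<bar>s - t0\<bar> \<le> 2 * K M * \<bar>s - t0\<bar>" using K_pos[OF M(1)] by (intro mult_right_mono) auto
    also have "\<dots> \<le> weight t0 s"
      unfolding weight_def M_def[symmetric] using exp_ge_add_one_self[of "2 * K M * \<bar>s - t0\<bar>"] by linarith
    finally have "(norm z + 1) * (K M * \<bar>s - t0\<bar>) \<le> (norm z + 1) * weight t0 s" by (intro mult_left_mono) auto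
    then show ?thesis by (simp add: mult_ac)
  qed
  ultimately show ?thesis by (simp add: picard_start)
qed

lemma picard_contracts:
  assumes t0: "0 \<le> t0" and u: "continuous_on {0..} u" and v: "continuous_on {0..} v" and c: "0 \<le> c"
    and close: "\<And>s. 0 \<le> s \<Longrightarrow> norm (u s - v s) \<le> c * weight t0 s" and s: "0 \<le> s"
  shows "norm (picard t0 z u s - picard t0 z v s) \<le> c / 2 * weight t0 s"
proof -
  let ?y = "\<lambda>s. picard t0 z u s - picard t0 z v s"
  have dy: "(?y has_vector_derivative F r (u r) - F r (v r)) (at r within S)" if "0 \<le> r" "S \<subseteq> {0..}" for r S
    using that by (intro has_vector_derivative_diff picard_derivative u v)
  have bd: "norm (F r (u r) - F r (v r)) \<le> 0 * norm (?y r) + K M * (c * exp (2 * K M * \<bar>r - t0\<bar>))"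
    if r: "0 \<le> r" "r \<le> M" "max r t0 \<le> M" for r M
  proof -
    have "weight t0 r \<le> exp (2 * K M * \<bar>r - t0\<bar>)"
      unfolding weight_def using K_mono[OF _ r(3)] t0 by (auto intro!: mult_right_mono)
    then have "norm (u r - v r) \<le> c * exp (2 * K M * \<bar>r - t0\<bar>)"
      using order_trans[OF close[OF r(1)] mult_left_mono[OF _ c]] by blast
    then show ?thesis using order_trans[OF lip_F[OF r(1)] mult_mono] K_mono[OF r(1,2)] K_pos[of M] r by fastforce
  qed
  have y0: "?y t0 = 0" by (simp add: picard_start)
  show ?thesis
  proof (cases "t0 \<le> s")
    case True
    define k where "k = K s"
    have k: "0 < k" using K_pos[OF s] by (simp add: k_def)
    let ?d = "\<lambda>r. c / 2 * exp (2 * k * (r - t0))"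
    have "norm (?y s) \<le> (norm (?y t0) + (?d s - ?d t0)) * exp (0 * (s - t0))"
    proof (rule gronwall_forward[OF True order_refl dy])
      show "(?d has_real_derivative k * (c * exp (2 * k * (r - t0)))) (at r within {t0..s})" for r
        by (auto intro!: derivative_eq_intros)
      show "norm (F r (u r) - F r (v r)) \<le> 0 * norm (?y r) + k * (c * exp (2 * k * (r - t0)))" if "r \<in> {t0..s}" for r
        using bd[of r s] that t0 by (simp add: k_def)
    qed (use t0 k c in auto)
    also have "\<dots> \<le> ?d s" using c by (simp add: y0)
    finally show ?thesis using True by (simp add: weight_def k_def max_def)
  next
    case False
    define k where "k = K t0"
    have k: "0 < k" using K_pos[OF t0] by (simp add: k_def)
    let ?d = "\<lambda>r. - (c / 2 * exp (2 * k * (t0 - r)))"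
    have "norm (?y s) \<le> (norm (?y t0) + (?d t0 - ?d s)) * exp (0 * (t0 - s))"
    proof (rule gronwall_backward[OF _ order_refl dy])
      show "(?d has_real_derivative k * (c * exp (2 * k * (t0 - r)))) (at r within {s..t0})" for r
        by (auto intro!: derivative_eq_intros)
      show "norm (F r (u r) - F r (v r)) \<le> 0 * norm (?y r) + k * (c * exp (2 * k * (t0 - r)))" if "r \<in> {s..t0}" for r
        using bd[of r t0] that s by (simp add: k_def)
    qed (use s False k c in auto)
    also have "\<dots> \<le> - ?d s" using c by (simp add: y0)
    finally show ?thesis using False by (simp add: weight_def k_def max_def)
  qed
qed

lemma solution_exists:
  assumes t0: "0 \<le> t0"
  shows "\<exists>u. solves u \<and> u t0 = z"
proof -
  have "\<exists>U. continuous_on {0..} U \<and> (\<forall>s\<in>{0..}. picard t0 z U s = U s)"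
  proof (rule weighted_contraction_fixed_point[where w = "weight t0" and D = "norm z + 1" and ?u0.0 = "\<lambda>_. z"])
    fix u :: "nat \<Rightarrow> real \<Rightarrow> 'a" and U and c :: real
    assume u: "\<And>n. continuous_on {0..} (u n)"
      and close: "\<And>n i. i \<in> {0..} \<Longrightarrow> norm (u n i - U i) \<le> c * (1/2)^n * weight t0 i"
    have c: "0 \<le> c" using order_trans[OF norm_ge_zero close[of t0 0]] t0 by (simp add: weight_def)
    show "continuous_on {0..} U"
    proof (rule continuous_on_half_line_if_locally_uniform_limit[OF u])
      fix N :: real assume N: "0 \<le> N"
      define W where "W = exp (2 * K (N + t0) * (N + t0))"
      have "norm (u n s - U s) \<le> (c * W) * (1/2)^n" if s: "s \<in> {0..N}" for n s
      proof -
        have "K (max s t0) * \<bar>s - t0\<bar> \<le> K (N + t0) * (N + t0)"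
        proof (rule mult_mono)
          show "K (max s t0) \<le> K (N + t0)" by (rule K_mono) (use s t0 in auto)
          show "0 \<le> K (N + t0)" using K_pos[of "N + t0"] N t0 by simp
        qed (use s t0 in auto)
        then have "weight t0 s \<le> W" by (simp add: weight_def W_def)
        then have "c * (1/2)^n * weight t0 s \<le> c * (1/2)^n * W" using c by (intro mult_left_mono) auto
        then show ?thesis using close[of s n] s by (simp add: mult_ac)
      qed
      then show "\<exists>C. \<forall>n. \<forall>s\<in>{0..N}. norm (u n s - U s) \<le> C * (1/2)^n" by blast
    qed
  qed (use picard_continuous picard_of_constant_bound[OF t0] picard_contracts[OF t0] in auto)
  then obtain U where U: "continuous_on {0..} U" "\<And>s. 0 \<le> s \<Longrightarrow> picard t0 z U s = U s" by auto
  have "(U has_vector_derivative F s (U s)) (at s within {0..})" if s: "0 \<le> s" for s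
    by (rule has_vector_derivative_transform[OF _ _ picard_derivative[where z = z and ?t0.0 = t0, OF U(1) s order_refl]])
       (use s U in auto)
  moreover have "U t0 = z" using U(2)[OF t0] by (simp add: picard_start)
  ultimately show ?thesis unfolding solves_def by blast
qed

text \<open>
  \<open>flow s t z\<close> is the position at time \<open>s\<close> of the solution that passes through \<open>z\<close> at time \<open>t\<close>; thus
  \<open>flow 0 t\<close> leads back to the initial time.
\<close>

definition flow :: "real \<Rightarrow> real \<Rightarrow> 'a \<Rightarrow> 'a" where
  "flow s t z = (SOME u. solves u \<and> u t = z) s"

lemma flow_solves: "0 \<le> t \<Longrightarrow> solves (\<lambda>s. flow s t z)"
  and flow_start: "0 \<le> t \<Longrightarrow> flow t t z = z"
  using someI_ex[OF solution_exists[of t z]] by (auto simp: flow_def)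

lemma flow_eqI: "solves u \<Longrightarrow> u t = z \<Longrightarrow> 0 \<le> t \<Longrightarrow> 0 \<le> s \<Longrightarrow> flow s t z = u s"
  using solution_unique[OF flow_solves[of t z], of u s t] flow_start by simp

lemma flow_flow: "0 \<le> r \<Longrightarrow> 0 \<le> s \<Longrightarrow> 0 \<le> t \<Longrightarrow> flow r s (flow s t z) = flow r t z"
  by (rule flow_eqI[OF flow_solves]) auto

lemma flow_lipschitz:
  "0 \<le> s \<Longrightarrow> 0 \<le> t \<Longrightarrow> norm (flow s t y - flow s t z) \<le> norm (y - z) * exp (K (max s t) * \<bar>s - t\<bar>)"
  using solutions_apart[OF flow_solves[of t y] flow_solves[of t z], of s t] by (simp add: flow_start)

end

section \<open>Differentiability of the flow\<close>

text \<open>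
  Difference quotients at the scale \<open>sqrt d\<close> see a distance \<open>d\<close> of the functions as \<open>sqrt d\<close> and a quadratic
  remainder as \<open>sqrt d\<close>. This gives continuity of the derivative of a flow, jointly in time and space,
  from Lipschitz continuity of the flow itself.
\<close>

lemma derivatives_close_if_functions_close:
  fixes g g' :: "'a::real_normed_vector \<Rightarrow> 'b::real_normed_vector" and D D' :: "'a \<Rightarrow>\<^sub>L 'b"
  assumes d: "0 < d" and L: "0 \<le> L" and Q: "0 \<le> Q"
    and near: "\<And>h. norm (g (z + h) - g' (z' + h)) \<le> L * d"
    and rem: "\<And>h. norm (g (z + h) - g z - D h) \<le> Q * (norm h)\<^sup>2"
    and rem': "\<And>h. norm (g' (z' + h) - g' z' - D' h) \<le> Q * (norm h)\<^sup>2"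
  shows "norm (D - D') \<le> 2 * (L + Q) * sqrt d"
proof (rule norm_blinfun_bound)
  show "0 \<le> 2 * (L + Q) * sqrt d" using assms by simp
  fix h :: 'a
  show "norm ((D - D') h) \<le> 2 * (L + Q) * sqrt d * norm h"
  proof (cases "h = 0")
    case False
    define e where "e = sqrt d"
    have e: "0 < e" "e\<^sup>2 = d" using d by (auto simp: e_def)
    define k where "k = (e / norm h) *\<^sub>R h"
    have k: "norm k = e" using False e by (simp add: k_def)
    have "(D - D') k = (g (z + k) - g' (z' + k)) - (g (z + 0) - g' (z' + 0))
        - (g (z + k) - g z - D k) + (g' (z' + k) - g' z' - D' k)"
      by (simp add: blinfun.diff_left)
    also have "norm \<dots> \<le> L * d + L * d + Q * e\<^sup>2 + Q * e\<^sup>2"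
    proof -
      have tri: "norm (a - b - c + d) \<le> norm a + norm b + norm c + norm d" for a b c d :: 'b
        by (smt (verit) norm_triangle_ineq norm_triangle_ineq4)
      show ?thesis
        by (rule order_trans[OF tri]) (intro add_mono near, use rem[of k] rem'[of k] k in auto)
    qed
    also have "\<dots> = 2 * (L + Q) * e * e" by (simp add: e(2)[symmetric] algebra_simps power2_eq_square)
    finally have *: "norm ((D - D') k) \<le> 2 * (L + Q) * e * e" .
    have "norm ((D - D') k) = e / norm h * norm ((D - D') h)"
      using e by (simp add: k_def blinfun.scaleR_right)
    with * have "e * norm ((D - D') h) \<le> e * (2 * (L + Q) * e * norm h)"
      using False by (simp add: field_simps)
    then show ?thesis using e(1) by (simp add: e_def)
  qed simp
qed

lemma continuous_on_half_space_if_locally_controlled: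
  fixes g :: "real \<Rightarrow> 'a::real_normed_vector \<Rightarrow> 'b::real_normed_vector"
  assumes \<phi>: "continuous_on UNIV \<phi>" "\<phi> 0 = 0"
    and bound: "\<And>N. 0 \<le> N \<Longrightarrow> \<exists>L. \<forall>s\<in>{0..N}. \<forall>t\<in>{0..N}. \<forall>y z. norm (g s y - g t z) \<le> L * \<phi> (norm (y - z) + \<bar>s - t\<bar>)"
  shows "continuous_on ({0..} \<times> UNIV) (\<lambda>(t, z). g t z)"
proof -
  have "continuous (at (t, z) within {0..} \<times> UNIV) (\<lambda>(t, z). g t z)" if t: "0 \<le> t" for t z
  proof -
    let ?F = "at (t, z) within {0..} \<times> UNIV" and ?b = "\<lambda>p. \<phi> (norm (snd p - z) + \<bar>fst p - t\<bar>)"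
    obtain L where L: "\<And>s y. s \<in> {0..t+1} \<Longrightarrow> norm (g s y - g t z) \<le> L * \<phi> (norm (y - z) + \<bar>s - t\<bar>)"
      using bound[of "t + 1"] t by fastforce
    have "((\<lambda>p. g (fst p) (snd p) - g t z) \<longlongrightarrow> 0) ?F"
    proof (rule Lim_null_comparison)
      have "\<forall>\<^sub>F p in ?F. fst p < t + 1"
        by (rule order_tendstoD(2)[of fst t]) (auto intro!: tendsto_eq_intros)
      then have "\<forall>\<^sub>F p in ?F. p \<in> {0..} \<times> UNIV \<and> fst p < t + 1"
        by (auto simp: eventually_at_filter elim: eventually_mono)
      then show "\<forall>\<^sub>F p in ?F. norm (g (fst p) (snd p) - g t z) \<le> L * ?b p"
        by eventually_elim (use L in auto)
      have "((\<lambda>p. norm (snd p - z) + \<bar>fst p - t\<bar>) \<longlongrightarrow> norm (snd (t, z) - z) + \<bar>fst (t, z) - t\<bar>) ?F"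
        by (intro tendsto_intros)
      then have "(?b \<longlongrightarrow> \<phi> 0) ?F"
        by (intro continuous_on_tendsto_compose[OF \<phi>(1)]) auto
      from tendsto_mult_left[OF this, of L] show "((\<lambda>p. L * ?b p) \<longlongrightarrow> 0) ?F"
        by (simp add: \<phi>(2))
    qed
    then show ?thesis unfolding continuous_within
      by (subst LIM_zero_iff[symmetric]) (simp add: case_prod_beta)
  qed
  then show ?thesis unfolding continuous_on_eq_continuous_within by auto
qed

lemmas continuous_on_half_space_if_locally_lipschitz =
  continuous_on_half_space_if_locally_controlled[OF continuous_on_id refl]

locale bounded_ode = lipschitz_ode F K for F :: "real \<Rightarrow> 'a::banach \<Rightarrow> 'a" and K +
  assumes F_bound: "\<And>t z. 0 \<le> t \<Longrightarrow> norm (F t z) \<le> K t"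
begin

lemma flow_increment:
  assumes "0 \<le> s" "0 \<le> t" and B: "\<And>r. r \<in> {min s t..max s t} \<Longrightarrow> norm (F r (flow r t z) - c) \<le> B"
  shows "norm (flow s t z - z - (s - t) *\<^sub>R c) \<le> B * \<bar>s - t\<bar>"
proof -
  let ?S = "{min s t..max s t}"
  have "norm ((flow s t z - s *\<^sub>R c) - (flow t t z - t *\<^sub>R c)) \<le> B * norm (s - t)"
  proof (rule differentiable_bound[of ?S])
    show "convex ?S" by simp
    fix r assume r: "r \<in> ?S"
    have "((\<lambda>r. flow r t z - r *\<^sub>R c) has_vector_derivative F r (flow r t z) - c) (at r within ?S)"
      using r assms by (auto intro!: derivative_eq_intros solves_within[OF flow_solves])
    then show "((\<lambda>r. flow r t z - r *\<^sub>R c) has_derivative (\<lambda>h. h *\<^sub>R (F r (flow r t z) - c))) (at r within ?S)"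
      by (simp add: has_vector_derivative_def)
    show "onorm (\<lambda>h. h *\<^sub>R (F r (flow r t z) - c)) \<le> B"
      using B[OF r] by (simp add: onorm_scaleR_left onorm_id)
  qed auto
  then show ?thesis using assms by (simp add: flow_start algebra_simps)
qed

lemma flow_displacement:
  assumes "0 \<le> s" "0 \<le> t"
  shows "norm (flow s t z - z) \<le> K (max s t) * \<bar>s - t\<bar>"
proof -
  have "norm (flow s t z - z - (s - t) *\<^sub>R 0) \<le> K (max s t) * \<bar>s - t\<bar>"
  proof (rule flow_increment[OF assms])
    fix r assume r: "r \<in> {min s t..max s t}"
    then have "norm (F r (flow r t z)) \<le> K r" using assms by (intro F_bound) auto
    also have "\<dots> \<le> K (max s t)" using r assms by (intro K_mono) auto
    finally show "norm (F r (flow r t z) - 0) \<le> K (max s t)" by simp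
  qed
  then show ?thesis by simp
qed

text \<open>
  The solution through \<open>(s, y)\<close> passes at time \<open>t\<close> through a point close to \<open>y\<close>, so a change of the
  starting time amounts to a change of the starting point.
\<close>

lemma flow_to_0_lipschitz:
  assumes "0 \<le> s" "0 \<le> t" "s \<le> N" "t \<le> N"
  shows "norm (flow 0 s y - flow 0 t z) \<le> (norm (y - z) + K N * \<bar>s - t\<bar>) * exp (K N * N)"
proof -
  have KN: "K t \<le> K N" "K (max t s) \<le> K N" "0 < K t" "0 < K N"
    using assms K_mono[of t N] K_mono[of "max t s" N] K_pos[of N] K_pos[of t] by auto
  have "flow 0 s y = flow 0 t (flow t s y)" using assms by (simp add: flow_flow)
  then have "norm (flow 0 s y - flow 0 t z) \<le> norm (flow t s y - z) * exp (K (max 0 t) * \<bar>0 - t\<bar>)"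
    using flow_lipschitz[of 0 t "flow t s y" z] assms by simp
  also have "\<dots> \<le> (norm (y - z) + K N * \<bar>s - t\<bar>) * exp (K N * N)"
  proof (rule mult_mono)
    have "norm (flow t s y - z) \<le> norm (flow t s y - y) + norm (y - z)"
      using norm_triangle_ineq[of "flow t s y - y" "y - z"] by simp
    also have "norm (flow t s y - y) \<le> K (max t s) * \<bar>t - s\<bar>"
      using assms by (intro flow_displacement)
    also have "\<dots> \<le> K N * \<bar>t - s\<bar>" using KN by (intro mult_right_mono) auto
    finally show "norm (flow t s y - z) \<le> norm (y - z) + K N * \<bar>s - t\<bar>"
      by (simp add: abs_minus_commute)
    show "exp (K (max 0 t) * \<bar>0 - t\<bar>) \<le> exp (K N * N)"
      using KN assms by (auto intro!: mult_mono)
  qed (use KN in auto)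
  finally show ?thesis .
qed

end

text \<open>
  The linearisation error is required to be quadratic, which amounts to a Lipschitz derivative. The
  linearisation error of the flow is then quadratic too, and its size is explicit. For the
  self-consistent field this hypothesis holds because the charge density is Lipschitz.
\<close>

locale smooth_ode = bounded_ode F K for F :: "real \<Rightarrow> 'a::banach \<Rightarrow> 'a" and K +
  fixes DF :: "real \<Rightarrow> 'a \<Rightarrow> ('a \<Rightarrow>\<^sub>L 'a)"
  assumes DF_remainder: "\<And>t y z. 0 \<le> t \<Longrightarrow> norm (F t y - F t z - DF t z (y - z)) \<le> K t * (norm (y - z))\<^sup>2"
    and DF_bound: "\<And>t z. 0 \<le> t \<Longrightarrow> norm (DF t z) \<le> K t"
    and DF_cont: "continuous_on ({0..} \<times> UNIV) (\<lambda>(t, z). DF t z)"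
begin

text \<open>
  The derivative is the solution of the variational equation \<open>A' = DF A\<close>, a Lipschitz equation in the
  Banach space of bounded linear maps. The linearisation error \<open>y\<close> vanishes at time \<open>t\<close> and satisfies
  \<open>|y'| \<le> K |y| + c\<close> with \<open>c\<close> of order \<open>|h|\<^sup>2\<close>.
\<close>

lemma flow_has_space_derivative:
  assumes t: "0 \<le> t"
  shows "\<exists>D. \<forall>h. norm (flow 0 t (z + h) - flow 0 t z - blinfun_apply D h)
           \<le> (K t * exp (2 * K t * t) * t * exp (K t * t)) * (norm h)\<^sup>2"
proof -
  define G :: "real \<Rightarrow> ('a \<Rightarrow>\<^sub>L 'a) \<Rightarrow> ('a \<Rightarrow>\<^sub>L 'a)" where "G s = blinfun_compose (DF s (flow s t z))" for s
  have contc: "continuous_on ({0..} \<times> UNIV) (\<lambda>x. flow (fst x) t z)"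
    by (rule continuous_on_compose2[OF solves_cont[OF flow_solves[OF t]] continuous_on_fst[OF continuous_on_id]]) auto
  interpret lin: lipschitz_ode G K
  proof
    have "continuous_on ({0..} \<times> UNIV) (\<lambda>x. DF (fst x) (flow (fst x) t z))"
    proof -
      have "continuous_on ({0..} \<times> UNIV) ((\<lambda>(t, z). DF t z) \<circ> (\<lambda>x. (fst x, flow (fst x) t z)))"
        by (rule continuous_on_compose) (auto intro!: continuous_intros contc continuous_on_subset[OF DF_cont])
      then show ?thesis by (simp add: o_def)
    qed
    then have "continuous_on ({0..} \<times> UNIV) (\<lambda>x. DF (fst x) (flow (fst x) t z) o\<^sub>L snd x)"
      by (intro bounded_bilinear.continuous_on[OF bounded_bilinear_blinfun_compose] continuous_intros)
    then show "continuous_on ({0..} \<times> UNIV) (\<lambda>(s, A). G s A)"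
      by (simp add: G_def case_prod_beta)
    fix s :: real and A B :: "'a \<Rightarrow>\<^sub>L 'a" assume s: "0 \<le> s"
    have "norm (G s (A - B)) \<le> norm (DF s (flow s t z)) * norm (A - B)"
      unfolding G_def by (rule norm_blinfun_compose)
    also have "\<dots> \<le> K s * norm (A - B)" using DF_bound[OF s] by (intro mult_right_mono) auto
    finally show "norm (G s A - G s B) \<le> K s * norm (A - B)"
      by (simp add: G_def bounded_bilinear.diff_right[OF bounded_bilinear_blinfun_compose])
    show "norm (G s 0) \<le> K s" using K_pos[OF s] by (simp add: G_def)
  qed (use K_mono K_pos in auto)
  obtain A where A: "lin.solves A" "A t = id_blinfun" using lin.solution_exists[OF t] by blast
  have "norm (flow 0 t (z + h) - flow 0 t z - A 0 h)
           \<le> (K t * exp (2 * K t * t) * t * exp (K t * t)) * (norm h)\<^sup>2" for h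
  proof -
    define y where "y s = flow s t (z + h) - flow s t z - A s h" for s
    define y' where "y' s = F s (flow s t (z + h)) - F s (flow s t z) - DF s (flow s t z) (A s h)" for s
    define c where "c = K t * (norm h * exp (K t * t))\<^sup>2"
    have Kt: "0 < K t" using K_pos[OF t] .
    have "norm (y 0) \<le> (norm (y t) + (c * t - c * 0)) * exp (K t * (t - 0))"
    proof (rule gronwall_backward[where y' = y' and d = "\<lambda>s. c * s" and d' = "\<lambda>_. c"])
      fix s assume s: "s \<in> {0..t}"
      have "((\<lambda>s. A s h) has_vector_derivative G s (A s) h) (at s within {0..t})"
        using lin.solves_within[OF A(1), of s "{0..t}"] s
        unfolding has_vector_derivative_def
        by (auto intro!: derivative_eq_intros simp: blinfun.scaleR_left)
      then show "(y has_vector_derivative y' s) (at s within {0..t})"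
        using s t unfolding y_def y'_def
        by (intro has_vector_derivative_diff solves_within[OF flow_solves]) (auto simp: G_def)
      show "((\<lambda>s. c * s) has_real_derivative c) (at s within {0..t})"
        by (auto intro!: derivative_eq_intros)
      show "0 \<le> c" using Kt by (simp add: c_def)
      let ?d = "flow s t (z + h) - flow s t z"
      have "y' s = (F s (flow s t (z + h)) - F s (flow s t z) - DF s (flow s t z) ?d) + DF s (flow s t z) (y s)"
        by (simp add: y'_def y_def blinfun.diff_right)
      also have "norm \<dots> \<le> K s * (norm ?d)\<^sup>2 + K s * norm (y s)"
      proof (intro norm_triangle_le add_mono)
        show "norm (F s (flow s t (z + h)) - F s (flow s t z) - DF s (flow s t z) ?d) \<le> K s * (norm ?d)\<^sup>2"
          using s by (intro DF_remainder) auto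
        have "norm (DF s (flow s t z) (y s)) \<le> norm (DF s (flow s t z)) * norm (y s)" by (rule norm_blinfun)
        also have "\<dots> \<le> K s * norm (y s)" using s by (intro mult_right_mono DF_bound) auto
        finally show "norm (DF s (flow s t z) (y s)) \<le> K s * norm (y s)" .
      qed
      also have "\<dots> \<le> K t * (norm h * exp (K t * t))\<^sup>2 + K t * norm (y s)"
      proof (intro add_mono mult_mono power_mono)
        have "norm ?d \<le> norm (z + h - z) * exp (K (max s t) * \<bar>s - t\<bar>)" using s t by (intro flow_lipschitz) auto
        also have "\<dots> \<le> norm h * exp (K t * t)"
          using s Kt by (auto simp: max_def intro!: mult_left_mono)
        finally show "norm ?d \<le> norm h * exp (K t * t)" .
      qed (use s Kt K_mono[of s t] in auto)
      finally show "norm (y' s) \<le> K t * norm (y s) + c" by (simp add: c_def)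
    qed (use t Kt in auto)
    moreover have "y t = 0" using t by (simp add: y_def flow_start A(2))
    moreover have "c * t * exp (K t * t) = (K t * exp (2 * K t * t) * t * exp (K t * t)) * (norm h)\<^sup>2"
    proof -
      have "(exp (K t * t))\<^sup>2 = exp (2 * K t * t)" by (simp add: power2_eq_square flip: exp_add)
      then show ?thesis by (simp add: c_def power_mult_distrib)
    qed
    ultimately have "norm (y 0) \<le> (K t * exp (2 * K t * t) * t * exp (K t * t)) * (norm h)\<^sup>2"
      by (simp only: norm_zero add_0_left mult_zero_right diff_zero)
    then show ?thesis by (simp add: y_def)
  qed
  then show ?thesis by blast
qed

definition dflow :: "real \<Rightarrow> 'a \<Rightarrow> 'a \<Rightarrow>\<^sub>L 'a" where
  "dflow t z = (SOME D. \<forall>h. norm (flow 0 t (z + h) - flow 0 t z - blinfun_apply D h)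
           \<le> (K t * exp (2 * K t * t) * t * exp (K t * t)) * (norm h)\<^sup>2)"

lemma dflow_remainder:
  assumes t: "0 \<le> t" "t \<le> N"
  shows "norm (flow 0 t (z + h) - flow 0 t z - dflow t z h)
           \<le> (K N * exp (2 * K N * N) * N * exp (K N * N)) * (norm h)\<^sup>2"
proof -
  have "norm (flow 0 t (z + h) - flow 0 t z - dflow t z h)
           \<le> (K t * exp (2 * K t * t) * t * exp (K t * t)) * (norm h)\<^sup>2"
    using someI_ex[OF flow_has_space_derivative[OF t(1), of z]] unfolding dflow_def by blast
  also have "\<dots> \<le> (K N * exp (2 * K N * N) * N * exp (K N * N)) * (norm h)\<^sup>2"
  proof -
    have "K t \<le> K N" "0 < K t" "0 < K N" using K_mono[OF t] K_pos[of t] K_pos[of N] t by auto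
    moreover have "K t * t \<le> K N * N" using calculation t by (intro mult_mono) auto
    ultimately show ?thesis using t by (intro mult_right_mono mult_mono) auto
  qed
  finally show ?thesis .
qed

lemma dflow_continuous: "continuous_on ({0..} \<times> UNIV) (\<lambda>(t, z). dflow t z)"
proof (rule continuous_on_half_space_if_locally_controlled[where \<phi> = sqrt])
  fix N :: real assume N0: "0 \<le> N"
  then have N: "0 < K N" by (rule K_pos)
  define L where "L = (1 + K N) * exp (K N * N)"
  define Q where "Q = K N * exp (2 * K N * N) * N * exp (K N * N)"
  have LQ: "0 \<le> L" "0 \<le> Q" using N N0 by (auto simp: L_def Q_def)
  have "norm (dflow s y - dflow t z) \<le> 2 * (L + Q) * sqrt (norm (y - z) + \<bar>s - t\<bar>)"
    if st: "s \<in> {0..N}" "t \<in> {0..N}" for s t y z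
  proof (cases "y = z \<and> s = t")
    case False
    show ?thesis
    proof (rule derivatives_close_if_functions_close[where g = "flow 0 s" and g' = "flow 0 t" and z = y and z' = z])
      show "0 < norm (y - z) + \<bar>s - t\<bar>" using False by (auto simp: add_pos_nonneg add_nonneg_pos)
      fix h
      have "norm (flow 0 s (y + h) - flow 0 t (z + h))
          \<le> (norm (y + h - (z + h)) + K N * \<bar>s - t\<bar>) * exp (K N * N)"
        using st by (intro flow_to_0_lipschitz) auto
      also have "\<dots> \<le> ((1 + K N) * (norm (y - z) + \<bar>s - t\<bar>)) * exp (K N * N)"
        using N by (intro mult_right_mono) (auto simp: algebra_simps)
      finally show "norm (flow 0 s (y + h) - flow 0 t (z + h)) \<le> L * (norm (y - z) + \<bar>s - t\<bar>)"
        by (simp add: L_def mult_ac)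
      show "norm (flow 0 s (y + h) - flow 0 s y - dflow s y h) \<le> Q * (norm h)\<^sup>2"
        "norm (flow 0 t (z + h) - flow 0 t z - dflow t z h) \<le> Q * (norm h)\<^sup>2"
        unfolding Q_def by (rule dflow_remainder; use st in auto)+
    qed (use LQ in auto)
  qed simp
  then show "\<exists>L. \<forall>s\<in>{0..N}. \<forall>t\<in>{0..N}. \<forall>y z. norm (dflow s y - dflow t z) \<le> L * sqrt (norm (y - z) + \<bar>s - t\<bar>)"
    by blast
qed (auto intro!: continuous_intros)

text \<open>
  Solutions that pass near \<open>(t, z)\<close> have velocity close to \<open>F t z\<close> there.
\<close>

lemma flow_derivative_in_start:
  assumes t: "0 \<le> t"
  shows "((\<lambda>(s, y). flow t s y) has_derivative (\<lambda>(\<tau>, h). h - \<tau> *\<^sub>R F t z)) (at (t, z) within {0..} \<times> UNIV)"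
  unfolding has_derivative_within_alt
proof (intro conjI allI impI)
  show "bounded_linear (\<lambda>(\<tau>, h). h - \<tau> *\<^sub>R F t z)"
    unfolding case_prod_beta by (intro bounded_linear_intros)
  fix e :: real assume e: "0 < e"
  have "\<exists>d>0. \<forall>p\<in>{0..}\<times>UNIV. dist p (t, z) < d \<longrightarrow> dist (case p of (t, z) \<Rightarrow> F t z) (case (t, z) of (t, z) \<Rightarrow> F t z) < e"
    using cont_F t e unfolding continuous_on_iff by auto
  then obtain d where d: "d > 0" and
    d': "\<And>s y. 0 \<le> s \<Longrightarrow> dist (s, y) (t, z) < d \<Longrightarrow> norm (F s y - F t z) < e"
    by (force simp: dist_norm)
  define M where "M = K (t + 1)"
  have M: "M > 0" using K_pos t by (simp add: M_def)
  define \<delta> where "\<delta> = min 1 (d / (2 * (2 + M)))"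
  have \<delta>: "\<delta> > 0" "\<delta> \<le> 1" "(2 + M) * \<delta> < d"
  proof -
    have "(2 + M) * \<delta> \<le> (2 + M) * (d / (2 * (2 + M)))"
      using M by (intro mult_left_mono) (auto simp: \<delta>_def)
    also have "\<dots> = d / 2" using M by (simp add: divide_simps)
    finally show "(2 + M) * \<delta> < d" using d by simp
  qed (use d M in \<open>auto simp: \<delta>_def\<close>)
  show "\<exists>d>0. \<forall>p\<in>{0..} \<times> UNIV. norm (p - (t, z)) < d \<longrightarrow>
     norm ((case p of (s, y) \<Rightarrow> flow t s y) - (case (t, z) of (s, y) \<Rightarrow> flow t s y) -
       (case p - (t, z) of (\<tau>, h) \<Rightarrow> h - \<tau> *\<^sub>R F t z)) \<le> e * norm (p - (t, z))"
  proof (intro exI[of _ \<delta>] conjI ballI impI)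
    fix p assume p: "p \<in> {0..} \<times> UNIV" "norm (p - (t, z)) < \<delta>"
    obtain s y where sy: "p = (s, y)" by force
    have s: "0 \<le> s" and near: "norm (s - t, y - z) < \<delta>" using p sy by auto
    have st: "\<bar>s - t\<bar> < \<delta>" and yz: "norm (y - z) < \<delta>"
      using near norm_fst_le[of "s - t" "y - z"] norm_snd_le[of "y - z" "s - t"] by auto
    have "norm (flow t s y - y - (t - s) *\<^sub>R F t z) \<le> e * \<bar>t - s\<bar>"
    proof (rule flow_increment[OF t s])
      fix r assume r: "r \<in> {min t s..max t s}"
      have r0: "0 \<le> r" and rs: "\<bar>r - s\<bar> \<le> \<bar>t - s\<bar>" and rt: "\<bar>r - t\<bar> \<le> \<bar>s - t\<bar>" using r t s by auto
      have "norm (flow r s y - y) \<le> K (max r s) * \<bar>r - s\<bar>" by (rule flow_displacement[OF r0 s])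
      also have "\<dots> \<le> M * \<delta>"
      proof (rule mult_mono)
        show "K (max r s) \<le> M" unfolding M_def by (rule K_mono) (use r t s st \<delta> in auto)
      qed (use rs st M in auto)
      finally have 1: "norm (flow r s y - y) \<le> M * \<delta>" .
      have "dist (r, flow r s y) (t, z) \<le> \<bar>r - t\<bar> + norm (flow r s y - z)"
        unfolding dist_norm using norm_Pair_le[of "r - t" "flow r s y - z"] by simp
      also have "norm (flow r s y - z) \<le> norm (flow r s y - y) + norm (y - z)"
        using norm_triangle_ineq[of "flow r s y - y" "y - z"] by simp
      finally have "dist (r, flow r s y) (t, z) \<le> \<delta> + (M * \<delta> + \<delta>)"
        using 1 yz st rt by linarith
      then have "dist (r, flow r s y) (t, z) < d" using \<delta>(3) by (simp add: algebra_simps)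
      then show "norm (F r (flow r s y) - F t z) \<le> e" using d'[OF r0] by (simp add: less_imp_le)
    qed
    also have "\<dots> \<le> e * norm (p - (t, z))"
      using norm_fst_le[of "s - t" "y - z"] e by (simp add: sy abs_minus_commute)
    finally show "norm ((case p of (s, y) \<Rightarrow> flow t s y) - (case (t, z) of (s, y) \<Rightarrow> flow t s y) -
       (case p - (t, z) of (\<tau>, h) \<Rightarrow> h - \<tau> *\<^sub>R F t z)) \<le> e * norm (p - (t, z))"
      using t by (simp add: sy flow_start algebra_simps)
  qed (use \<delta> in auto)
qed

text \<open>
  Since \<open>flow 0 s y = flow 0 t (flow t s y)\<close>, differentiability in space at the one time \<open>t\<close> and the
  previous lemma give the joint derivative by the chain rule. It vanishes in the direction \<open>(1, F t z)\<close>: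
  this is the transport equation.
\<close>

lemma flow_to_0_derivative:
  assumes t: "0 \<le> t"
  shows "((\<lambda>(s, y). flow 0 s y) has_derivative (\<lambda>(\<tau>, h). dflow t z (h - \<tau> *\<^sub>R F t z)))
    (at (t, z) within {0..} \<times> UNIV)"
proof -
  have space: "(flow 0 t has_derivative dflow t z) (at z)"
    by (rule has_derivative_if_quadratic_remainder[OF blinfun.bounded_linear_right])
       (use dflow_remainder[of t t z "_ - z"] t in auto)
  have "((\<lambda>p. flow 0 t (case p of (s, y) \<Rightarrow> flow t s y)) has_derivative
      (\<lambda>p. dflow t z (case p of (\<tau>, h) \<Rightarrow> h - \<tau> *\<^sub>R F t z))) (at (t, z) within {0..} \<times> UNIV)"
    by (rule has_derivative_compose[OF flow_derivative_in_start[OF t]]) (use space t in \<open>simp add: flow_start\<close>)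
  then have "((\<lambda>(s, y). flow 0 s y) has_derivative
      (\<lambda>p. dflow t z (case p of (\<tau>, h) \<Rightarrow> h - \<tau> *\<^sub>R F t z))) (at (t, z) within {0..} \<times> UNIV)"
    by (rule has_derivative_transform[rotated 2]) (use t in \<open>auto simp: flow_flow\<close>)
  then show ?thesis by (simp only: case_prod_beta')
qed

end

section \<open>Relativistic velocity\<close>

lemma sqrt_one_plus_square_eq_norm: "sqrt (1 + (norm v)\<^sup>2) = norm (1::real, v)"
  by (simp add: norm_Pair)

lemma sqrt_one_plus_square_lipschitz:
  "\<bar>sqrt (1 + (norm v)\<^sup>2) - sqrt (1 + (norm w)\<^sup>2)\<bar> \<le> norm (v - w)"
  unfolding sqrt_one_plus_square_eq_norm
  using norm_triangle_ineq3[of "(1::real, v)" "(1, w)"] by (simp add: norm_Pair)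

lemma sqrt_one_plus_square_ge: "1 \<le> sqrt (1 + (norm v)\<^sup>2)" "norm v < sqrt (1 + (norm v)\<^sup>2)"
  using real_sqrt_less_mono[of "(norm v)\<^sup>2" "1 + (norm v)\<^sup>2"] by auto

lemma norm_vhat_less_1: "norm (vhat v) < 1"
proof -
  have "0 < sqrt (1 + (norm v)\<^sup>2)" using sqrt_one_plus_square_ge(1)[of v] by linarith
  then show ?thesis using sqrt_one_plus_square_ge(2)[of v]
    by (simp add: vhat_def divide_simps del: real_sqrt_gt_0_iff)
qed

lemma abs_vhat_less_1: "\<bar>fst (vhat v)\<bar> < 1" "\<bar>snd (vhat v)\<bar> < 1"
  using norm_vhat_less_1[of v] norm_fst_le[of "fst (vhat v)" "snd (vhat v)"]
    norm_snd_le[of "snd (vhat v)" "fst (vhat v)"] by auto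

lemma vhat_lipschitz: "norm (vhat v - vhat w) \<le> 2 * norm (v - w)"
proof -
  define a b where "a = sqrt (1 + (norm v)\<^sup>2)" and "b = sqrt (1 + (norm w)\<^sup>2)"
  have ab: "1 \<le> a" "1 \<le> b" "norm w < b" "\<bar>a - b\<bar> \<le> norm (v - w)"
    using sqrt_one_plus_square_ge sqrt_one_plus_square_lipschitz by (auto simp: a_def b_def)
  have "vhat v - vhat w = (v - w) /\<^sub>R a + ((b - a) / a) *\<^sub>R (w /\<^sub>R b)"
    using ab by (simp add: vhat_def a_def[symmetric] b_def[symmetric] scaleR_diff_right scaleR_diff_left
        diff_divide_distrib inverse_eq_divide)
  also have "norm \<dots> \<le> norm (v - w) / a + \<bar>b - a\<bar> / a * (norm w / b)"
    by (rule norm_triangle_le) (use ab in \<open>simp add: divide_inverse abs_mult\<close>)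
  also have "\<dots> \<le> norm (v - w) / 1 + norm (v - w) / 1 * 1"
    using ab by (intro add_mono mult_mono frac_le) (auto simp: abs_minus_commute)
  finally show ?thesis by simp
qed

lemma vhat_continuous: "continuous_on S vhat"
proof -
  have "continuous_on UNIV vhat"
    by (rule lipschitz_on_continuous_on[of 2]) (rule lipschitz_onI, auto simp: dist_norm vhat_lipschitz)
  then show ?thesis using continuous_on_subset by blast
qed

section \<open>Finite propagation speed and lower bounds for Lebesgue norms\<close>

text \<open>
  The set \<open>K\<close> is a compact backward domain of dependence: following the transport direction back in
  time one never leaves it. If \<open>g\<close> were positive at the apex, \<open>g - e t\<close> would still be positive there for
  small \<open>e > 0\<close>, and would attain its maximum over \<open>K\<close> at a positive time. But it increases at rate \<open>e\<close>
  backwards along the transport direction.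
\<close>

lemma backward_cone_maximum_principle:
  fixes g :: "real \<times> real \<times> real \<times> real \<Rightarrow> real" and b :: "real \<times> real \<times> real \<times> real \<Rightarrow> real \<times> real \<times> real"
    and t1 x1 M :: real and w :: "real \<times> real"
  defines "K \<equiv> {(t, x, v). 0 \<le> t \<and> t \<le> t1 \<and> \<bar>x - x1\<bar> \<le> t1 - t \<and> norm (v - w) \<le> M * (t1 - t)}"
  assumes t1: "0 \<le> t1" and M: "0 \<le> M"
    and deriv: "\<And>p. p \<in> {0..} \<times> UNIV \<Longrightarrow> (g has_derivative D p) (at p within {0..} \<times> UNIV)"
    and transport: "\<And>p. p \<in> {0..} \<times> UNIV \<Longrightarrow> D p (1, b p) = 0"
    and speed: "\<And>p. p \<in> K \<Longrightarrow> \<bar>fst (b p)\<bar> \<le> 1" "\<And>p. p \<in> K \<Longrightarrow> norm (snd (b p)) \<le> M"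
    and initial: "\<And>x v. (0, x, v) \<in> K \<Longrightarrow> g (0, x, v) \<le> 0"
  shows "g (t1, x1, w) \<le> 0"
proof (rule ccontr)
  assume "\<not> g (t1, x1, w) \<le> 0"
  then have pos: "0 < g (t1, x1, w)" by simp
  define e where "e = g (t1, x1, w) / 2 / (t1 + 1)"
  define h where "h p = g p - e * fst p" for p
  have e: "0 < e" using pos t1 by (simp add: e_def)
  have top: "0 < h (t1, x1, w)"
  proof -
    have "e * t1 \<le> e * (t1 + 1)" using e by simp
    also have "\<dots> = g (t1, x1, w) / 2 * (t1 + 1) / (t1 + 1)" by (simp only: e_def times_divide_eq_left)
    also have "\<dots> = g (t1, x1, w) / 2" by (rule nonzero_mult_div_cancel_right) (use t1 in simp)
    finally show ?thesis using pos by (simp add: h_def)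
  qed
  have in_K: "(t1, x1, w) \<in> K" using t1 by (simp add: K_def)
  have "compact K"
  proof (rule compact_eq_bounded_closed[THEN iffD2], rule conjI)
    have "K \<subseteq> {0..t1} \<times> cball x1 t1 \<times> cball w (M * t1)"
    proof
      fix p assume p: "p \<in> K"
      obtain t x v where [simp]: "p = (t, x, v)" by (metis prod.collapse)
      have "M * (t1 - t) \<le> M * t1" using p M by (intro mult_left_mono) (auto simp: K_def)
      then show "p \<in> {0..t1} \<times> cball x1 t1 \<times> cball w (M * t1)"
        using p by (auto simp: K_def dist_norm norm_minus_commute abs_minus_commute)
    qed
    then show "bounded K"
      by (rule bounded_subset[rotated]) (intro bounded_Times bounded_closed_interval bounded_cball)
    have "K = {p. 0 \<le> fst p} \<inter> {p. fst p \<le> t1} \<inter> {p. \<bar>fst (snd p) - x1\<bar> \<le> t1 - fst p}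
        \<inter> {p. norm (snd (snd p) - w) \<le> M * (t1 - fst p)}"
      by (auto simp: K_def)
    then show "closed K"
      by (rule ssubst) (intro closed_Int closed_Collect_le continuous_intros)
  qed
  moreover have "continuous_on K h"
  proof -
    have "continuous_on ({0..} \<times> UNIV) g"
      unfolding continuous_on_eq_continuous_within using has_derivative_continuous[OF deriv] by simp
    then have "continuous_on K g" by (rule continuous_on_subset) (auto simp: K_def)
    then show ?thesis unfolding h_def[abs_def] by (intro continuous_intros)
  qed
  ultimately obtain p where p: "p \<in> K" and max: "\<And>q. q \<in> K \<Longrightarrow> h q \<le> h p"
    using continuous_attains_sup[of K h] in_K by blast
  obtain t x v where pe: "p = (t, x, v)" by (metis prod.collapse)
  have t: "0 \<le> t" "t \<le> t1" using p by (auto simp: pe K_def)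
  have "t \<noteq> 0"
  proof
    assume "t = 0"
    then have "h p \<le> 0" using initial[of x v] p by (simp add: h_def pe)
    then show False using max[OF in_K] top by linarith
  qed
  then have t_pos: "0 < t" using t by simp
  \<comment> \<open>The path back in time along the transport direction, starting at the maximum.\<close>
  define q where "q r = p + r *\<^sub>R (- 1, - b p)" for r
  have q0: "q 0 = p" by (simp add: q_def prod_eq_iff)
  have q_in: "q r \<in> K" if r: "0 \<le> r" "r \<le> t" for r
  proof -
    have "\<bar>x - r * fst (b p) - x1\<bar> \<le> \<bar>x - x1\<bar> + r * \<bar>fst (b p)\<bar>"
      using r abs_triangle_ineq4[of "x - x1" "r * fst (b p)"] by (simp add: abs_mult algebra_simps)
    also have "\<dots> \<le> (t1 - t) + r * 1"
      using p speed(1)[OF p] r by (intro add_mono mult_left_mono) (auto simp: K_def pe)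
    finally have 1: "\<bar>x - r * fst (b p) - x1\<bar> \<le> t1 - (t - r)" by simp
    have "norm (v - r *\<^sub>R snd (b p) - w) \<le> norm (v - w) + r * norm (snd (b p))"
      using r norm_triangle_ineq4[of "v - w" "r *\<^sub>R snd (b p)"] by (simp add: algebra_simps)
    also have "\<dots> \<le> M * (t1 - t) + r * M"
      using p speed(2)[OF p] r by (intro add_mono mult_left_mono) (auto simp: K_def pe)
    finally have 2: "norm (v - r *\<^sub>R snd (b p) - w) \<le> M * (t1 - (t - r))" by (simp add: algebra_simps)
    have "q r = (t - r, x - r * fst (b p), v - r *\<^sub>R snd (b p))"
      by (simp add: q_def pe prod_eq_iff)
    then show ?thesis using 1 2 r t by (simp add: K_def)
  qed
  have dom: "p \<in> {0..} \<times> UNIV" using t by (simp add: pe)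
  have "((\<lambda>r. h (q r)) has_derivative (\<lambda>s. s * e)) (at 0 within {0..t})"
  proof -
    have dq: "(q has_derivative (\<lambda>s. s *\<^sub>R (- 1, - b p))) (at 0 within {0..t})"
      unfolding q_def[abs_def] by (auto intro!: derivative_eq_intros)
    have "q ` {0..t} \<subseteq> {0..} \<times> UNIV" using q_in by (force simp: K_def)
    then have "(g has_derivative D (q 0)) (at (q 0) within q ` {0..t})"
      unfolding q0 by (rule has_derivative_subset[OF deriv[OF dom]])
    from has_derivative_in_compose[OF dq this]
    have dg: "((\<lambda>r. g (q r)) has_derivative (\<lambda>s. D p (s *\<^sub>R (- 1, - b p)))) (at 0 within {0..t})"
      by (simp add: q0)
    have lin: "bounded_linear (D p)" using deriv[OF dom] by (rule has_derivative_bounded_linear)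
    have "D p (s *\<^sub>R (- 1, - b p)) = 0" for s
    proof -
      have eq: "s *\<^sub>R (- 1, - b p) = (- s) *\<^sub>R (1, b p)" by simp
      show ?thesis unfolding eq linear_scale[OF bounded_linear.linear[OF lin]] transport[OF dom] by simp
    qed
    then have "((\<lambda>r. g (q r) - e * (t - r)) has_derivative (\<lambda>s. s * e)) (at 0 within {0..t})"
      using dg by (auto intro!: derivative_eq_intros)
    then show ?thesis by (simp add: h_def q_def pe)
  qed
  then have "((\<lambda>r. h (q r)) has_real_derivative e) (at 0 within {0..t})"
    by (simp add: has_field_derivative_def mult_commute_abs)
  from has_real_derivative_pos_inc_right[OF this e]
  obtain d where d: "0 < d" "\<And>r. 0 < r \<Longrightarrow> r \<in> {0..t} \<Longrightarrow> r < d \<Longrightarrow> h (q 0) < h (q r)" by auto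
  define r where "r = min t (d / 2)"
  have r: "0 < r" "r \<le> t" "r < d" using d(1) t_pos by (auto simp: r_def)
  have "h (q 0) < h (q r)" using d(2)[of r] r by simp
  moreover have "h (q r) \<le> h p" using max q_in r by simp
  ultimately show False by (simp add: q0)
qed

lemma C1_on_continuous: "C1_on S g \<Longrightarrow> continuous_on S g"
  unfolding C1_on_def continuous_on_eq_continuous_within by (auto dest: has_derivative_continuous)

lemma bounded_on_compact_rectangle:
  fixes G :: field
  assumes "C1_on ({0..} \<times> UNIV) (\<lambda>(t, x). G t x)"
  shows "\<exists>C. \<forall>t\<in>{0..a}. \<forall>x\<in>{b..c}. \<bar>G t x\<bar> \<le> C"
proof -
  have "compact ((\<lambda>(t, x). G t x) ` ({0..a} \<times> {b..c}))"
    by (intro compact_continuous_image compact_Times compact_Icc continuous_on_subset[OF C1_on_continuous[OF assms]]) auto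
  then obtain C where "\<forall>y \<in> (\<lambda>(t, x). G t x) ` ({0..a} \<times> {b..c}). norm y \<le> C"
    using compact_imp_bounded bounded_iff by blast
  then show ?thesis by (intro exI[of _ C]) auto
qed

text \<open>
  The partial derivatives in the Vlasov equation are values of one total derivative of \<open>f\<close>, so the
  equation states that \<open>f\<close> is stationary in the direction of the characteristics.
\<close>

lemma solution_transport_derivative:
  assumes "monocharge_RVM_solution f0 E20 B0 f E1 E2 B"
  obtains D where
    "\<And>p. p \<in> {0..} \<times> UNIV \<Longrightarrow> ((\<lambda>(t, x, v). f t x v) has_derivative blinfun_apply (D p)) (at p within {0..} \<times> UNIV)"
    "\<And>t x v. 0 \<le> t \<Longrightarrow> D (t, x, v) (1, fst (vhat v), E1 t x + snd (vhat v) * B t x, E2 t x - fst (vhat v) * B t x) = 0"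
proof -
  let ?f = "\<lambda>(t, x, v). f t x v"
  have "C1_on ({0..} \<times> UNIV) ?f" using assms unfolding monocharge_RVM_solution_def by (elim conjE)
  then obtain D where "\<forall>p\<in>{0..} \<times> UNIV. (?f has_derivative blinfun_apply (D p)) (at p within {0..} \<times> UNIV)"
    unfolding C1_on_def by (elim exE conjE)
  note D = this[rule_format]
  have "D (t, x, v) (1, fst (vhat v), E1 t x + snd (vhat v) * B t x, E2 t x - fst (vhat v) * B t x) = 0"
    if t: "0 \<le> t" for t x v
  proof -
    obtain v1 v2 where v: "v = (v1, v2)" by force
    let ?D = "D (t, x, v1, v2)"
    have line: "((\<lambda>s. ?f (c s)) has_derivative (\<lambda>h. h *\<^sub>R ?D c')) (at s0 within S)"
      if "c s0 = (t, x, v1, v2)" "(c has_derivative (\<lambda>h. h *\<^sub>R c')) (at s0 within S)" "c ` S \<subseteq> {0..} \<times> UNIV"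
      for c s0 c' and S :: "real set"
    proof -
      have "(?f has_derivative blinfun_apply ?D) (at (c s0) within c ` S)"
        unfolding that(1) by (rule has_derivative_subset[OF D that(3)]) (use t in simp)
      from has_derivative_in_compose[OF that(2) this] show ?thesis
        by (simp only: blinfun.scaleR_right)
    qed
    have 1: "time_deriv (\<lambda>s. f s x (v1, v2)) t = ?D (1, 0, 0, 0)"
    proof -
      have "at t within {0..} \<noteq> bot" by (rule at_within_half_line_nontrivial[OF t])
      moreover have "((\<lambda>s. ?f (s, x, v1, v2)) has_derivative (\<lambda>h. h *\<^sub>R ?D (1, 0, 0, 0))) (at t within {0..})"
        by (rule line) (use t in \<open>auto intro!: derivative_eq_intros simp: fun_eq_iff prod_eq_iff\<close>)
      ultimately show ?thesis unfolding time_deriv_def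
        by (intro vector_derivative_within) (simp_all add: has_vector_derivative_def)
    qed
    have 2: "deriv (\<lambda>y. f t y (v1, v2)) x = ?D (0, 1, 0, 0)"
    proof (rule DERIV_imp_deriv)
      have "((\<lambda>y. ?f (t, y, v1, v2)) has_derivative (\<lambda>h. h *\<^sub>R ?D (0, 1, 0, 0))) (at x)"
        by (rule line) (use t in \<open>auto intro!: derivative_eq_intros simp: fun_eq_iff prod_eq_iff\<close>)
      then show "((\<lambda>y. f t y (v1, v2)) has_real_derivative ?D (0, 1, 0, 0)) (at x)"
        by (simp add: has_field_derivative_def mult_commute_abs)
    qed
    have 3: "deriv (\<lambda>u. f t x (u, v2)) v1 = ?D (0, 0, 1, 0)"
    proof (rule DERIV_imp_deriv)
      have "((\<lambda>u. ?f (t, x, u, v2)) has_derivative (\<lambda>h. h *\<^sub>R ?D (0, 0, 1, 0))) (at v1)"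
        by (rule line) (use t in \<open>auto intro!: derivative_eq_intros simp: fun_eq_iff prod_eq_iff\<close>)
      then show "((\<lambda>u. f t x (u, v2)) has_real_derivative ?D (0, 0, 1, 0)) (at v1)"
        by (simp add: has_field_derivative_def mult_commute_abs)
    qed
    have 4: "deriv (\<lambda>u. f t x (v1, u)) v2 = ?D (0, 0, 0, 1)"
    proof (rule DERIV_imp_deriv)
      have "((\<lambda>u. ?f (t, x, v1, u)) has_derivative (\<lambda>h. h *\<^sub>R ?D (0, 0, 0, 1))) (at v2)"
        by (rule line) (use t in \<open>auto intro!: derivative_eq_intros simp: fun_eq_iff prod_eq_iff\<close>)
      then show "((\<lambda>u. f t x (v1, u)) has_real_derivative ?D (0, 0, 0, 1)) (at v2)"
        by (simp add: has_field_derivative_def mult_commute_abs)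
    qed
    have "\<forall>t\<ge>0. \<forall>x v1 v2. time_deriv (\<lambda>s. f s x (v1, v2)) t
        + fst (vhat (v1, v2)) * deriv (\<lambda>y. f t y (v1, v2)) x
        + (E1 t x + snd (vhat (v1, v2)) * B t x) * deriv (\<lambda>u. f t x (u, v2)) v1
        + (E2 t x - fst (vhat (v1, v2)) * B t x) * deriv (\<lambda>u. f t x (v1, u)) v2 = 0"
      using assms unfolding monocharge_RVM_solution_def by (elim conjE)
    note pde = this[rule_format, OF t, of x v1 v2]
    have e: "(1::real, a, p, q) = (1, 0, 0, 0) + a *\<^sub>R (0, 1, 0, 0) + p *\<^sub>R (0, 0, 1, 0) + q *\<^sub>R (0, 0, 0, 1)" for a p q :: real
      by simp
    have lin: "?D (1, a, p, q) = ?D (1, 0, 0, 0) + a * ?D (0, 1, 0, 0) + p * ?D (0, 0, 1, 0) + q * ?D (0, 0, 0, 1)" for a p q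
      using arg_cong[OF e[of a p q], of "blinfun_apply ?D"]
      by (simp only: blinfun.add_right blinfun.scaleR_right real_scaleR_def)
    show ?thesis
      using pde lin[of "fst (vhat (v1, v2))" "E1 t x + snd (vhat (v1, v2)) * B t x" "E2 t x - fst (vhat (v1, v2)) * B t x"]
      unfolding 1 2 3 4 v by linarith
  qed
  with D show ?thesis by (rule that)
qed

text \<open>
  Because \<open>|vhat| < 1\<close>, the force is bounded on a compact set of \<open>(t, x)\<close> by a constant \<open>M\<close> that does not
  depend on \<open>v\<close>. Hence a cone that is also bounded in velocity is a domain of dependence, and the maximum
  principle applies to \<open>f\<close> and to \<open>- f\<close> whatever the support in \<open>v\<close> may be.
\<close>

lemma finite_propagation_speed:
  assumes sol: "monocharge_RVM_solution f0 E20 B0 f E1 E2 B"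
    and supp: "\<And>x v. R < x \<Longrightarrow> f0 x v = 0" and t: "0 \<le> t" and x: "R + t < x"
  shows "f t x v = 0"
proof -
  let ?f = "\<lambda>(t, x, v). f t x v"
  let ?b = "\<lambda>(t, x, v). (fst (vhat v), E1 t x + snd (vhat v) * B t x, E2 t x - fst (vhat v) * B t x)"
  obtain D where D: "\<And>p. p \<in> {0..} \<times> UNIV \<Longrightarrow> (?f has_derivative blinfun_apply (D p)) (at p within {0..} \<times> UNIV)"
    and tr: "\<And>t x v. 0 \<le> t \<Longrightarrow> D (t, x, v) (1, fst (vhat v), E1 t x + snd (vhat v) * B t x, E2 t x - fst (vhat v) * B t x) = 0"
    using solution_transport_derivative[OF sol] by metis
  have "C1_on ({0..} \<times> UNIV) (\<lambda>(t, x). E1 t x) \<and> C1_on ({0..} \<times> UNIV) (\<lambda>(t, x). E2 t x) \<and> C1_on ({0..} \<times> UNIV) (\<lambda>(t, x). B t x)"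
    using sol unfolding monocharge_RVM_solution_def by (elim conjE, intro conjI)
  then have C1: "C1_on ({0..} \<times> UNIV) (\<lambda>(t, x). E1 t x)" "C1_on ({0..} \<times> UNIV) (\<lambda>(t, x). E2 t x)" "C1_on ({0..} \<times> UNIV) (\<lambda>(t, x). B t x)"
    by blast+
  obtain M1 where M1: "\<And>s y. s \<in> {0..t} \<Longrightarrow> y \<in> {x-t..x+t} \<Longrightarrow> \<bar>E1 s y\<bar> \<le> M1"
    using bounded_on_compact_rectangle[OF C1(1), of t "x-t" "x+t"] by blast
  obtain M2 where M2: "\<And>s y. s \<in> {0..t} \<Longrightarrow> y \<in> {x-t..x+t} \<Longrightarrow> \<bar>E2 s y\<bar> \<le> M2"
    using bounded_on_compact_rectangle[OF C1(2), of t "x-t" "x+t"] by blast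
  obtain M3 where M3: "\<And>s y. s \<in> {0..t} \<Longrightarrow> y \<in> {x-t..x+t} \<Longrightarrow> \<bar>B s y\<bar> \<le> M3"
    using bounded_on_compact_rectangle[OF C1(3), of t "x-t" "x+t"] by blast
  define M where "M = M1 + M2 + 2 * M3"
  have v1: "\<bar>fst (vhat u)\<bar> \<le> 1" "\<bar>snd (vhat u)\<bar> \<le> 1" for u
    using abs_vhat_less_1[of u] by auto
  have M0: "0 \<le> M" using order_trans[OF abs_ge_zero M1[of 0 x]] order_trans[OF abs_ge_zero M2[of 0 x]]
      order_trans[OF abs_ge_zero M3[of 0 x]] t by (simp add: M_def)
  let ?K = "{(s, y, u). 0 \<le> s \<and> s \<le> t \<and> \<bar>y - x\<bar> \<le> t - s \<and> norm (u - v) \<le> M * (t - s)}"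
  have force: "norm (snd (?b p)) \<le> M" if "p \<in> ?K" for p
  proof -
    obtain s y u where p: "p = (s, y, u)" by (metis prod.collapse)
    have sy: "s \<in> {0..t}" "y \<in> {x-t..x+t}" using that by (auto simp: p)
    have B: "\<bar>a * B s y\<bar> \<le> M3" if "\<bar>a\<bar> \<le> 1" for a
    proof -
      have "\<bar>a\<bar> * \<bar>B s y\<bar> \<le> 1 * M3" using that M3[OF sy] by (intro mult_mono) auto
      then show ?thesis by (simp add: abs_mult)
    qed
    have "norm (snd (?b p)) \<le> \<bar>E1 s y + snd (vhat u) * B s y\<bar> + \<bar>E2 s y - fst (vhat u) * B s y\<bar>"
      using norm_Pair_le[of "E1 s y + snd (vhat u) * B s y" "E2 s y - fst (vhat u) * B s y"] by (simp add: p)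
    also have "\<dots> \<le> M"
      using M1[OF sy] M2[OF sy] B[OF v1(1)[of u]] B[OF v1(2)[of u]] by (simp add: M_def)
    finally show ?thesis .
  qed
  have zero: "f 0 y u = 0" if "(0, y, u) \<in> ?K" for y u
  proof -
    have "R < y" using that x by auto
    moreover have "\<forall>x v. f 0 x v = f0 x v" using sol unfolding monocharge_RVM_solution_def by (elim conjE)
    ultimately show ?thesis using supp by metis
  qed
  have tr': "D p (1, ?b p) = 0" if "p \<in> {0..} \<times> UNIV" for p
  proof -
    obtain s y u where p: "p = (s, y, u)" by (metis prod.collapse)
    show ?thesis using tr[of s y u] that by (simp add: p)
  qed
  have speed: "\<bar>fst (?b p)\<bar> \<le> 1" for p by (simp add: case_prod_beta' v1)
  have "?f (t, x, v) \<le> 0"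
  proof (rule backward_cone_maximum_principle[OF t M0 D tr' speed force])
    show "?f (0, y, u) \<le> 0" if "(0, y, u) \<in> ?K" for y u using zero[OF that] by simp
  qed
  moreover have "- ?f (t, x, v) \<le> 0"
  proof (rule backward_cone_maximum_principle[OF t M0 has_derivative_minus[OF D] _ speed force])
    show "- D p (1, ?b p) = 0" if "p \<in> {0..} \<times> UNIV" for p using tr'[OF that] by simp
    show "- ?f (0, y, u) \<le> 0" if "(0, y, u) \<in> ?K" for y u using zero[OF that] by simp
  qed
  ultimately show ?thesis by simp
qed

text \<open>
  Normalise by \<open>c = C / (2 l)\<close>, so that \<open>y = |g| / c\<close> has integral above \<open>2 l\<close> on an interval of length \<open>l\<close>.
  The elementary inequality \<open>y powr r \<ge> y - 1\<close> then leaves an integral of \<open>y powr r\<close> above \<open>l \<ge> 1\<close>, for every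
  \<open>r \<ge> 1\<close>. This replaces Hoelder's inequality and keeps the constant independent of the exponent.
\<close>

lemma Lp_norm_greater_if_concentrated:
  fixes g :: "real \<Rightarrow> real"
  assumes g: "integrable lborel g" and C: "0 < C" and l: "1 \<le> l"
    and conc: "C < (LINT x:{a..a+l}|lborel. g x)" and p: "1 \<le> p"
  shows "ennreal (C / (2 * l)) < Lp_norm p g"
proof -
  let ?I = "{a..a+l}"
  define c where "c = C / (2 * l)"
  have c: "0 < c" "c * l = C / 2" using C l by (auto simp: c_def)
  have ind: "integrable lborel (\<lambda>x. indicator ?I x :: real)"
    by (intro integrable_real_indicator) (use emeasure_lborel_cbox_finite[of a "a + l"] in auto)
  have ind_l: "(LINT x|lborel. indicator ?I x :: real) = l" using l by simp
  have gI: "integrable lborel (\<lambda>x. indicator ?I x * \<bar>g x\<bar>)"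
    using integrable_mult_indicator[OF _ integrable_abs[OF g], of ?I] by simp
  have mass: "C < (LINT x|lborel. indicator ?I x * \<bar>g x\<bar>)"
  proof -
    have "(LINT x:?I|lborel. g x) \<le> (LINT x|lborel. indicator ?I x * \<bar>g x\<bar>)"
      unfolding set_lebesgue_integral_def
      by (rule integral_mono) (use gI integrable_mult_indicator[OF _ g, of ?I] in \<open>auto simp: indicator_def\<close>)
    then show ?thesis using conc by linarith
  qed
  show ?thesis
  proof (cases "p = \<infinity>")
    case True
    show ?thesis
    proof (rule ccontr)
      assume "\<not> ?thesis"
      then have le: "esssup lborel (\<lambda>x. ennreal \<bar>g x\<bar>) \<le> ennreal c" using True by (simp add: Lp_norm_def c_def)
      have "AE x in lborel. ennreal \<bar>g x\<bar> \<le> esssup lborel (\<lambda>x. ennreal \<bar>g x\<bar>)"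
        by (rule esssup_AE)
      then have "AE x in lborel. indicator ?I x * \<bar>g x\<bar> \<le> c * indicator ?I x"
      proof eventually_elim
        case (elim x)
        then have "ennreal \<bar>g x\<bar> \<le> ennreal c" using le by (rule order_trans)
        then have "\<bar>g x\<bar> \<le> c" using c by simp
        then show ?case by (auto simp: indicator_def)
      qed
      then have "(LINT x|lborel. indicator ?I x * \<bar>g x\<bar>) \<le> (LINT x|lborel. c * indicator ?I x)"
        by (intro integral_mono_AE gI integrable_mult_right ind)
      also have "\<dots> = C / 2" using ind_l c by simp
      finally show False using mass C by simp
    qed
  next
    case False
    define r where "r = enn2real p"
    have r: "1 \<le> r"
      using enn2real_mono[OF p] False by (simp add: r_def less_top)
    define N where "N = (\<integral>\<^sup>+x. ennreal (\<bar>g x\<bar> powr r) \<partial>lborel)"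
    show ?thesis
    proof (cases "N = \<infinity>")
      case True
      then show ?thesis using False by (simp add: Lp_norm_def Let_def N_def r_def)
    next
      case fin: False
      have [measurable]: "g \<in> borel_measurable borel" using borel_measurable_integrable[OF g] by simp
      have int: "integrable lborel (\<lambda>x. \<bar>g x\<bar> powr r)"
        by (rule integrableI_nonneg) (use fin in \<open>auto simp: N_def top.not_eq_extremum\<close>)
      have "enn2real N = (LINT x|lborel. \<bar>g x\<bar> powr r)"
        unfolding N_def by (rule integral_eq_nn_integral[symmetric]) auto
      moreover have "c powr r < (LINT x|lborel. \<bar>g x\<bar> powr r)"
      proof -
        have pt: "c powr r * (indicator ?I x * \<bar>g x\<bar> / c - indicator ?I x) \<le> \<bar>g x\<bar> powr r" for x
        proof -
          define y where "y = \<bar>g x\<bar> / c"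
          have y: "0 \<le> y" "\<bar>g x\<bar> = c * y" using c by (auto simp: y_def)
          have "y - 1 \<le> y powr r"
          proof (cases "1 \<le> y")
            case True
            then show ?thesis using powr_mono[of 1 r y] r by simp
          next
            case False
            then show ?thesis using powr_ge_zero[of y r] by linarith
          qed
          moreover have "indicator ?I x * y - indicator ?I x \<le> max 0 (y - 1)"
            by (auto simp: indicator_def)
          ultimately have "indicator ?I x * y - indicator ?I x \<le> y powr r"
            using powr_ge_zero[of y r] by linarith
          then have "c powr r * (indicator ?I x * y - indicator ?I x) \<le> c powr r * y powr r"
            by (intro mult_left_mono) auto
          also have "\<dots> = \<bar>g x\<bar> powr r" using c y by (simp add: powr_mult)
          finally show ?thesis by (simp add: y_def)
        qed
        have i: "integrable lborel (\<lambda>x. c powr r * (indicator ?I x * \<bar>g x\<bar> / c - indicator ?I x))"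
          by (intro integrable_mult_right Bochner_Integration.integrable_diff integrable_divide gI ind)
        have "c powr r * (C / c - l) < (LINT x|lborel. c powr r * (indicator ?I x * \<bar>g x\<bar> / c - indicator ?I x))"
          using mass c gI ind ind_l by (simp add: divide_strict_right_mono)
        also have "\<dots> \<le> (LINT x|lborel. \<bar>g x\<bar> powr r)"
          by (rule integral_mono[OF i int pt])
        also have "C / c - l = l" using l C by (simp add: c_def)
        finally have "c powr r * l < (LINT x|lborel. \<bar>g x\<bar> powr r)" .
        moreover have "c powr r * 1 \<le> c powr r * l" using l by (intro mult_left_mono) auto
        ultimately show ?thesis by linarith
      qed
      ultimately have "c powr r < enn2real N" by simp
      then have "(c powr r) powr (1 / r) < enn2real N powr (1 / r)"
        using r by (intro powr_less_mono2) auto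
      then have "c < enn2real N powr (1 / r)" using r c by (simp add: powr_powr)
      then have "ennreal c < ennreal (enn2real N powr (1 / r))" using c by (intro ennreal_lessI) auto
      then show ?thesis using False fin by (simp add: Lp_norm_def Let_def N_def r_def c_def)
    qed
  qed
qed

text \<open>
  The interval \<open>[x0 + t, R + t]\<close> that carries the charge has a length that does not depend on \<open>t\<close>. The
  length \<open>l\<close> is enlarged to at least \<open>1\<close> so that one constant serves all exponents.
\<close>

theorem mass_ahead_bounds_Lp_norms:
  assumes data: "admissible_data f0 E20 B0" and sol: "monocharge_RVM_solution f0 E20 B0 f E1 E2 B"
    and ahead: "mass_stays_ahead f"
  shows "\<exists>C::real. C > 0 \<and> (\<forall>t\<ge>0. \<forall>p\<ge>1. Lp_norm p (rho f t) > ennreal C)"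
proof -
  obtain x0 C where C: "C > 0" and mass: "\<And>t. 0 \<le> t \<Longrightarrow> C < (LINT x:{x0 + t..}|lborel. rho f t x)"
    using ahead unfolding mass_stays_ahead_def by blast
  have "bounded (closure {z. (\<lambda>(x, v). f0 x v) z \<noteq> 0})"
    using data unfolding admissible_data_def compactly_supported_def by (intro compact_imp_bounded) auto
  then obtain R where R: "\<And>z. z \<in> closure {z. (\<lambda>(x, v). f0 x v) z \<noteq> 0} \<Longrightarrow> norm z \<le> R"
    unfolding bounded_iff by blast
  have supp: "f0 x v = 0" if "R < x" for x v
  proof (rule ccontr)
    assume "f0 x v \<noteq> 0"
    then have "norm (x, v) \<le> R" by (intro R closure_subset[THEN subsetD]) simp
    then show False using norm_fst_le[of x v] that by simp
  qed
  define l where "l = max 1 (R - x0)"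
  have l: "1 \<le> l" by (simp add: l_def)
  have "ennreal (C / (2 * l)) < Lp_norm p (rho f t)" if t: "0 \<le> t" and p: "1 \<le> p" for t p
  proof (rule Lp_norm_greater_if_concentrated[OF _ C l _ p])
    show "integrable lborel (rho f t)" using sol t unfolding monocharge_RVM_solution_def by (elim conjE) simp
    have "rho f t x = 0" if "x0 + t + l < x" for x
    proof -
      have "f t x v = 0" for v
        by (rule finite_propagation_speed[OF sol supp t]) (use that in \<open>auto simp: l_def\<close>)
      then show ?thesis by (simp add: rho_def)
    qed
    then have eq: "indicator {x0 + t..} x *\<^sub>R rho f t x = indicator {x0 + t..x0 + t + l} x *\<^sub>R rho f t x" for x
      by (auto simp: indicator_def not_le)
    then show "C < (LINT x:{x0 + t..x0 + t + l}|lborel. rho f t x)"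
      using mass[OF t] by (simp only: set_lebesgue_integral_def eq)
  qed
  then show ?thesis using C l by (intro exI[of _ "C / (2 * l)"]) auto
qed

section \<open>The force of a prescribed longitudinal field\<close>

lemma integral_bounded_on_cbox:
  fixes h :: "'a::euclidean_space \<Rightarrow> real"
  assumes [measurable]: "h \<in> borel_measurable lborel"
    and bound: "\<And>z. \<bar>h z\<bar> \<le> C * indicator (cbox a b) z"
  shows "integrable lborel h" and "\<bar>LINT z|lborel. h z\<bar> \<le> C * measure lborel (cbox a b)"
proof -
  have int: "integrable lborel (\<lambda>z. C * indicator (cbox a b) z)"
    by (intro integrable_mult_right integrable_real_indicator) (use emeasure_lborel_cbox_finite[of a b] in auto)
  show h: "integrable lborel h"
    by (rule Bochner_Integration.integrable_bound[OF int]) (use order_trans[OF bound abs_ge_self] in auto)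
  have "\<bar>LINT z|lborel. h z\<bar> \<le> (LINT z|lborel. \<bar>h z\<bar>)" by (rule integral_abs_bound)
  also have "\<dots> \<le> (LINT z|lborel. C * indicator (cbox a b) z)"
    by (intro integral_mono int integrable_abs h) (use bound in auto)
  also have "\<dots> = C * measure lborel (cbox a b)" by simp
  finally show "\<bar>LINT z|lborel. h z\<bar> \<le> C * measure lborel (cbox a b)" .
qed

lemma measure_lborel_cbox_triple:
  fixes a1 a2 a3 b1 b2 b3 :: real
  assumes "a1 \<le> b1" "a2 \<le> b2" "a3 \<le> b3"
  shows "measure lborel (cbox (a1, a2, a3) (b1, b2, b3)) = (b1 - a1) * ((b2 - a2) * (b3 - a3))"
  using assms by (simp add: content_Pair)

type_synonym phase = "real \<times> real \<times> real"

text \<open>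
  The characteristic vector field for \<open>E2 = B = 0\<close> on the phase space of triples \<open>(x, v1, v2)\<close>.
\<close>

definition lorentz :: "field \<Rightarrow> real \<Rightarrow> phase \<Rightarrow> phase" where
  "lorentz E t z = (fst (vhat (snd z)), E t (fst z), 0)"

abbreviation "E_flow E \<equiv> lipschitz_ode.flow (lorentz E)"

text \<open>
  One radius \<open>R\<close> bounds the support in all three variables. Evenness in \<open>v2\<close> is what makes the
  transverse current vanish and the choice \<open>E2 = B = 0\<close> consistent.
\<close>

locale vlasov_data =
  fixes f0 :: "phase \<Rightarrow> real" and Df0 :: "phase \<Rightarrow> phase \<Rightarrow>\<^sub>L real" and A L0 R :: real
  assumes A: "0 \<le> A" and L0: "0 \<le> L0" and R: "0 < R"
    and f0_nonneg: "\<And>z. 0 \<le> f0 z" and f0_le: "\<And>z. f0 z \<le> A"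
    and f0_lip: "\<And>y z. \<bar>f0 y - f0 z\<bar> \<le> L0 * norm (y - z)"
    and f0_supp: "\<And>z. f0 z \<noteq> 0 \<Longrightarrow> z \<in> cbox (-R, -R, -R) (R, R, R)"
    and f0_deriv: "\<And>z. (f0 has_derivative Df0 z) (at z)"
    and f0_deriv_cont: "continuous_on UNIV Df0"
    and f0_even: "\<And>x v1 v2. f0 (x, v1, - v2) = f0 (x, v1, v2)"
begin

text \<open>
  \<open>reach t\<close> bounds \<open>|v1|\<close> on the support at time \<open>t\<close>. A density bounded by \<open>A\<close> on the box \<open>|x| \<le> R + t\<close>,
  \<open>|v1| \<le> b\<close>, \<open>|v2| \<le> R\<close> induces a field of size at most \<open>4 A R (R + t) b\<close>, which in turn limits the growth
  of \<open>|v1|\<close>. The function \<open>reach\<close> is the solution of \<open>b' = 4 A R (R + t) b\<close>, \<open>b 0 = R\<close>, so the bounds close up.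
\<close>

definition reach :: "real \<Rightarrow> real" where "reach t = R * exp (4 * A * R * (R * t + t\<^sup>2 / 2))"

text \<open>
  \<open>slope\<close> bounds the charge density, that is the slope of the field in \<open>x\<close>, and \<open>height\<close> bounds the field.
\<close>

definition slope :: "real \<Rightarrow> real" where "slope t = 4 * A * R * reach t"
definition height :: "real \<Rightarrow> real" where "height t = (R + t) * slope t"
definition box :: "real \<Rightarrow> phase set" where
  "box t = cbox (- (R + t), - reach t, - R) (R + t, reach t, R)"
definition vol :: "real \<Rightarrow> real" where "vol t = 8 * (R + t) * reach t * R"

text \<open>
  \<open>rate\<close> bounds the vector field \<open>lorentz E\<close> and its Lipschitz constant, \<open>drift\<close> is the resulting Lipschitz
  constant in time of the induced field.
\<close>

definition rate :: "real \<Rightarrow> real" where "rate t = 2 + slope t + height t"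
definition drift :: "real \<Rightarrow> real" where "drift t = vol t * L0 * (rate t * exp (rate t * t))"

text \<open>
  The bounds are pointwise inequalities, so they survive pointwise limits; they are also reproduced by
  the map from a field to the field that its transported density induces.
\<close>

definition tame :: "field \<Rightarrow> bool" where
  "tame E \<longleftrightarrow> (\<forall>t\<ge>0. \<forall>x. \<bar>E t x\<bar> \<le> height t) \<and>
     (\<forall>t\<ge>0. \<forall>x y. \<bar>E t x - E t y\<bar> \<le> slope t * \<bar>x - y\<bar>) \<and>
     (\<forall>s t x. 0 \<le> s \<longrightarrow> s \<le> t \<longrightarrow> \<bar>E s x - E t x\<bar> \<le> drift t * \<bar>s - t\<bar>)"

lemma reach_pos: "0 < reach t" using R by (simp add: reach_def)
lemma reach_0: "reach 0 = R" by (simp add: reach_def)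

lemma reach_mono: "0 \<le> s \<Longrightarrow> s \<le> t \<Longrightarrow> reach s \<le> reach t"
  using R A by (auto simp: reach_def intro!: mult_left_mono add_mono divide_right_mono power_mono)

lemma slope_mono: "0 \<le> s \<Longrightarrow> s \<le> t \<Longrightarrow> slope s \<le> slope t"
  using R A reach_mono by (auto simp: slope_def intro!: mult_left_mono)

lemma slope_nonneg: "0 \<le> slope t" using R A reach_pos[of t] by (simp add: slope_def)

lemma height_mono: "0 \<le> s \<Longrightarrow> s \<le> t \<Longrightarrow> height s \<le> height t"
  using R slope_mono[of s t] slope_nonneg by (auto simp: height_def intro!: mult_mono)

lemma height_nonneg: "0 \<le> t \<Longrightarrow> 0 \<le> height t" using R slope_nonneg[of t] by (simp add: height_def)

lemma rate_mono: "0 \<le> s \<Longrightarrow> s \<le> t \<Longrightarrow> rate s \<le> rate t"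
  using slope_mono height_mono by (auto simp: rate_def intro!: add_mono)

lemma rate_ge: "0 \<le> t \<Longrightarrow> 2 \<le> rate t" "0 \<le> t \<Longrightarrow> 0 < rate t"
  using slope_nonneg[of t] height_nonneg[of t] by (auto simp: rate_def)

lemma vol_nonneg: "0 \<le> t \<Longrightarrow> 0 \<le> vol t" using R reach_pos[of t] by (simp add: vol_def)

lemma vol_mono: "0 \<le> s \<Longrightarrow> s \<le> t \<Longrightarrow> vol s \<le> vol t"
  using R reach_mono[of s t] reach_pos[of s] by (auto simp: vol_def intro!: mult_mono)

lemma drift_mono: "0 \<le> s \<Longrightarrow> s \<le> t \<Longrightarrow> drift s \<le> drift t"
  using vol_mono[of s t] vol_nonneg[of s] vol_nonneg[of t] rate_mono[of s t] rate_ge[of s] rate_ge[of t] L0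
  unfolding drift_def by (auto intro!: mult_mono mult_nonneg_nonneg)

lemma drift_nonneg: "0 \<le> t \<Longrightarrow> 0 \<le> drift t"
  using vol_nonneg[of t] rate_ge[of t] L0 by (simp add: drift_def)

lemma box_mono: "0 \<le> s \<Longrightarrow> s \<le> t \<Longrightarrow> box s \<subseteq> box t"
  using reach_mono[of s t] by (auto simp: box_def)

lemma measure_box: "0 \<le> t \<Longrightarrow> measure lborel (box t) = vol t"
  using R reach_pos[of t] unfolding box_def by (subst measure_lborel_cbox_triple) (auto simp: vol_def)

lemma reach_deriv: "(reach has_real_derivative height t) (at t within S)"
proof -
  have "(reach has_real_derivative R * (exp (4 * A * R * (R * t + t\<^sup>2 / 2)) * (4 * A * R * (R + t)))) (at t within S)"
    unfolding reach_def by (auto intro!: derivative_eq_intros)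
  moreover have "R * (exp (4 * A * R * (R * t + t\<^sup>2 / 2)) * (4 * A * R * (R + t))) = height t"
    by (simp add: height_def slope_def reach_def)
  ultimately show ?thesis by simp
qed

lemma tame_bound: "tame E \<Longrightarrow> 0 \<le> t \<Longrightarrow> \<bar>E t x\<bar> \<le> height t"
  and tame_slope: "tame E \<Longrightarrow> 0 \<le> t \<Longrightarrow> \<bar>E t x - E t y\<bar> \<le> slope t * \<bar>x - y\<bar>"
  and tame_drift: "tame E \<Longrightarrow> 0 \<le> s \<Longrightarrow> s \<le> t \<Longrightarrow> \<bar>E s x - E t x\<bar> \<le> drift t * \<bar>s - t\<bar>"
  unfolding tame_def by blast+

lemma tame_continuous:
  assumes "tame E"
  shows "continuous_on ({0..} \<times> UNIV) (\<lambda>(t, x). E t x)"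
proof (rule continuous_on_half_space_if_locally_lipschitz)
  fix N :: real assume N: "0 \<le> N"
  have "norm (E s y - E t x) \<le> (slope N + drift N) * (norm (y - x) + \<bar>s - t\<bar>)"
    if st: "s \<in> {0..N}" "t \<in> {0..N}" for s t y x
  proof -
    have "\<bar>E s y - E s x\<bar> \<le> slope s * \<bar>y - x\<bar>" using assms st by (auto simp: tame_def)
    also have "\<dots> \<le> slope N * \<bar>y - x\<bar>" using st by (intro mult_right_mono slope_mono) auto
    finally have 1: "\<bar>E s y - E s x\<bar> \<le> slope N * \<bar>y - x\<bar>" .
    have "\<bar>E s x - E t x\<bar> \<le> drift (max s t) * \<bar>s - t\<bar>"
      using assms st by (cases "s \<le> t") (auto simp: tame_def max_def abs_minus_commute)
    also have "\<dots> \<le> drift N * \<bar>s - t\<bar>" using st by (intro mult_right_mono drift_mono) auto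
    finally have 2: "\<bar>E s x - E t x\<bar> \<le> drift N * \<bar>s - t\<bar>" .
    have "0 \<le> drift N * \<bar>y - x\<bar>" "0 \<le> slope N * \<bar>s - t\<bar>" using drift_nonneg[OF N] slope_nonneg by auto
    moreover have "\<bar>E s y - E t x\<bar> \<le> \<bar>E s y - E s x\<bar> + \<bar>E s x - E t x\<bar>" by simp
    moreover have "(slope N + drift N) * (norm (y - x) + \<bar>s - t\<bar>)
        = slope N * \<bar>y - x\<bar> + drift N * \<bar>s - t\<bar> + (drift N * \<bar>y - x\<bar> + slope N * \<bar>s - t\<bar>)"
      by (simp add: algebra_simps)
    ultimately show ?thesis using 1 2 by simp
  qed
  then show "\<exists>L. \<forall>s\<in>{0..N}. \<forall>t\<in>{0..N}. \<forall>y x. norm (E s y - E t x) \<le> L * (norm (y - x) + \<bar>s - t\<bar>)"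
    by blast
qed

lemma tame_bounded_ode:
  assumes E: "tame E"
  shows "bounded_ode (lorentz E) rate"
proof -
  have bound: "norm (lorentz E t z) \<le> rate t" if t: "0 \<le> t" for t z
  proof -
    have "norm (lorentz E t z) \<le> norm (fst (vhat (snd z))) + norm (E t (fst z), 0::real)"
      unfolding lorentz_def by (rule norm_Pair_le)
    also have "\<dots> \<le> 1 + height t"
      using abs_vhat_less_1(1)[of "snd z"] tame_bound[OF E t, of "fst z"] by simp
    also have "\<dots> \<le> rate t" using slope_nonneg[of t] by (simp add: rate_def)
    finally show ?thesis .
  qed
  show ?thesis
  proof
    have 1: "continuous_on ({0..} \<times> UNIV) (\<lambda>x::real \<times> phase. vhat (snd (snd x)))"
      by (rule continuous_on_compose2[OF vhat_continuous[of UNIV]]) (auto intro!: continuous_intros)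
    have "continuous_on ({0..} \<times> UNIV) ((\<lambda>(t, x). E t x) \<circ> (\<lambda>x::real \<times> phase. (fst x, fst (snd x))))"
      by (rule continuous_on_compose)
         (auto intro!: continuous_intros continuous_on_subset[OF tame_continuous[OF E]])
    then have 2: "continuous_on ({0..} \<times> UNIV) (\<lambda>x::real \<times> phase. E (fst x) (fst (snd x)))"
      by (simp add: o_def)
    show "continuous_on ({0..} \<times> UNIV) (\<lambda>(t, z). lorentz E t z)"
      unfolding lorentz_def case_prod_beta by (intro continuous_intros 1 2)
    fix t :: real assume t: "0 \<le> t"
    fix y z :: phase
    have "norm (lorentz E t y - lorentz E t z)
        \<le> norm (fst (vhat (snd y) - vhat (snd z))) + norm (E t (fst y) - E t (fst z), 0::real)"
      using norm_Pair_le[of "fst (vhat (snd y) - vhat (snd z))" "(E t (fst y) - E t (fst z), 0::real)"]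
      by (simp add: lorentz_def)
    also have "norm (fst (vhat (snd y) - vhat (snd z))) \<le> norm (vhat (snd y) - vhat (snd z))"
      by (metis norm_fst_le prod.collapse)
    also have "\<dots> \<le> 2 * norm (snd (y - z))" using vhat_lipschitz by simp
    also have "norm (snd (y - z)) \<le> norm (y - z)" by (metis norm_snd_le prod.collapse)
    also have "norm (E t (fst y) - E t (fst z), 0::real) = \<bar>E t (fst y) - E t (fst z)\<bar>"
      by simp
    also have "\<dots> \<le> slope t * norm (fst (y - z))" using E t by (auto simp: tame_def)
    also have "norm (fst (y - z)) \<le> norm (y - z)" by (metis norm_fst_le prod.collapse)
    also have "2 * norm (y - z) + slope t * norm (y - z) \<le> rate t * norm (y - z)"
      using height_nonneg[OF t] by (simp add: rate_def algebra_simps)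
    finally show "norm (lorentz E t y - lorentz E t z) \<le> rate t * norm (y - z)"
      using slope_nonneg[of t] by (simp add: mult_left_mono)
  next
    show "norm (lorentz E t 0) \<le> rate t" if "0 \<le> t" for t by (rule bound[OF that])
    show "norm (lorentz E t z) \<le> rate t" if "0 \<le> t" for t z by (rule bound[OF that])
  qed (use rate_mono rate_ge in auto)
qed

end

section \<open>The field induced by the transported density\<close>

context vlasov_data
begin

definition dens :: "field \<Rightarrow> real \<Rightarrow> phase \<Rightarrow> real" where
  "dens E t z = f0 (E_flow E 0 t z)"

lemma dens_nonneg: "0 \<le> dens E t z" by (simp add: dens_def f0_nonneg)
lemma dens_le: "dens E t z \<le> A" by (simp add: dens_def f0_le)

text \<open>
  Each coordinate has a velocity with a known antiderivative bound: \<open>|X'| < 1\<close>, \<open>|V1'| \<le> height = reach'\<close>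
  and \<open>V2' = 0\<close>.
\<close>

lemma characteristic_bounds:
  assumes E: "tame E" and t: "0 \<le> t" and u: "lipschitz_ode.solves (lorentz E) u"
  shows "\<bar>fst (u 0) - fst (u t)\<bar> \<le> t" "\<bar>fst (snd (u 0)) - fst (snd (u t))\<bar> \<le> reach t - R"
    "snd (snd (u 0)) = snd (snd (u t))"
proof -
  interpret bounded_ode "lorentz E" rate by (rule tame_bounded_ode[OF E])
  have u': "(u has_vector_derivative lorentz E s (u s)) (at s within {0..t})" if "s \<in> {0..t}" for s
    using that by (intro solves_within[OF u]) auto
  have f: "((\<lambda>s. fst (u s)) has_vector_derivative fst (vhat (snd (u s)))) (at s within {0..t})"
    and s1: "((\<lambda>s. fst (snd (u s))) has_vector_derivative E s (fst (u s))) (at s within {0..t})"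
    and s2: "((\<lambda>s. snd (snd (u s))) has_vector_derivative 0) (at s within {0..t})"
    if "s \<in> {0..t}" for s
    using u'[OF that] unfolding lorentz_def has_vector_derivative_def
    by (auto intro!: derivative_eq_intros)
  have "norm ((\<lambda>s. fst (u s) - fst (u t)) 0) \<le> (norm ((\<lambda>s. fst (u s) - fst (u t)) t) + (t - 0)) * exp (0 * (t - 0))"
    by (rule gronwall_backward[where y' = "\<lambda>s. fst (vhat (snd (u s)))" and d' = "\<lambda>_. 1"])
       (use t in \<open>auto intro!: derivative_eq_intros f less_imp_le[OF abs_vhat_less_1(1)]\<close>)
  then show "\<bar>fst (u 0) - fst (u t)\<bar> \<le> t" by simp
  have "norm ((\<lambda>s. fst (snd (u s)) - fst (snd (u t))) 0) \<le>
      (norm ((\<lambda>s. fst (snd (u s)) - fst (snd (u t))) t) + (reach t - reach 0)) * exp (0 * (t - 0))"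
    by (rule gronwall_backward[where y' = "\<lambda>s. E s (fst (u s))" and d' = "\<lambda>s. height s"])
       (use t height_nonneg tame_bound[OF E] in \<open>auto intro!: derivative_eq_intros s1 reach_deriv\<close>)
  then show "\<bar>fst (snd (u 0)) - fst (snd (u t))\<bar> \<le> reach t - R" by (simp add: reach_0)
  have "norm ((\<lambda>s. snd (snd (u s)) - snd (snd (u t))) 0) \<le>
      (norm ((\<lambda>s. snd (snd (u s)) - snd (snd (u t))) t) + (0 - 0)) * exp (0 * (t - 0))"
    by (rule gronwall_backward[where y' = "\<lambda>s. 0" and d' = "\<lambda>s. 0"])
       (use t in \<open>auto intro!: derivative_eq_intros s2\<close>)
  then show "snd (snd (u 0)) = snd (snd (u t))" by simp
qed

lemma dens_supp:
  assumes E: "tame E" and t: "0 \<le> t" and nz: "dens E t z \<noteq> 0"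
  shows "z \<in> box t"
proof -
  interpret bounded_ode "lorentz E" rate by (rule tame_bounded_ode[OF E])
  obtain x v1 v2 where z: "z = (x, v1, v2)" by (metis prod.collapse)
  note b = characteristic_bounds[OF E t flow_solves[OF t], of z]
  have "E_flow E 0 t z \<in> cbox (-R, -R, -R) (R, R, R)"
    using nz f0_supp by (simp add: dens_def)
  moreover obtain y w1 w2 where "E_flow E 0 t z = (y, w1, w2)" by (metis prod.collapse)
  ultimately show ?thesis using b t by (auto simp: flow_start z box_def cbox_Pair_eq)
qed

lemma dens_lipschitz:
  assumes E: "tame E" and "0 \<le> s" "0 \<le> t" "s \<le> N" "t \<le> N"
  shows "\<bar>dens E s y - dens E t z\<bar> \<le> L0 * exp (rate N * N) * (norm (y - z) + rate N * \<bar>s - t\<bar>)"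
proof -
  interpret bounded_ode "lorentz E" rate by (rule tame_bounded_ode[OF E])
  have "\<bar>dens E s y - dens E t z\<bar> \<le> L0 * norm (E_flow E 0 s y - E_flow E 0 t z)"
    unfolding dens_def by (rule f0_lip)
  also have "\<dots> \<le> L0 * ((norm (y - z) + rate N * \<bar>s - t\<bar>) * exp (rate N * N))"
    by (intro mult_left_mono flow_to_0_lipschitz assms L0)
  finally show ?thesis by (simp add: mult_ac)
qed

lemma dens_continuous: "tame E \<Longrightarrow> continuous_on ({0..} \<times> UNIV) (\<lambda>(t, z). dens E t z)"
proof (rule continuous_on_half_space_if_locally_lipschitz)
  fix N :: real assume E: "tame E" and N: "0 \<le> N"
  have "norm (dens E s y - dens E t z) \<le> L0 * exp (rate N * N) * (1 + rate N) * (norm (y - z) + \<bar>s - t\<bar>)"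
    if "s \<in> {0..N}" "t \<in> {0..N}" for s t y z
  proof -
    have "norm (dens E s y - dens E t z) \<le> L0 * exp (rate N * N) * (norm (y - z) + rate N * \<bar>s - t\<bar>)"
      using dens_lipschitz[OF E, of s t N y z] that by simp
    also have "\<dots> \<le> L0 * exp (rate N * N) * ((1 + rate N) * (norm (y - z) + \<bar>s - t\<bar>))"
      using rate_ge[OF N] L0 by (intro mult_left_mono) (auto simp: algebra_simps)
    finally show ?thesis by (simp add: mult.assoc)
  qed
  then show "\<exists>L. \<forall>s\<in>{0..N}. \<forall>t\<in>{0..N}. \<forall>y z. norm (dens E s y - dens E t z) \<le> L * (norm (y - z) + \<bar>s - t\<bar>)"
    by blast
qed

lemma dens_continuous_at: "tame E \<Longrightarrow> 0 \<le> t \<Longrightarrow> continuous_on S (dens E t)"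
  using continuous_on_compose2[OF dens_continuous[of E] continuous_on_Pair[OF continuous_on_const[of S t] continuous_on_id]]
  by force

lemma dens_measurable [measurable]: "tame E \<Longrightarrow> 0 \<le> t \<Longrightarrow> dens E t \<in> borel_measurable borel"
  by (intro borel_measurable_continuous_onI dens_continuous_at)

text \<open>
  Half the charge to the left minus half the charge to the right, as one integral over phase space. In
  this form estimates of the density pass directly to the field.
\<close>

definition induced :: "field \<Rightarrow> field" where
  "induced E t x = 1/2 * (LINT z|lborel. sgn (x - fst z) * dens E t z)"

lemma integral_bounded_on_box:
  fixes h :: "phase \<Rightarrow> real"
  assumes "0 \<le> t" "h \<in> borel_measurable lborel" "\<And>z. \<bar>h z\<bar> \<le> C * indicator (box t) z"
  shows "integrable lborel h" and "\<bar>LINT z|lborel. h z\<bar> \<le> C * vol t"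
  using integral_bounded_on_cbox[OF assms(2), of C] assms(3) measure_box[OF assms(1)]
  unfolding box_def by metis+

lemma induced_integrand:
  assumes E: "tame E" and t: "0 \<le> t"
  shows "(\<lambda>z. sgn (x - fst z) * dens E t z) \<in> borel_measurable lborel"
    "integrable lborel (\<lambda>z. sgn (x - fst z) * dens E t z)"
proof -
  show m: "(\<lambda>z. sgn (x - fst z) * dens E t z) \<in> borel_measurable lborel"
  proof -
    have "(\<lambda>z::phase. x - fst z) \<in> borel_measurable borel"
      by (intro borel_measurable_continuous_onI continuous_intros)
    then have "(\<lambda>z::phase. sgn (x - fst z)) \<in> borel_measurable borel"
      by (rule measurable_compose) simp
    then show ?thesis using dens_measurable[OF E t] by simp
  qed
  show "integrable lborel (\<lambda>z. sgn (x - fst z) * dens E t z)"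
  proof (rule integral_bounded_on_box(1)[OF t m])
    show "\<bar>sgn (x - fst z) * dens E t z\<bar> \<le> A * indicator (box t) z" for z
      using dens_supp[OF E t, of z] dens_nonneg[of E t z] dens_le[of E t z] A
      by (auto simp: indicator_def abs_mult sgn_real_def)
  qed
qed

lemma induced_bound:
  assumes E: "tame E" and t: "0 \<le> t"
  shows "\<bar>induced E t x\<bar> \<le> height t"
proof -
  have "\<bar>LINT z|lborel. sgn (x - fst z) * dens E t z\<bar> \<le> A * vol t"
  proof (rule integral_bounded_on_box(2)[OF t induced_integrand(1)[OF E t]])
    show "\<bar>sgn (x - fst z) * dens E t z\<bar> \<le> A * indicator (box t) z" for z
      using dens_supp[OF E t, of z] dens_nonneg[of E t z] dens_le[of E t z] A
      by (auto simp: indicator_def abs_mult sgn_real_def)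
  qed
  then show ?thesis by (simp add: induced_def height_def slope_def vol_def algebra_simps)
qed


text \<open>
  Only the particles between \<open>y\<close> and \<open>x\<close> contribute to the difference.
\<close>

lemma induced_slope:
  assumes E: "tame E" and t: "0 \<le> t"
  shows "\<bar>induced E t x - induced E t y\<bar> \<le> slope t * \<bar>x - y\<bar>"
proof -
  have *: "\<bar>induced E t x - induced E t y\<bar> \<le> slope t * \<bar>x - y\<bar>" if xy: "y \<le> x" for x y
  proof -
    let ?h = "\<lambda>z. sgn (x - fst z) * dens E t z - sgn (y - fst z) * dens E t z"
    let ?a = "(y, - reach t, - R)" and ?b = "(x, reach t, R)"
    have "\<bar>LINT z|lborel. ?h z\<bar> \<le> 2 * A * measure lborel (cbox ?a ?b)"
    proof (rule integral_bounded_on_cbox(2))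
      show "?h \<in> borel_measurable lborel"
        by (intro borel_measurable_diff induced_integrand E t)
      show "\<bar>?h z\<bar> \<le> 2 * A * indicator (cbox ?a ?b) z" for z
      proof (cases "dens E t z = 0 \<or> fst z < y \<or> x < fst z")
        case True
        then show ?thesis using xy A by (auto simp: sgn_real_def)
      next
        case False
        then have "z \<in> cbox ?a ?b" using dens_supp[OF E t, of z] by (cases z) (auto simp: box_def cbox_Pair_eq)
        moreover have bd: "\<bar>sgn r * dens E t z\<bar> \<le> A" for r
          using dens_nonneg[of E t z] dens_le[of E t z] A by (auto simp: sgn_real_def)
        moreover have "\<bar>?h z\<bar> \<le> A + A"
          by (rule order_trans[OF abs_triangle_ineq4 add_mono[OF bd bd]])
        ultimately show ?thesis by (simp add: indicator_def)
      qed
    qed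
    also have "measure lborel (cbox ?a ?b) = (x - y) * ((2 * reach t) * (2 * R))"
      using xy R reach_pos[of t] by (subst measure_lborel_cbox_triple) auto
    finally have "\<bar>1/2 * (LINT z|lborel. ?h z)\<bar> \<le> slope t * \<bar>x - y\<bar>"
      using xy by (simp add: slope_def algebra_simps)
    moreover have "induced E t x - induced E t y = 1/2 * (LINT z|lborel. ?h z)"
      unfolding induced_def
      unfolding Bochner_Integration.integral_diff[OF induced_integrand(2)[OF E t] induced_integrand(2)[OF E t]]
      by (simp add: algebra_simps)
    ultimately show ?thesis by simp
  qed
  show ?thesis using *[of x y] *[of y x] by (cases "y \<le> x") (auto simp: abs_minus_commute)
qed

lemma induced_diff:
  assumes E: "tame E" and E': "tame E'" and s: "0 \<le> s" "s \<le> t"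
    and close: "\<And>z. z \<in> box t \<Longrightarrow> \<bar>dens E s z - dens E' t z\<bar> \<le> c" and c: "0 \<le> c"
  shows "\<bar>induced E s x - induced E' t x\<bar> \<le> 1/2 * c * vol t"
proof -
  let ?h = "\<lambda>z. sgn (x - fst z) * dens E s z - sgn (x - fst z) * dens E' t z"
  have t: "0 \<le> t" using s by simp
  have "\<bar>LINT z|lborel. ?h z\<bar> \<le> c * vol t"
  proof (rule integral_bounded_on_box(2)[OF t])
    show "?h \<in> borel_measurable lborel"
      by (intro borel_measurable_diff induced_integrand E E' s t)
    show "\<bar>?h z\<bar> \<le> c * indicator (box t) z" for z
    proof (cases "z \<in> box t")
      case True
      have "?h z = sgn (x - fst z) * (dens E s z - dens E' t z)" by (simp add: algebra_simps)
      then show ?thesis using close[OF True] c True by (auto simp: abs_mult sgn_real_def)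
    next
      case False
      then have "dens E s z = 0" "dens E' t z = 0"
        using dens_supp[OF E s(1), of z] dens_supp[OF E' t, of z] box_mono[OF s] by auto
      then show ?thesis using False by simp
    qed
  qed
  moreover have "induced E s x - induced E' t x = 1/2 * (LINT z|lborel. ?h z)"
    unfolding induced_def
    unfolding Bochner_Integration.integral_diff[OF induced_integrand(2)[OF E s(1)] induced_integrand(2)[OF E' t]]
    by (simp add: algebra_simps)
  ultimately show ?thesis by (simp only: abs_mult)
qed

lemma induced_drift:
  assumes E: "tame E" and s: "0 \<le> s" "s \<le> t"
  shows "\<bar>induced E s x - induced E t x\<bar> \<le> drift t * \<bar>s - t\<bar>"
proof -
  let ?c = "L0 * exp (rate t * t) * (rate t * \<bar>s - t\<bar>)"
  have "\<bar>induced E s x - induced E t x\<bar> \<le> 1/2 * ?c * vol t"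
  proof (rule induced_diff[OF E E s])
    show "\<bar>dens E s z - dens E t z\<bar> \<le> ?c" for z
      using dens_lipschitz[OF E, of s t t z z] s by simp
  qed (use L0 rate_ge[of t] s in auto)
  also have "\<dots> \<le> 1 * ?c * vol t"
    using L0 rate_ge[of t] s vol_nonneg[of t] by (intro mult_right_mono) auto
  also have "\<dots> = drift t * \<bar>s - t\<bar>" by (simp add: drift_def)
  finally show ?thesis .
qed

lemma induced_tame: "tame E \<Longrightarrow> tame (induced E)"
  unfolding tame_def[of "induced E"] using induced_bound induced_slope induced_drift by blast

end

section \<open>Existence of a self-consistent field\<close>

context vlasov_data
begin

text \<open>
  The product bounds the change of the induced field at time \<open>t\<close> relative to the time integral of the
  change of the field; the summand \<open>height t\<close> lets the weight dominate the first iterate as well.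
\<close>

definition contraction_rate :: "real \<Rightarrow> real" where
  "contraction_rate t = 1 + height t + vol t * L0 * exp (rate t * t)"

lemma contraction_rate_mono: "0 \<le> s \<Longrightarrow> s \<le> t \<Longrightarrow> contraction_rate s \<le> contraction_rate t"
  using vol_mono[of s t] vol_nonneg[of s] vol_nonneg[of t] rate_mono[of s t] rate_ge[of s] rate_ge[of t] L0
    height_mono[of s t]
  unfolding contraction_rate_def by (auto intro!: add_mono mult_mono mult_nonneg_nonneg)

lemma contraction_rate_ge: assumes "0 \<le> t" shows "1 \<le> contraction_rate t" "height t \<le> contraction_rate t" "vol t * L0 * exp (rate t * t) \<le> contraction_rate t"
  using height_nonneg[OF assms] vol_nonneg[OF assms] L0 by (auto simp: contraction_rate_def)

text \<open>
  Two flows with the same Lipschitz constant whose vector fields differ by at most an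
  exponential function of time are compared by Gronwall's inequality, the difference being integrated in closed form.
\<close>

lemma dens_stable:
  assumes E: "tame E" and E': "tame E'" and t: "0 \<le> t" and c: "0 \<le> c" and k: "0 < k"
    and close: "\<And>s x. 0 \<le> s \<Longrightarrow> s \<le> t \<Longrightarrow> \<bar>E s x - E' s x\<bar> \<le> c * exp (2 * k * (s + 1))"
  shows "\<bar>dens E t z - dens E' t z\<bar> \<le> L0 * (c * exp (2 * k * (t + 1)) / (2 * k) * exp (rate t * t))"
proof -
  interpret o1: bounded_ode "lorentz E" rate by (rule tame_bounded_ode[OF E])
  interpret o2: bounded_ode "lorentz E'" rate by (rule tame_bounded_ode[OF E'])
  let ?u = "\<lambda>s. o1.flow s t z" and ?w = "\<lambda>s. o2.flow s t z"
  let ?d = "\<lambda>s. c * exp (2 * k * (s + 1)) / (2 * k)"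
  have "norm ((\<lambda>s. ?u s - ?w s) 0) \<le> (norm ((\<lambda>s. ?u s - ?w s) t) + (?d t - ?d 0)) * exp (rate t * (t - 0))"
  proof (rule gronwall_backward[where y' = "\<lambda>s. lorentz E s (?u s) - lorentz E' s (?w s)"
        and d' = "\<lambda>s. c * exp (2 * k * (s + 1))"])
    fix s assume s: "s \<in> {0..t}"
    show "((\<lambda>s. ?u s - ?w s) has_vector_derivative lorentz E s (?u s) - lorentz E' s (?w s)) (at s within {0..t})"
      using s t by (intro has_vector_derivative_diff o1.solves_within[OF o1.flow_solves] o2.solves_within[OF o2.flow_solves]) auto
    show "(?d has_real_derivative c * exp (2 * k * (s + 1))) (at s within {0..t})"
      using k by (auto intro!: derivative_eq_intros)
    have "norm (lorentz E s (?u s) - lorentz E' s (?w s))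
        \<le> norm (lorentz E s (?u s) - lorentz E s (?w s)) + norm (lorentz E s (?w s) - lorentz E' s (?w s))"
      using norm_triangle_ineq[of "lorentz E s (?u s) - lorentz E s (?w s)" "lorentz E s (?w s) - lorentz E' s (?w s)"] by simp
    also have "norm (lorentz E s (?u s) - lorentz E s (?w s)) \<le> rate s * norm (?u s - ?w s)"
      using s by (intro o1.lip_F) auto
    also have "\<dots> \<le> rate t * norm (?u s - ?w s)" using s by (intro mult_right_mono rate_mono) auto
    also have "norm (lorentz E s (?w s) - lorentz E' s (?w s)) \<le> c * exp (2 * k * (s + 1))"
      using close[of s "fst (?w s)"] s by (simp add: lorentz_def norm_Pair)
    finally show "norm (lorentz E s (?u s) - lorentz E' s (?w s)) \<le> rate t * norm (?u s - ?w s) + c * exp (2 * k * (s + 1))"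
      by simp
  qed (use t c rate_ge[OF t] in auto)
  also have "\<dots> \<le> (?d t) * exp (rate t * t)"
    using t c k by (intro mult_mono) (auto simp: o1.flow_start o2.flow_start)
  finally have "norm (?u 0 - ?w 0) \<le> ?d t * exp (rate t * t)" by simp
  then have "L0 * norm (?u 0 - ?w 0) \<le> L0 * (?d t * exp (rate t * t))" using L0 by (intro mult_left_mono)
  moreover have "\<bar>dens E t z - dens E' t z\<bar> \<le> L0 * norm (?u 0 - ?w 0)" unfolding dens_def by (rule f0_lip)
  ultimately show ?thesis by linarith
qed

text \<open>
  With \<open>k = contraction_rate t\<close>, integrating the weight \<open>exp (2 k (s + 1))\<close> over \<open>s \<le> t\<close> gains a factor \<open>1 / (2 k)\<close>,
  which outweighs the Lipschitz constant of the map. The shift \<open>s + 1\<close> keeps the weight above the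
  size of the first iterate also near \<open>s = 0\<close>.
\<close>

theorem self_consistent_field_exists: "\<exists>E. tame E \<and> (\<forall>t\<ge>0. \<forall>x. induced E t x = E t x)"
proof -
  define cur :: "(real \<times> real \<Rightarrow> real) \<Rightarrow> field" where "cur U t x = U (t, x)" for U t x
  have "\<exists>U. tame (cur U) \<and> (\<forall>i\<in>{0..}\<times>UNIV. (\<lambda>(t, x). induced (cur U) t x) i = U i)"
  proof (rule weighted_contraction_fixed_point[where D = 1 and ?u0.0 = "\<lambda>_. 0"
        and w = "\<lambda>(t, x). exp (2 * contraction_rate t * (t + 1))" and T = "\<lambda>U (t, x). induced (cur U) t x" and P = "\<lambda>U. tame (cur U)"])
    show 0: "tame (cur (\<lambda>_. 0))"
      using height_nonneg slope_nonneg drift_nonneg by (auto simp: tame_def cur_def)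
    fix i :: "real \<times> real" assume "i \<in> {0..} \<times> UNIV"
    then obtain t x where i: "i = (t, x)" "0 \<le> t" by auto
    have "\<bar>induced (cur (\<lambda>_. 0)) t x\<bar> \<le> height t" by (rule induced_bound[OF 0 i(2)])
    also have "\<dots> \<le> 2 * contraction_rate t * (t + 1)"
    proof -
      have "0 \<le> contraction_rate t * t" using contraction_rate_ge(1)[OF i(2)] i(2) by simp
      then show ?thesis using contraction_rate_ge(1,2)[OF i(2)] by (simp add: algebra_simps)
    qed
    also have "\<dots> \<le> exp (2 * contraction_rate t * (t + 1))" using exp_ge_add_one_self[of "2 * contraction_rate t * (t + 1)"] by linarith
    finally show "norm ((case i of (t, x) \<Rightarrow> induced (cur (\<lambda>_. 0)) t x) - 0) \<le> 1 * (case i of (t, x) \<Rightarrow> exp (2 * contraction_rate t * (t + 1)))"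
      by (simp add: i)
  next
    show "tame (cur (\<lambda>(t, x). induced (cur U) t x))" if "tame (cur U)" for U
    proof -
      have "cur (\<lambda>(t, x). induced (cur U) t x) = induced (cur U)" by (simp add: cur_def fun_eq_iff)
      then show ?thesis using induced_tame[OF that] by simp
    qed
  next
    fix U V :: "real \<times> real \<Rightarrow> real" and c :: real
    assume U: "tame (cur U)" and V: "tame (cur V)" and c: "0 \<le> c"
      and close: "\<And>i. i \<in> {0..} \<times> UNIV \<Longrightarrow> norm (U i - V i) \<le> c * (case i of (t, x) \<Rightarrow> exp (2 * contraction_rate t * (t + 1)))"
    have "\<bar>induced (cur U) t x - induced (cur V) t x\<bar> \<le> c / 2 * exp (2 * contraction_rate t * (t + 1))" if t: "0 \<le> t" for t x
    proof -
      define k where "k = contraction_rate t"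
      have k: "0 < k" using contraction_rate_ge(1)[OF t] by (simp add: k_def)
      let ?m = "c * exp (2 * k * (t + 1)) / (2 * k) * exp (rate t * t)"
      have "\<bar>induced (cur U) t x - induced (cur V) t x\<bar> \<le> 1/2 * (L0 * ?m) * vol t"
      proof (rule induced_diff[OF U V t order_refl])
        show "\<bar>dens (cur U) t z - dens (cur V) t z\<bar> \<le> L0 * ?m" for z
        proof (rule dens_stable[OF U V t c k])
          fix s y assume s: "0 \<le> s" "s \<le> t"
          have "\<bar>cur U s y - cur V s y\<bar> \<le> c * exp (2 * contraction_rate s * (s + 1))"
            using close[of "(s, y)"] s by (simp add: cur_def)
          also have "\<dots> \<le> c * exp (2 * k * (s + 1))"
            using c s contraction_rate_mono[OF s] by (auto simp: k_def intro!: mult_left_mono mult_right_mono)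
          finally show "\<bar>cur U s y - cur V s y\<bar> \<le> c * exp (2 * k * (s + 1))" .
        qed
        show "0 \<le> L0 * ?m" using L0 c k by simp
      qed
      also have "\<dots> = c / 2 * exp (2 * k * (t + 1)) * ((vol t * L0 * exp (rate t * t)) / (2 * k))"
        by simp
      also have "\<dots> \<le> c / 2 * exp (2 * k * (t + 1)) * 1"
        using c k contraction_rate_ge(3)[OF t] by (intro mult_left_mono) (auto simp: k_def)
      finally show ?thesis by (simp add: k_def)
    qed
    then show "\<forall>i\<in>{0..} \<times> UNIV. norm ((case i of (t, x) \<Rightarrow> induced (cur U) t x) - (case i of (t, x) \<Rightarrow> induced (cur V) t x))
        \<le> c / 2 * (case i of (t, x) \<Rightarrow> exp (2 * contraction_rate t * (t + 1)))"
      by auto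
  next
    fix u :: "nat \<Rightarrow> real \<times> real \<Rightarrow> real" and U c
    assume u: "\<And>n. tame (cur (u n))"
      and close: "\<And>n i. i \<in> {0..} \<times> UNIV \<Longrightarrow> norm (u n i - U i) \<le> c * (1/2)^n * (case i of (t, x) \<Rightarrow> exp (2 * contraction_rate t * (t + 1)))"
    have lim: "(\<lambda>n. u n (t, x)) \<longlonglongrightarrow> U (t, x)" if t: "0 \<le> t" for t x
    proof -
      have "(\<lambda>n. u n (t, x) - U (t, x)) \<longlonglongrightarrow> 0"
      proof (rule Lim_null_comparison)
        show "\<forall>\<^sub>F n in sequentially. norm (u n (t, x) - U (t, x)) \<le> c * (1/2)^n * exp (2 * contraction_rate t * (t + 1))"
          using close[of "(t, x)"] t by simp
        have "(\<lambda>n. c * (1/2::real)^n * exp (2 * contraction_rate t * (t + 1))) \<longlonglongrightarrow> c * 0 * exp (2 * contraction_rate t * (t + 1))"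
          by (intro tendsto_intros LIMSEQ_power_zero) auto
        then show "(\<lambda>n. c * (1/2::real)^n * exp (2 * contraction_rate t * (t + 1))) \<longlonglongrightarrow> 0" by simp
      qed
      then show ?thesis by (simp add: LIM_zero_iff)
    qed
    show "tame (cur U)" unfolding tame_def cur_def
    proof (intro conjI allI impI)
      fix t x y :: real assume t: "0 \<le> t"
      show "\<bar>U (t, x)\<bar> \<le> height t"
        by (rule LIMSEQ_le_const2[OF tendsto_rabs[OF lim[OF t]]])
           (use tame_bound[OF u t] in \<open>auto simp: cur_def\<close>)
      show "\<bar>U (t, x) - U (t, y)\<bar> \<le> slope t * \<bar>x - y\<bar>"
        by (rule LIMSEQ_le_const2[OF tendsto_rabs[OF tendsto_diff[OF lim[OF t] lim[OF t]]]])
           (use tame_slope[OF u t] in \<open>auto simp: cur_def\<close>)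
    next
      fix s t x :: real assume s: "0 \<le> s" "s \<le> t"
      show "\<bar>U (s, x) - U (t, x)\<bar> \<le> drift t * \<bar>s - t\<bar>"
        by (rule LIMSEQ_le_const2[OF tendsto_rabs[OF tendsto_diff[OF lim lim]]])
           (use tame_drift[OF u s] s in \<open>auto simp: cur_def\<close>)
    qed
  qed simp
  then obtain U where "tame (cur U)" "\<forall>i\<in>{0..}\<times>UNIV. (\<lambda>(t, x). induced (cur U) t x) i = U i" by blast
  then show ?thesis by (intro exI[of _ "cur U"]) (auto simp: cur_def)
qed

end

section \<open>Velocity moments\<close>

text \<open>
  The gradient of \<open>v1 / sqrt (1 + |v|\<^sup>2)\<close>.
\<close>

definition vgrad :: "real \<times> real \<Rightarrow> real \<times> real" where
  "vgrad v = (1 / sqrt (1 + (norm v)\<^sup>2)) *\<^sub>R (1 - (fst (vhat v))\<^sup>2, - (fst (vhat v) * snd (vhat v)))"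

text \<open>
  Let \<open>a\<close>, \<open>b\<close> be the values of \<open>sqrt (1 + |.|\<^sup>2)\<close> and \<open>p\<close>, \<open>q\<close> the first components of \<open>vhat\<close> at \<open>v\<close>, \<open>w\<close>, and let
  \<open>d = |w - v|\<close>. The remainder equals \<open>(b - a) / a * (p - q) + p * ((b - a)\<^sup>2 - d\<^sup>2) / (2 * a\<^sup>2)\<close>, where
  \<open>|b - a| \<le> d\<close> and \<open>|p - q| \<le> 2 d\<close>. This avoids second derivatives.
\<close>

lemma vhat_quadratic_remainder:
  "\<bar>fst (vhat w) - fst (vhat v) - (fst (vgrad v) * fst (w - v) + snd (vgrad v) * snd (w - v))\<bar> \<le> 3 * (norm (w - v))\<^sup>2"
proof -
  obtain v1 v2 where v: "v = (v1, v2)" by force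
  obtain w1 w2 where w: "w = (w1, w2)" by force
  define a b where "a = sqrt (1 + (norm v)\<^sup>2)" and "b = sqrt (1 + (norm w)\<^sup>2)"
  define d where "d = norm (w - v)"
  have a1: "1 \<le> a" and b1: "1 \<le> b" and ab: "\<bar>b - a\<bar> \<le> d"
    using sqrt_one_plus_square_ge sqrt_one_plus_square_lipschitz by (auto simp: a_def b_def d_def)
  have a2: "a\<^sup>2 = 1 + v1\<^sup>2 + v2\<^sup>2" and b2: "b\<^sup>2 = 1 + w1\<^sup>2 + w2\<^sup>2" and d2: "d\<^sup>2 = (w1 - v1)\<^sup>2 + (w2 - v2)\<^sup>2"
    by (simp_all add: a_def b_def d_def v w norm_Pair)
  have d0: "0 \<le> d" by (simp add: d_def)
  define p where "p = fst (vhat v)" define q where "q = fst (vhat w)"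
  have p: "p * a = v1" and q: "q * b = w1" and r: "snd (vhat v) * a = v2"
    using a1 b1 vhat_def[of v, folded a_def] vhat_def[of w, folded b_def]
    by (simp_all add: p_def q_def v w)
  have pq: "\<bar>p - q\<bar> \<le> 2 * d"
  proof -
    have "\<bar>p - q\<bar> \<le> norm (vhat v - vhat w)"
      unfolding p_def q_def using abs_fst_le_norm[of "vhat v - vhat w"] by simp
    then show ?thesis using vhat_lipschitz[of v w] by (simp add: d_def norm_minus_commute)
  qed
  have p1: "\<bar>p\<bar> < 1" using abs_vhat_less_1 by (simp add: p_def)
  let ?X = "q - p - (fst (vgrad v) * (w1 - v1) + snd (vgrad v) * (w2 - v2))"
  have "?X = (b - a) / a * (p - q) + p * ((b - a)\<^sup>2 - d\<^sup>2) / (2 * a\<^sup>2)"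
  proof -
    have g: "fst (vgrad v) = (1 - p\<^sup>2) / a" "snd (vgrad v) = - (p * (v2 / a)) / a"
      using r a1 by (auto simp: vgrad_def a_def[symmetric] p_def field_simps)
    have vh: "2 * (v1 * (w1 - v1) + v2 * (w2 - v2)) = b\<^sup>2 - a\<^sup>2 - d\<^sup>2"
      unfolding a2 b2 d2 by (simp add: power2_eq_square algebra_simps)
    have v1: "v1 = p * a" and w1: "w1 = q * b" using p q by auto
    have "?X * (2 * a\<^sup>2) = 2 * a\<^sup>2 * (q - p) - 2 * a * (w1 - v1) + p * (2 * (v1 * (w1 - v1) + v2 * (w2 - v2)))"
    proof -
      have "?X * (2 * a\<^sup>2) = 2 * a\<^sup>2 * (q - p) - 2 * a * (1 - p\<^sup>2) * (w1 - v1) + 2 * p * v2 * (w2 - v2)"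
        unfolding g using a1 by (simp add: power2_eq_square field_simps)
      also have "\<dots> = 2 * a\<^sup>2 * (q - p) - 2 * a * (w1 - v1) + 2 * p * (p * a) * (w1 - v1) + 2 * p * v2 * (w2 - v2)"
        by (simp add: power2_eq_square algebra_simps)
      finally show ?thesis unfolding p by (simp add: algebra_simps)
    qed
    also have "\<dots> = 2 * a\<^sup>2 * (q - p) - 2 * a * (q * b - p * a) + p * (b\<^sup>2 - a\<^sup>2 - d\<^sup>2)"
      unfolding vh p q ..
    also have "\<dots> = 2 * a * (b - a) * (p - q) + p * ((b - a)\<^sup>2 - d\<^sup>2)"
      by (simp add: power2_eq_square algebra_simps)
    finally have "?X * (2 * a\<^sup>2) = 2 * a * (b - a) * (p - q) + p * ((b - a)\<^sup>2 - d\<^sup>2)" .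
    then have "?X = (2 * a * (b - a) * (p - q) + p * ((b - a)\<^sup>2 - d\<^sup>2)) / (2 * a\<^sup>2)"
      using a1 by (simp add: eq_divide_eq)
    then show ?thesis using a1 by (simp add: add_divide_distrib power2_eq_square)
  qed
  moreover have "\<bar>(b - a) / a * (p - q)\<bar> \<le> d * (2 * d)"
  proof -
    have "\<bar>(b - a) / a\<bar> \<le> d / 1" unfolding abs_divide using a1 ab d0 by (intro frac_le) auto
    then show ?thesis unfolding abs_mult using pq d0 by (intro mult_mono) auto
  qed
  moreover have "\<bar>p * ((b - a)\<^sup>2 - d\<^sup>2) / (2 * a\<^sup>2)\<bar> \<le> 1 * d\<^sup>2 / 1"
  proof -
    have "(b - a)\<^sup>2 \<le> d\<^sup>2" using ab d0 by (metis abs_le_square_iff abs_of_nonneg)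
    then have "\<bar>(b - a)\<^sup>2 - d\<^sup>2\<bar> \<le> d\<^sup>2" by (simp add: abs_le_iff)
    moreover have "1 \<le> 2 * a\<^sup>2" using one_le_power[OF a1, of 2] by linarith
    ultimately show ?thesis unfolding abs_divide abs_mult using p1 by (intro frac_le mult_mono) auto
  qed
  ultimately have "\<bar>?X\<bar> \<le> d * (2 * d) + 1 * d\<^sup>2 / 1" by linarith
  then show ?thesis by (simp add: p_def q_def v w d_def power2_eq_square)
qed

lemma vgrad_bound: "\<bar>fst (vgrad v)\<bar> \<le> 1" "\<bar>snd (vgrad v)\<bar> \<le> 1"
proof -
  define a where "a = sqrt (1 + (norm v)\<^sup>2)"
  have a: "1 \<le> a" using sqrt_one_plus_square_ge(1) by (simp add: a_def)
  have "(fst (vhat v))\<^sup>2 \<le> 1" "\<bar>fst (vhat v) * snd (vhat v)\<bar> \<le> 1 * 1"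
    unfolding abs_mult using abs_vhat_less_1[of v, THEN less_imp_le]
    by (simp add: abs_square_le_1, intro mult_mono) auto
  then have "\<bar>1 - (fst (vhat v))\<^sup>2\<bar> \<le> 1" "\<bar>- (fst (vhat v) * snd (vhat v))\<bar> \<le> 1"
    by auto
  then show "\<bar>fst (vgrad v)\<bar> \<le> 1" "\<bar>snd (vgrad v)\<bar> \<le> 1"
    using a by (auto simp: vgrad_def a_def[symmetric] abs_mult abs_divide divide_le_eq)
qed

lemma vgrad_continuous: "continuous_on S vgrad"
proof -
  have "sqrt (1 + (norm v)\<^sup>2) \<noteq> 0" for v :: "real \<times> real"
    using sqrt_one_plus_square_ge(1)[of v] by linarith
  then show ?thesis unfolding vgrad_def by (intro continuous_intros vhat_continuous) auto
qed

text \<open>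
  The derivative of the characteristic vector field is a combination of these three fixed maps with
  scalar coefficients, so its continuity in the operator norm reduces to that of the coefficients.
\<close>

lift_definition v1_to_x :: "phase \<Rightarrow>\<^sub>L phase" is "\<lambda>h. (fst (snd h), 0, 0)"
  by (intro bounded_linear_intros)
lift_definition v2_to_x :: "phase \<Rightarrow>\<^sub>L phase" is "\<lambda>h. (snd (snd h), 0, 0)"
  by (intro bounded_linear_intros)
lift_definition x_to_v1 :: "phase \<Rightarrow>\<^sub>L phase" is "\<lambda>h. (0, fst h, 0)"
  by (intro bounded_linear_intros)

lemma coordinate_maps_norm: "norm v1_to_x \<le> 1" "norm v2_to_x \<le> 1" "norm x_to_v1 \<le> 1"
proof -
  have le: "\<bar>fst (snd h)\<bar> \<le> norm h" "\<bar>snd (snd h)\<bar> \<le> norm h" "\<bar>fst h\<bar> \<le> norm h" for h :: phase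
    using norm_fst_le[of "fst h" "snd h"] norm_snd_le[of "snd h" "fst h"]
      norm_fst_le[of "fst (snd h)" "snd (snd h)"] norm_snd_le[of "snd (snd h)" "fst (snd h)"] by auto
  show "norm v1_to_x \<le> 1" by (rule norm_blinfun_bound) (use le in \<open>auto simp: v1_to_x.rep_eq norm_Pair\<close>)
  show "norm v2_to_x \<le> 1" by (rule norm_blinfun_bound) (use le in \<open>auto simp: v2_to_x.rep_eq norm_Pair\<close>)
  show "norm x_to_v1 \<le> 1" by (rule norm_blinfun_bound) (use le in \<open>auto simp: x_to_v1.rep_eq norm_Pair\<close>)
qed

context vlasov_data
begin

text \<open>
  The charge density and both components of the current are moments with a bounded weight \<open>w\<close>.
\<close>

definition moment :: "field \<Rightarrow> (real \<times> real \<Rightarrow> real) \<Rightarrow> real \<Rightarrow> real \<Rightarrow> real" where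
  "moment E w t x = (LINT v|lborel. dens E t (x, v) * w v)"

definition vbox :: "real \<Rightarrow> (real \<times> real) set" where
  "vbox t = cbox (- reach t, - R) (reach t, R)"

lemma dens_vsupp:
  assumes "tame E" "0 \<le> t" "dens E t (x, v) \<noteq> 0"
  shows "v \<in> vbox t" "\<bar>x\<bar> \<le> R + t"
  using dens_supp[OF assms] by (cases v; auto simp: box_def vbox_def cbox_Pair_eq)+

lemma vbox_mono: "0 \<le> s \<Longrightarrow> s \<le> t \<Longrightarrow> vbox s \<subseteq> vbox t"
  using reach_mono[of s t] by (auto simp: vbox_def)

lemma measure_vbox: "measure lborel (vbox t) = 4 * reach t * R"
  using R reach_pos[of t] by (simp add: vbox_def content_Pair)

lemma integral_bounded_on_vbox:
  fixes h :: "real \<times> real \<Rightarrow> real"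
  assumes "h \<in> borel_measurable lborel" "\<And>z. \<bar>h z\<bar> \<le> C * indicator (vbox t) z"
  shows "integrable lborel h" and "\<bar>LINT z|lborel. h z\<bar> \<le> C * (4 * reach t * R)"
  using integral_bounded_on_cbox[OF assms(1), of C] assms(2) measure_vbox[of t]
  unfolding vbox_def by metis+

text \<open>
  The area of the velocity support times the Lipschitz constant of the density.
\<close>

definition moment_slope :: "real \<Rightarrow> real" where "moment_slope t = 4 * reach t * R * (L0 * exp (rate t * t))"

lemma moment_slope_nonneg: "0 \<le> moment_slope t" using R L0 reach_pos[of t] by (simp add: moment_slope_def)

lemma moment_slope_mono: "0 \<le> s \<Longrightarrow> s \<le> t \<Longrightarrow> moment_slope s \<le> moment_slope t"
  using R L0 reach_pos[of s] reach_mono[of s t] rate_mono[of s t] rate_ge[of s] unfolding moment_slope_def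
  by (auto intro!: mult_mono)

lemma dens_at_x_continuous: "tame E \<Longrightarrow> 0 \<le> t \<Longrightarrow> continuous_on S (\<lambda>v. dens E t (x, v))"
  by (rule continuous_on_compose2[OF dens_continuous_at[of E t UNIV]
        continuous_on_Pair[OF continuous_on_const continuous_on_id]]) auto

lemma moment_integrand:
  assumes E: "tame E" and t: "0 \<le> t" and w: "continuous_on UNIV w" "\<And>v. \<bar>w v\<bar> \<le> 1"
  shows "(\<lambda>v. dens E t (x, v) * w v) \<in> borel_measurable lborel"
    "integrable lborel (\<lambda>v. dens E t (x, v) * w v)" "\<bar>moment E w t x\<bar> \<le> slope t"
proof -
  show m: "(\<lambda>v. dens E t (x, v) * w v) \<in> borel_measurable lborel"
    using borel_measurable_continuous_onI[OF continuous_on_mult[OF dens_at_x_continuous[OF E t] w(1)]] by simp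
  have b: "\<bar>dens E t (x, v) * w v\<bar> \<le> A * indicator (vbox t) v" for v
  proof -
    have "\<bar>dens E t (x, v)\<bar> * \<bar>w v\<bar> \<le> A * 1"
      using dens_nonneg[of E t "(x, v)"] dens_le[of E t "(x, v)"] w(2)[of v] A by (intro mult_mono) auto
    then show ?thesis using dens_vsupp(1)[OF E t, of x v] by (cases "dens E t (x, v) = 0") (auto simp: abs_mult A)
  qed
  show "integrable lborel (\<lambda>v. dens E t (x, v) * w v)" by (rule integral_bounded_on_vbox(1)[OF m b])
  show "\<bar>moment E w t x\<bar> \<le> slope t"
    using integral_bounded_on_vbox(2)[OF m b] by (simp add: moment_def slope_def mult_ac)
qed

lemma moment_lipschitz:
  assumes E: "tame E" and st: "0 \<le> s" "0 \<le> t" "s \<le> N" "t \<le> N"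
    and w: "continuous_on UNIV w" "\<And>v. \<bar>w v\<bar> \<le> 1"
  shows "\<bar>moment E w s y - moment E w t x\<bar> \<le> moment_slope N * (\<bar>y - x\<bar> + rate N * \<bar>s - t\<bar>)"
proof -
  let ?c = "L0 * exp (rate N * N) * (\<bar>y - x\<bar> + rate N * \<bar>s - t\<bar>)"
  let ?h = "\<lambda>v. dens E s (y, v) * w v - dens E t (x, v) * w v"
  have c: "0 \<le> ?c" using L0 rate_ge[of N] st by simp
  have b: "\<bar>?h v\<bar> \<le> ?c * indicator (vbox N) v" for v
  proof (cases "v \<in> vbox N")
    case True
    have "norm ((y, v) - (x, v)) = \<bar>y - x\<bar>" by (simp add: norm_Pair)
    then have "\<bar>dens E s (y, v) - dens E t (x, v)\<bar> \<le> ?c"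
      using dens_lipschitz[OF E st, of "(y, v)" "(x, v)"] by simp
    then have "\<bar>dens E s (y, v) - dens E t (x, v)\<bar> * \<bar>w v\<bar> \<le> ?c * 1"
      using w(2) c by (intro mult_mono) auto
    then show ?thesis using True by (simp add: abs_mult[symmetric] left_diff_distrib)
  next
    case False
    then have "dens E s (y, v) = 0" "dens E t (x, v) = 0"
      using dens_vsupp(1)[OF E, of s y v] dens_vsupp(1)[OF E, of t x v] st vbox_mono[of s N] vbox_mono[of t N] by blast+
    then show ?thesis using c by simp
  qed
  have "\<bar>LINT v|lborel. ?h v\<bar> \<le> ?c * (4 * reach N * R)"
    by (rule integral_bounded_on_vbox(2)[OF borel_measurable_diff b])
       (use moment_integrand(1)[OF E _ w] st in auto)
  moreover have "moment E w s y - moment E w t x = (LINT v|lborel. ?h v)"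
    unfolding moment_def
    by (rule Bochner_Integration.integral_diff[symmetric]) (use moment_integrand(2)[OF E _ w] st in auto)
  moreover have "?c * (4 * reach N * R) = moment_slope N * (\<bar>y - x\<bar> + rate N * \<bar>s - t\<bar>)"
    by (simp add: moment_slope_def)
  ultimately show ?thesis by (simp only:)
qed

lemma moment_continuous:
  assumes E: "tame E" and w: "continuous_on UNIV w" "\<And>v. \<bar>w v\<bar> \<le> 1"
  shows "continuous_on ({0..} \<times> UNIV) (\<lambda>(t, x). moment E w t x)"
proof (rule continuous_on_half_space_if_locally_lipschitz)
  fix N :: real assume N: "0 \<le> N"
  have "norm (moment E w s y - moment E w t x) \<le> moment_slope N * (1 + rate N) * (norm (y - x) + \<bar>s - t\<bar>)"
    if "s \<in> {0..N}" "t \<in> {0..N}" for s t y x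
  proof -
    have "norm (moment E w s y - moment E w t x) \<le> moment_slope N * (\<bar>y - x\<bar> + rate N * \<bar>s - t\<bar>)"
      using moment_lipschitz[OF E _ _ _ _ w, of s t N y x] that by simp
    also have "\<dots> \<le> moment_slope N * ((1 + rate N) * (norm (y - x) + \<bar>s - t\<bar>))"
      using rate_ge[OF N] moment_slope_nonneg by (intro mult_left_mono) (auto simp: algebra_simps)
    finally show ?thesis by (simp add: mult.assoc)
  qed
  then show "\<exists>L. \<forall>s\<in>{0..N}. \<forall>t\<in>{0..N}. \<forall>y x. norm (moment E w s y - moment E w t x) \<le> L * (norm (y - x) + \<bar>s - t\<bar>)"
    by blast
qed

abbreviation "charge E \<equiv> moment E (\<lambda>_. 1)"

lemma charge_nonneg: "0 \<le> charge E t x"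
  unfolding moment_def using dens_nonneg by (intro Bochner_Integration.integral_nonneg) auto

lemma charge_continuous_at: "tame E \<Longrightarrow> 0 \<le> t \<Longrightarrow> continuous_on S (charge E t)"
  using continuous_on_compose2[OF moment_continuous[of E "\<lambda>_. 1"] continuous_on_Pair[OF continuous_on_const[of S t] continuous_on_id]]
  by force

lemma charge_supp: "tame E \<Longrightarrow> 0 \<le> t \<Longrightarrow> R + t < \<bar>x\<bar> \<Longrightarrow> moment E w t x = 0"
proof -
  assume "tame E" "0 \<le> t" "R + t < \<bar>x\<bar>"
  then have "dens E t (x, v) = 0" for v using dens_vsupp(2)[of E t x v] by auto
  then show ?thesis by (simp add: moment_def)
qed

lemma charge_integrable:
  assumes E: "tame E" and t: "0 \<le> t"
  shows "integrable lborel (charge E t)"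
proof (rule integral_bounded_on_cbox(1))
  show "charge E t \<in> borel_measurable lborel"
    using borel_measurable_continuous_onI[OF charge_continuous_at[OF E t]] by simp
  show "\<bar>charge E t x\<bar> \<le> slope t * indicator (cbox (- (R + t)) (R + t)) x" for x
    using moment_integrand(3)[OF E t, of "\<lambda>_. 1" x] charge_supp[OF E t, of x] slope_nonneg[of t]
    by (cases "R + t < \<bar>x\<bar>") (auto simp: indicator_def)
qed

lemma induced_charge:
  assumes E: "tame E" and t: "0 \<le> t"
  shows "induced E t x = 1/2 * (LINT y|lborel. sgn (x - y) * charge E t y)"
proof -
  have "integrable (lborel \<Otimes>\<^sub>M lborel) (\<lambda>(y, v). sgn (x - y) * dens E t (y, v))"
    using induced_integrand(2)[OF E t, of x] by (simp add: lborel_prod case_prod_beta')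
  from lborel_pair.integral_fst[OF this]
  have "(LINT z|lborel. sgn (x - fst z) * dens E t z) = (LINT y|lborel. LINT v|lborel. sgn (x - y) * dens E t (y, v))"
    by (simp add: lborel_prod case_prod_beta')
  then show ?thesis by (simp add: induced_def moment_def)
qed

lemma sgn_charge_integrable:
  assumes E: "tame E" and t: "0 \<le> t"
  shows "integrable lborel (\<lambda>y. sgn (x - y) * charge E t y)"
proof (rule Bochner_Integration.integrable_bound[OF charge_integrable[OF E t]])
  have "(\<lambda>y::real. sgn (x - y)) \<in> borel_measurable borel"
    by (rule measurable_compose[where N = borel]) simp_all
  then show "(\<lambda>y. sgn (x - y) * charge E t y) \<in> borel_measurable lborel"
    using borel_measurable_continuous_onI[OF charge_continuous_at[OF E t]] by simp
qed (auto simp: abs_mult sgn_real_def)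

text \<open>
  Away from \<open>y = a\<close> and \<open>y = b\<close> the difference of the two signs is \<open>2\<close> between these points and \<open>0\<close> elsewhere.
\<close>

lemma induced_increment:
  assumes E: "tame E" and t: "0 \<le> t" and ab: "a \<le> b"
  shows "induced E t b - induced E t a = (LINT y|lborel. indicator (cbox a b) y * charge E t y)"
proof -
  have "induced E t b - induced E t a = 1/2 * (LINT y|lborel. sgn (b - y) * charge E t y - sgn (a - y) * charge E t y)"
    unfolding induced_charge[OF E t]
      Bochner_Integration.integral_diff[OF sgn_charge_integrable[OF E t] sgn_charge_integrable[OF E t]]
    by (simp add: algebra_simps)
  also have "\<dots> = (LINT y|lborel. 1/2 * (sgn (b - y) * charge E t y - sgn (a - y) * charge E t y))"
    by simp
  also have "\<dots> = (LINT y|lborel. indicator (cbox a b) y * charge E t y)"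
  proof (rule integral_cong_AE)
    have "AE y in lborel. y \<noteq> a \<and> y \<noteq> b" by (intro AE_conjI AE_lborel_singleton)
    then show "AE y in lborel. 1/2 * (sgn (b - y) * charge E t y - sgn (a - y) * charge E t y) = indicator (cbox a b) y * charge E t y"
      by eventually_elim (use ab in \<open>auto simp: sgn_real_def indicator_def\<close>)
    show "(\<lambda>y. 1/2 * (sgn (b - y) * charge E t y - sgn (a - y) * charge E t y)) \<in> borel_measurable lborel"
      by (intro borel_measurable_times[OF borel_measurable_const borel_measurable_diff]
          borel_measurable_integrable[OF sgn_charge_integrable[OF E t]])
    show "(\<lambda>y. indicator (cbox a b) y * charge E t y) \<in> borel_measurable lborel"
      using borel_measurable_integrable[OF charge_integrable[OF E t]]
      by (intro borel_measurable_times borel_measurable_indicator) auto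
  qed
  finally show ?thesis .
qed

lemma induced_mono: "tame E \<Longrightarrow> 0 \<le> t \<Longrightarrow> a \<le> b \<Longrightarrow> induced E t a \<le> induced E t b"
proof -
  assume *: "tame E" "0 \<le> t" "a \<le> b"
  have "0 \<le> (LINT y|lborel. indicator (cbox a b) y * charge E t y)"
    by (intro Bochner_Integration.integral_nonneg) (simp add: charge_nonneg)
  then show ?thesis using induced_increment[OF *] by linarith
qed

text \<open>
  The charge density is the \<open>x\<close>-derivative of the field and is Lipschitz; both facts are contained in
  this quadratic bound, which is the form needed for the flow to be differentiable.
\<close>

lemma induced_remainder:
  assumes E: "tame E" and t: "0 \<le> t"
  shows "\<bar>induced E t y - induced E t x - charge E t x * (y - x)\<bar> \<le> moment_slope t * \<bar>y - x\<bar>\<^sup>2"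
proof -
  have *: "\<bar>induced E t b - induced E t a - charge E t p * (b - a)\<bar> \<le> moment_slope t * \<bar>b - a\<bar>\<^sup>2"
    if ab: "a \<le> b" and p: "p \<in> {a, b}" for a b p
  proof -
    let ?h = "\<lambda>y. indicator (cbox a b) y * charge E t y - indicator (cbox a b) y * charge E t p"
    have i1: "integrable lborel (\<lambda>y. indicator (cbox a b) y * charge E t y)"
      by (rule Bochner_Integration.integrable_bound[OF charge_integrable[OF E t]])
         (use borel_measurable_integrable[OF charge_integrable[OF E t]] in \<open>auto simp: indicator_def\<close>)
    have i2: "integrable lborel (\<lambda>y. indicator (cbox a b) y * charge E t p)"
      by (intro integrable_mult_left integrable_real_indicator) (use emeasure_lborel_cbox_finite[of a b] in auto)
    have b: "\<bar>?h y\<bar> \<le> moment_slope t * \<bar>b - a\<bar> * indicator (cbox a b) y" for y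
    proof (cases "y \<in> cbox a b")
      case True
      have "\<bar>charge E t y - charge E t p\<bar> \<le> moment_slope t * (\<bar>y - p\<bar> + rate t * \<bar>t - t\<bar>)"
        by (rule moment_lipschitz[OF E]) (use t in auto)
      also have "\<dots> \<le> moment_slope t * \<bar>b - a\<bar>" using True p ab moment_slope_nonneg by (auto intro!: mult_left_mono)
      finally show ?thesis using True by simp
    qed simp
    have "\<bar>LINT y|lborel. ?h y\<bar> \<le> moment_slope t * \<bar>b - a\<bar> * measure lborel (cbox a b)"
      by (rule integral_bounded_on_cbox(2)[OF borel_measurable_diff b])
         (use borel_measurable_integrable[OF i1] borel_measurable_integrable[OF i2] in auto)
    moreover have "(LINT y|lborel. ?h y) = induced E t b - induced E t a - charge E t p * (b - a)"
      unfolding Bochner_Integration.integral_diff[OF i1 i2] induced_increment[OF E t ab, symmetric]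
      using ab by simp
    ultimately show ?thesis using ab by (simp add: power2_eq_square mult.assoc)
  qed
  show ?thesis
  proof (cases "x \<le> y")
    case True
    then show ?thesis using *[of x y x] by simp
  next
    case False
    then have "\<bar>induced E t x - induced E t y - charge E t x * (x - y)\<bar> \<le> moment_slope t * \<bar>x - y\<bar>\<^sup>2"
      using *[of y x x] by simp
    moreover have "induced E t x - induced E t y - charge E t x * (x - y) = - (induced E t y - induced E t x - charge E t x * (y - x))"
      by (simp add: algebra_simps)
    ultimately show ?thesis by (simp only: abs_minus_cancel abs_minus_commute[of x y])
  qed
qed

end

section \<open>Smoothness of the self-consistent solution\<close>

lemma continuous_on_blinfun_scaleR_left:
  "continuous_on S f \<Longrightarrow> continuous_on S (\<lambda>x. blinfun_scaleR_left (f x))"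
  by (rule bounded_linear.continuous_on[OF bounded_linear_blinfun_scaleR_left])

lemma continuous_on_blinfun_compose:
  "continuous_on S f \<Longrightarrow> continuous_on S g \<Longrightarrow> continuous_on S (\<lambda>x. f x o\<^sub>L g x)"
  by (rule bounded_bilinear.continuous_on[OF bounded_bilinear_blinfun_compose])

text \<open>
  Since \<open>E\<close> equals its own induced field, it inherits the regularity of the induced field, one degree
  better than \<open>tame\<close>.
\<close>

locale self_consistent_field = vlasov_data +
  fixes E :: field
  assumes tame: "tame E" and consistent: "\<And>t x. 0 \<le> t \<Longrightarrow> induced E t x = E t x"
begin

definition smooth_rate :: "real \<Rightarrow> real" where "smooth_rate t = rate t + (3 + moment_slope t)"

definition jac :: "real \<Rightarrow> phase \<Rightarrow> phase \<Rightarrow>\<^sub>L phase" where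
  "jac t z = fst (vgrad (snd z)) *\<^sub>R v1_to_x + snd (vgrad (snd z)) *\<^sub>R v2_to_x + charge E t (fst z) *\<^sub>R x_to_v1"

lemma charge_along_continuous: "continuous_on ({0..} \<times> UNIV) (\<lambda>p::real \<times> phase. charge E (fst p) (fst (snd p)))"
proof -
  have "continuous_on ({0..} \<times> UNIV) ((\<lambda>(t, x). charge E t x) \<circ> (\<lambda>p::real \<times> phase. (fst p, fst (snd p))))"
    by (rule continuous_on_compose)
       (auto intro!: continuous_intros continuous_on_subset[OF moment_continuous[OF tame]])
  then show ?thesis by (simp add: o_def)
qed

sublocale char: smooth_ode "lorentz E" smooth_rate jac
proof -
  interpret b: bounded_ode "lorentz E" rate by (rule tame_bounded_ode[OF tame])
  have ge: "rate t \<le> smooth_rate t" "3 + moment_slope t \<le> smooth_rate t" if "0 \<le> t" for t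
    using moment_slope_nonneg[of t] rate_ge[OF that] by (auto simp: smooth_rate_def)
  show "smooth_ode (lorentz E) smooth_rate jac"
  proof
    show "continuous_on ({0..} \<times> UNIV) (\<lambda>(t, z). lorentz E t z)" by (rule b.cont_F)
    show "smooth_rate s \<le> smooth_rate t" if "0 \<le> s" "s \<le> t" for s t
      using rate_mono[OF that] moment_slope_mono[OF that] by (simp add: smooth_rate_def)
    show "0 < smooth_rate t" if "0 \<le> t" for t using rate_ge[OF that] ge[OF that] by linarith
    show "norm (lorentz E t y - lorentz E t z) \<le> smooth_rate t * norm (y - z)" if "0 \<le> t" for t y z
      by (rule order_trans[OF b.lip_F[OF that] mult_right_mono]) (use ge[OF that] in auto)
    show "norm (lorentz E t 0) \<le> smooth_rate t" if "0 \<le> t" for t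
      using b.F_zero[OF that] ge[OF that] by linarith
    show "norm (lorentz E t z) \<le> smooth_rate t" if "0 \<le> t" for t z
      using b.F_bound[OF that, of z] ge[OF that] by linarith
    show "norm (lorentz E t y - lorentz E t z - jac t z (y - z)) \<le> smooth_rate t * (norm (y - z))\<^sup>2" if t: "0 \<le> t" for t y z
    proof -
      let ?a = "fst (vhat (snd y)) - fst (vhat (snd z)) - (fst (vgrad (snd z)) * fst (snd y - snd z) + snd (vgrad (snd z)) * snd (snd y - snd z))"
      let ?b = "E t (fst y) - E t (fst z) - charge E t (fst z) * (fst y - fst z)"
      have "lorentz E t y - lorentz E t z - jac t z (y - z) = (?a, ?b, 0)"
        by (simp add: lorentz_def jac_def blinfun.add_left blinfun.scaleR_left
            v1_to_x.rep_eq v2_to_x.rep_eq x_to_v1.rep_eq algebra_simps)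
      moreover have "norm (?a, ?b, 0::real) \<le> \<bar>?a\<bar> + \<bar>?b\<bar>"
        using norm_Pair_le[of ?a "(?b, 0::real)"] by simp
      moreover have "\<bar>?a\<bar> \<le> 3 * (norm (y - z))\<^sup>2"
      proof -
        have "\<bar>?a\<bar> \<le> 3 * (norm (snd y - snd z))\<^sup>2" by (rule vhat_quadratic_remainder)
        also have "\<dots> \<le> 3 * (norm (y - z))\<^sup>2"
          using norm_snd_le_norm[of "y - z"] by (auto intro!: power_mono)
        finally show ?thesis .
      qed
      moreover have "\<bar>?b\<bar> \<le> moment_slope t * (norm (y - z))\<^sup>2"
      proof -
        have "\<bar>?b\<bar> \<le> moment_slope t * \<bar>fst y - fst z\<bar>\<^sup>2"
          using induced_remainder[OF tame t, of "fst y" "fst z"] t by (simp add: consistent)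
        also have "\<dots> \<le> moment_slope t * (norm (y - z))\<^sup>2"
          using abs_fst_le_norm[of "y - z"] moment_slope_nonneg by (intro mult_left_mono power_mono) auto
        finally show ?thesis .
      qed
      ultimately have "norm (lorentz E t y - lorentz E t z - jac t z (y - z)) \<le> (3 + moment_slope t) * (norm (y - z))\<^sup>2"
        by (simp add: algebra_simps)
      also have "\<dots> \<le> smooth_rate t * (norm (y - z))\<^sup>2" using ge[OF t] by (intro mult_right_mono) auto
      finally show ?thesis .
    qed
    show "norm (jac t z) \<le> smooth_rate t" if t: "0 \<le> t" for t z
    proof -
      have "norm (jac t z) \<le> \<bar>fst (vgrad (snd z))\<bar> * norm v1_to_x + \<bar>snd (vgrad (snd z))\<bar> * norm v2_to_x
          + \<bar>charge E t (fst z)\<bar> * norm x_to_v1"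
        unfolding jac_def by (intro norm_triangle_le add_mono) auto
      also have "\<dots> \<le> 1 * 1 + 1 * 1 + slope t * 1"
        using coordinate_maps_norm vgrad_bound[of "snd z"] moment_integrand(3)[OF tame t, of "\<lambda>_. 1" "fst z"] slope_nonneg
        by (intro add_mono mult_mono) auto
      also have "\<dots> \<le> smooth_rate t"
        using moment_slope_nonneg[of t] height_nonneg[OF t] by (simp add: smooth_rate_def rate_def)
      finally show ?thesis .
    qed
    have "continuous_on ({0..} \<times> UNIV) (\<lambda>p::real \<times> phase. vgrad (snd (snd p)))"
      by (rule continuous_on_compose2[OF vgrad_continuous[of UNIV]]) (auto intro!: continuous_intros)
    then show "continuous_on ({0..} \<times> UNIV) (\<lambda>(t, z). jac t z)"
      unfolding jac_def case_prod_beta' by (intro continuous_intros charge_along_continuous)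
  qed
qed

definition dens_deriv :: "real \<Rightarrow> phase \<Rightarrow> (real \<times> phase) \<Rightarrow>\<^sub>L real" where
  "dens_deriv t z = Df0 (E_flow E 0 t z) o\<^sub>L char.dflow t z o\<^sub>L (snd_blinfun - (blinfun_scaleR_left (lorentz E t z) o\<^sub>L fst_blinfun))"

lemma dens_deriv_apply: "dens_deriv t z (\<tau>, h) = Df0 (E_flow E 0 t z) (char.dflow t z (h - \<tau> *\<^sub>R lorentz E t z))"
  by (simp add: dens_deriv_def blinfun.diff_left)

lemma dens_has_derivative:
  assumes t: "0 \<le> t"
  shows "((\<lambda>(t, z). dens E t z) has_derivative dens_deriv t z) (at (t, z) within {0..} \<times> UNIV)"
proof -
  have "((\<lambda>p. f0 (case p of (s, y) \<Rightarrow> E_flow E 0 s y)) has_derivative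
      (\<lambda>p. Df0 (E_flow E 0 t z) (case p of (\<tau>, h) \<Rightarrow> char.dflow t z (h - \<tau> *\<^sub>R lorentz E t z))))
      (at (t, z) within {0..} \<times> UNIV)"
    by (rule has_derivative_compose[OF char.flow_to_0_derivative[OF t]]) (use f0_deriv in simp)
  moreover have "(\<lambda>p. f0 (case p of (s, y) \<Rightarrow> E_flow E 0 s y)) = (\<lambda>(t, z). dens E t z)"
    by (auto simp: dens_def)
  moreover have "(\<lambda>p. Df0 (E_flow E 0 t z) (case p of (\<tau>, h) \<Rightarrow> char.dflow t z (h - \<tau> *\<^sub>R lorentz E t z))) = dens_deriv t z"
    by (auto simp: dens_deriv_apply)
  ultimately show ?thesis by simp
qed

lemma dens_deriv_continuous: "continuous_on ({0..} \<times> UNIV) (\<lambda>(t, z). dens_deriv t z)"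
proof -
  have fl: "continuous_on ({0..} \<times> UNIV) (\<lambda>(t, z). E_flow E 0 t z)"
    unfolding continuous_on_eq_continuous_within
    using char.flow_to_0_derivative has_derivative_continuous by fastforce
  have "continuous_on ({0..} \<times> UNIV) (\<lambda>p. Df0 (E_flow E 0 (fst p) (snd p)))"
    using continuous_on_compose2[OF f0_deriv_cont fl] by (simp add: case_prod_beta')
  then show ?thesis
    using char.dflow_continuous char.cont_F unfolding dens_deriv_def case_prod_beta'
    by (intro continuous_on_blinfun_compose continuous_on_diff continuous_on_const continuous_on_blinfun_scaleR_left)
qed

lemma dens_deriv_continuous_at: "0 \<le> t \<Longrightarrow> continuous_on S (\<lambda>z. dens_deriv t z h)"
proof -
  assume t: "0 \<le> t"
  have "continuous_on S (\<lambda>z. case (t, z) of (t, z) \<Rightarrow> dens_deriv t z)"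
    by (rule continuous_on_compose2[OF dens_deriv_continuous]) (use t in \<open>auto intro!: continuous_intros\<close>)
  then show ?thesis by (simp add: blinfun.continuous_on)
qed

lemma transport: "dens_deriv t z (1, lorentz E t z) = 0"
  by (simp add: dens_deriv_apply)

lemma dens_time_derivative:
  assumes t: "0 \<le> t"
  shows "((\<lambda>s. dens E s z) has_vector_derivative dens_deriv t z (1, 0)) (at t within {0..})"
proof -
  have p: "((\<lambda>s. (s, z)) has_derivative (\<lambda>h. (h, 0))) (at t within {0..})"
    by (intro derivative_eq_intros) auto
  have "((\<lambda>s. case (s, z) of (t, z) \<Rightarrow> dens E t z) has_derivative (\<lambda>h. dens_deriv t z (h, 0))) (at t within {0..})"
    by (rule has_derivative_in_compose[OF p has_derivative_subset[OF dens_has_derivative[OF t]]]) auto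
  moreover have "(\<lambda>h. dens_deriv t z (h, 0)) = (\<lambda>h. h *\<^sub>R dens_deriv t z (1, 0))"
  proof
    fix h
    have "(h, 0) = h *\<^sub>R (1, 0::phase)" by simp
    then show "dens_deriv t z (h, 0) = h *\<^sub>R dens_deriv t z (1, 0)" by (simp only: blinfun.scaleR_right)
  qed
  ultimately show ?thesis by (simp add: has_vector_derivative_def)
qed

lemma dens_space_derivative:
  assumes t: "0 \<le> t"
  shows "(dens E t has_derivative (\<lambda>h. dens_deriv t z (0, h))) (at z within S)"
proof -
  have p: "((\<lambda>y. (t, y)) has_derivative (\<lambda>h. (0, h))) (at z within S)"
    by (intro derivative_eq_intros) auto
  have "((\<lambda>y. case (t, y) of (t, z) \<Rightarrow> dens E t z) has_derivative (\<lambda>h. dens_deriv t z (0, h))) (at z within S)"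
    by (rule has_derivative_in_compose[OF p has_derivative_subset[OF dens_has_derivative[OF t]]]) (use t in auto)
  then show ?thesis by simp
qed

lemma dens_line_derivative:
  assumes t: "0 \<le> t" and c: "\<And>s. (c has_vector_derivative c') (at s within S)"
  shows "((\<lambda>s. dens E t (c s)) has_real_derivative dens_deriv t (c s) (0, c')) (at s within S)"
proof -
  have "((\<lambda>s. dens E t (c s)) has_derivative (\<lambda>h. dens_deriv t (c s) (0, h *\<^sub>R c'))) (at s within S)"
    by (rule has_derivative_in_compose[OF c[unfolded has_vector_derivative_def] dens_space_derivative[OF t]])
  moreover have "(\<lambda>h. dens_deriv t (c s) (0, h *\<^sub>R c')) = (*) (dens_deriv t (c s) (0, c'))"
  proof
    fix h
    have "(0::real, h *\<^sub>R c') = h *\<^sub>R (0, c')" by simp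
    then show "dens_deriv t (c s) (0, h *\<^sub>R c') = dens_deriv t (c s) (0, c') * h"
      by (simp only: blinfun.scaleR_right real_scaleR_def mult.commute)
  qed
  ultimately show ?thesis by (simp add: has_field_derivative_def)
qed

lemma dens_x_derivative:
  assumes t: "0 \<le> t"
  shows "((\<lambda>y. dens E t (y, v)) has_real_derivative dens_deriv t (y, v) (0, 1, 0)) (at y within S)"
proof -
  have "((\<lambda>y. (y, v)) has_vector_derivative (1, 0)) (at s within S)" for s :: real
    unfolding has_vector_derivative_def by (auto intro!: derivative_eq_intros)
  from dens_line_derivative[OF t this] show ?thesis .
qed

lemma dens_v1_derivative:
  assumes t: "0 \<le> t"
  shows "((\<lambda>u. dens E t (x, u, v2)) has_real_derivative dens_deriv t (x, u, v2) (0, 0, 1, 0)) (at u within S)"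
proof -
  have "((\<lambda>u. (x, u, v2)) has_vector_derivative (0, 1, 0)) (at s within S)" for s :: real
    unfolding has_vector_derivative_def by (auto intro!: derivative_eq_intros)
  from dens_line_derivative[OF t this] show ?thesis .
qed

lemma time_derivative_split:
  "dens_deriv t z (1, 0) = - (fst (vhat (snd z)) * dens_deriv t z (0, 1, 0) + E t (fst z) * dens_deriv t z (0, 0, 1, 0))"
proof -
  have "(1::real, lorentz E t z) = (1, 0) + (fst (vhat (snd z)) *\<^sub>R (0, 1, 0) + E t (fst z) *\<^sub>R (0, 0, 1, 0))"
    by (simp add: lorentz_def)
  then have "0 = dens_deriv t z (1, 0) + (fst (vhat (snd z)) * dens_deriv t z (0, 1, 0) + E t (fst z) * dens_deriv t z (0, 0, 1, 0))"
    using transport[of t z] by (simp only: blinfun.add_right blinfun.scaleR_right real_scaleR_def)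
  then show ?thesis by linarith
qed

lemma integral_of_x_derivative:
  fixes c d :: "real \<times> real"
  assumes t: "0 \<le> t" and ab: "a \<le> b" and w: "continuous_on UNIV w"
  shows "integral (cbox (a, c) (b, d)) (\<lambda>z. w (snd z) * dens_deriv t z (0, 1, 0))
     = integral (cbox c d) (\<lambda>v. w v * (dens E t (b, v) - dens E t (a, v)))"
proof -
  have cont: "continuous_on S (\<lambda>z. w (snd z) * dens_deriv t z (0, 1, 0))" for S
    by (intro continuous_on_mult dens_deriv_continuous_at[OF t] continuous_on_compose2[OF w] continuous_on_snd continuous_on_id) auto
  have "integral (cbox (a, c) (b, d)) (\<lambda>z. w (snd z) * dens_deriv t z (0, 1, 0))
      = integral (cbox a b) (\<lambda>y. integral (cbox c d) (\<lambda>v. w v * dens_deriv t (y, v) (0, 1, 0)))"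
    using integral_prod_continuous[OF cont] by simp
  also have "\<dots> = integral (cbox c d) (\<lambda>v. integral (cbox a b) (\<lambda>y. w v * dens_deriv t (y, v) (0, 1, 0)))"
    using cont by (intro integral_swap_continuous) (simp add: case_prod_beta')
  also have "\<dots> = integral (cbox c d) (\<lambda>v. w v * (dens E t (b, v) - dens E t (a, v)))"
  proof (rule integral_cong)
    fix v
    have "((\<lambda>y. dens_deriv t (y, v) (0, 1, 0)) has_integral dens E t (b, v) - dens E t (a, v)) (cbox a b)"
      using fundamental_theorem_of_calculus[OF ab, of "\<lambda>y. dens E t (y, v)"] dens_x_derivative[OF t]
      by (simp add: has_real_derivative_iff_has_vector_derivative)
    then show "integral (cbox a b) (\<lambda>y. w v * dens_deriv t (y, v) (0, 1, 0)) = w v * (dens E t (b, v) - dens E t (a, v))"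
      by (simp add: integral_unique has_integral_mult_right)
  qed
  finally show ?thesis .
qed

lemma integral_of_v1_derivative:
  assumes t: "0 \<le> t" and V: "reach t < V" and e: "continuous_on UNIV e"
  shows "integral (cbox (a, - V, c2) (b, V, d2)) (\<lambda>z. e (fst z) * dens_deriv t z (0, 0, 1, 0)) = 0"
proof -
  have cont: "continuous_on S (\<lambda>z. e (fst z) * dens_deriv t z (0, 0, 1, 0))" for S
    by (intro continuous_on_mult dens_deriv_continuous_at[OF t] continuous_on_compose2[OF e] continuous_on_fst continuous_on_id) auto
  have cont': "continuous_on S (\<lambda>v. e y * dens_deriv t (y, v) (0, 0, 1, 0))" for S y
    using continuous_on_compose2[OF cont[of UNIV] continuous_on_Pair[OF continuous_on_const[of S y] continuous_on_id]] by simp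
  have V0: "- V \<le> V" using V reach_pos[of t] by linarith
  have "integral (cbox (a, - V, c2) (b, V, d2)) (\<lambda>z. e (fst z) * dens_deriv t z (0, 0, 1, 0))
      = integral (cbox a b) (\<lambda>y. integral (cbox (- V, c2) (V, d2)) (\<lambda>v. e y * dens_deriv t (y, v) (0, 0, 1, 0)))"
    using integral_prod_continuous[OF cont] by simp
  also have "\<dots> = integral (cbox a b) (\<lambda>y. 0)"
  proof (rule integral_cong)
    fix y
    have "integral (cbox (- V, c2) (V, d2)) (\<lambda>v. e y * dens_deriv t (y, v) (0, 0, 1, 0))
        = integral (cbox (- V) V) (\<lambda>v1. integral (cbox c2 d2) (\<lambda>v2. e y * dens_deriv t (y, v1, v2) (0, 0, 1, 0)))"
      by (rule integral_prod_continuous[OF cont'])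
    also have "\<dots> = integral (cbox c2 d2) (\<lambda>v2. integral (cbox (- V) V) (\<lambda>v1. e y * dens_deriv t (y, v1, v2) (0, 0, 1, 0)))"
      using cont' by (intro integral_swap_continuous) (simp add: case_prod_beta')
    also have "\<dots> = integral (cbox c2 d2) (\<lambda>v2. 0)"
    proof (rule integral_cong)
      fix v2
      have "((\<lambda>v1. dens_deriv t (y, v1, v2) (0, 0, 1, 0)) has_integral dens E t (y, V, v2) - dens E t (y, - V, v2)) (cbox (- V) V)"
        using fundamental_theorem_of_calculus[OF V0, of "\<lambda>v1. dens E t (y, v1, v2)"] dens_v1_derivative[OF t]
        by (simp add: has_real_derivative_iff_has_vector_derivative)
      moreover have "dens E t (y, V, v2) = 0" "dens E t (y, - V, v2) = 0"
        using dens_vsupp(1)[OF tame t, of y "(V, v2)"] dens_vsupp(1)[OF tame t, of y "(- V, v2)"] V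
        by (auto simp: vbox_def cbox_Pair_eq)
      ultimately show "integral (cbox (- V) V) (\<lambda>v1. e y * dens_deriv t (y, v1, v2) (0, 0, 1, 0)) = 0"
        using has_integral_mult_right[of "\<lambda>v1. dens_deriv t (y, v1, v2) (0, 0, 1, 0)" 0 _ "e y"]
        by (simp add: integral_unique)
    qed
    finally show "integral (cbox (- V, c2) (V, d2)) (\<lambda>v. e y * dens_deriv t (y, v) (0, 0, 1, 0)) = 0" by simp
  qed
  finally show ?thesis by simp
qed

text \<open>
  In the Vlasov equation the term with \<open>\<partial>\<^sub>v\<^sub>1\<close> integrates to zero, as \<open>E\<close> does not depend on \<open>v\<close> and the density
  vanishes at \<open>v1 = V\<close> and \<open>v1 = - V\<close>. The term with \<open>\<partial>\<^sub>x\<close> leaves the flux through the two ends.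
\<close>

lemma integral_of_time_derivative:
  assumes t: "0 \<le> t" and V: "reach t < V" and ab: "a \<le> b"
  shows "integral (cbox (a, - V, - R) (b, V, R)) (\<lambda>z. dens_deriv t z (1, 0))
    = - integral (cbox (- V, - R) (V, R)) (\<lambda>v. fst (vhat v) * (dens E t (b, v) - dens E t (a, v)))"
proof -
  have w: "continuous_on UNIV (\<lambda>v. fst (vhat v))" by (intro continuous_intros vhat_continuous)
  have e: "continuous_on UNIV (E t)"
    using continuous_on_compose2[OF tame_continuous[OF tame] continuous_on_Pair[OF continuous_on_const[of UNIV t] continuous_on_id]] t
    by force
  have i1: "(\<lambda>z. fst (vhat (snd z)) * dens_deriv t z (0, 1, 0)) integrable_on cbox p q" for p q
    by (intro integrable_continuous continuous_on_mult dens_deriv_continuous_at[OF t]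
        continuous_on_compose2[OF w] continuous_on_snd continuous_on_id) auto
  have i2: "(\<lambda>z. E t (fst z) * dens_deriv t z (0, 0, 1, 0)) integrable_on cbox p q" for p q
    by (intro integrable_continuous continuous_on_mult dens_deriv_continuous_at[OF t]
        continuous_on_compose2[OF e] continuous_on_fst continuous_on_id) auto
  show ?thesis
    unfolding time_derivative_split
    by (simp only: integral_neg integral_add[OF i1 i2] integral_of_x_derivative[OF t ab w]
        integral_of_v1_derivative[OF t V e] add_0_right)
qed

end

section \<open>The self-consistent field solves the system\<close>

context self_consistent_field
begin

abbreviation "flux \<equiv> moment E (\<lambda>v. fst (vhat v))"

lemma vhat1_continuous: "continuous_on UNIV (\<lambda>v. fst (vhat v))" by (intro continuous_intros vhat_continuous)
lemma vhat1_le: "\<bar>fst (vhat v)\<bar> \<le> 1" using abs_vhat_less_1(1)[of v] by simp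

lemma flux_as_box_integral:
  assumes t: "0 \<le> t" and V: "reach t \<le> V"
  shows "flux t x = integral (cbox (- V, - R) (V, R)) (\<lambda>v. fst (vhat v) * dens E t (x, v))"
proof -
  let ?C = "cbox (- V, - R) (V, R)" and ?h = "\<lambda>v. fst (vhat v) * dens E t (x, v)"
  have "set_integrable lborel ?C ?h"
    unfolding set_integrable_def
    by (intro borel_integrable_compact continuous_on_mult dens_at_x_continuous tame t
        continuous_on_subset[OF vhat1_continuous]) auto
  from set_borel_integral_eq_integral(2)[OF this]
  have "integral ?C ?h = (LINT v|lborel. indicator ?C v *\<^sub>R ?h v)"
    by (simp add: set_lebesgue_integral_def)
  also have "(\<lambda>v. indicator ?C v *\<^sub>R ?h v) = (\<lambda>v. dens E t (x, v) * fst (vhat v))"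
  proof
    fix v
    have "v \<in> ?C" if "dens E t (x, v) \<noteq> 0"
      using dens_vsupp(1)[OF tame t that] V by (cases v) (auto simp: vbox_def cbox_Pair_eq)
    then show "indicator ?C v *\<^sub>R ?h v = dens E t (x, v) * fst (vhat v)"
      by (cases "dens E t (x, v) = 0") auto
  qed
  finally show ?thesis by (simp add: moment_def)
qed

text \<open>
  On a bounded time interval the supports lie in one box. The field is a difference of integrals over
  two fixed boxes, on which the integrands are smooth in time and the Leibniz rule applies.
\<close>

lemma field_as_box_integrals:
  assumes s: "0 \<le> s" "s \<le> N" and X: "R + N \<le> X" and x: "\<bar>x\<bar> \<le> X" and V: "reach N \<le> V"
  shows "E s x = 1/2 * (integral (cbox (- X, - V, - R) (x, V, R)) (dens E s)
                      - integral (cbox (x, - V, - R) (X, V, R)) (dens E s))"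
proof -
  let ?C1 = "cbox (- X, - V, - R) (x, V, R)" and ?C2 = "cbox (x, - V, - R) (X, V, R)"
  have int: "set_integrable lborel (cbox p q) (dens E s)" for p q
    unfolding set_integrable_def
    by (intro borel_integrable_compact dens_continuous_at tame s) auto
  have box: "integral (cbox p q) (dens E s) = (LINT z|lborel. indicator (cbox p q) z *\<^sub>R dens E s z)" for p q
    using set_borel_integral_eq_integral(2)[OF int] by (simp add: set_lebesgue_integral_def)
  have eq: "sgn (x - fst z) * dens E s z = indicator ?C1 z *\<^sub>R dens E s z - indicator ?C2 z *\<^sub>R dens E s z" for z
  proof (cases "dens E s z = 0")
    case False
    then have z: "z \<in> box s" using dens_supp[OF tame s(1)] by blast
    obtain y v1 v2 where zz: "z = (y, v1, v2)" by (metis prod.collapse)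
    have "reach s \<le> V" using reach_mono[OF s] V by linarith
    then have "z \<in> ?C1 \<longleftrightarrow> y \<le> x" "z \<in> ?C2 \<longleftrightarrow> x \<le> y"
      using z X s by (auto simp: zz box_def cbox_Pair_eq)
    then show ?thesis by (auto simp: zz sgn_real_def indicator_def)
  qed simp
  have "E s x = 1/2 * (LINT z|lborel. sgn (x - fst z) * dens E s z)"
    using consistent[OF s(1), of x] by (simp add: induced_def)
  also have "\<dots> = 1/2 * (LINT z|lborel. indicator ?C1 z *\<^sub>R dens E s z - indicator ?C2 z *\<^sub>R dens E s z)"
    by (simp only: eq)
  also have "(LINT z|lborel. indicator ?C1 z *\<^sub>R dens E s z - indicator ?C2 z *\<^sub>R dens E s z)
      = (LINT z|lborel. indicator ?C1 z *\<^sub>R dens E s z) - (LINT z|lborel. indicator ?C2 z *\<^sub>R dens E s z)"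
    using int by (intro Bochner_Integration.integral_diff) (auto simp: set_integrable_def)
  finally show ?thesis by (simp only: box)
qed

lemma field_time_derivative:
  assumes t: "0 \<le> t"
  shows "((\<lambda>s. E s x) has_vector_derivative - flux t x) (at t within {0..})"
proof -
  define N where "N = t + 1"
  define X where "X = R + N + \<bar>x\<bar>"
  \<comment> \<open>Strictly beyond the reach, so that the density vanishes at \<open>v1 = V\<close> and \<open>v1 = - V\<close>.\<close>
  define V where "V = reach N + 1"
  have tN: "t \<in> {0..N}" "0 \<le> N" using t by (auto simp: N_def)
  have V: "reach t < V" "reach N \<le> V" using reach_mono[of t N] tN by (auto simp: V_def)
  have X: "R + N \<le> X" "\<bar>x\<bar> \<le> X" "R + t < X" "- X \<le> x" "x \<le> X" using R tN by (auto simp: X_def N_def)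
  let ?C1 = "cbox (- X, - V, - R) (x, V, R)" and ?C2 = "cbox (x, - V, - R) (X, V, R)"
  have d: "((\<lambda>s. integral (cbox p q) (dens E s)) has_vector_derivative integral (cbox p q) (\<lambda>z. dens_deriv t z (1, 0))) (at t within {0..N})"
    for p q
  proof (rule leibniz_rule_vector_derivative[OF _ _ _ tN(1)])
    show "((\<lambda>s. dens E s z) has_vector_derivative dens_deriv s z (1, 0)) (at s within {0..N})" if "s \<in> {0..N}" for s z
      using that by (intro has_vector_derivative_within_subset[OF dens_time_derivative]) auto
    show "dens E s integrable_on cbox p q" if "s \<in> {0..N}" for s
      using that by (intro integrable_continuous dens_continuous_at tame) auto
    have "continuous_on ({0..N} \<times> cbox p q) (\<lambda>(t, z). dens_deriv t z)"
      by (rule continuous_on_subset[OF dens_deriv_continuous]) auto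
    then show "continuous_on ({0..N} \<times> cbox p q) (\<lambda>(s, z). dens_deriv s z (1, 0))"
      unfolding case_prod_beta' by (intro blinfun.continuous_on continuous_on_const)
  qed simp
  have "((\<lambda>s. 1/2 * (integral ?C1 (dens E s) - integral ?C2 (dens E s))) has_vector_derivative
      1/2 * (integral ?C1 (\<lambda>z. dens_deriv t z (1, 0)) - integral ?C2 (\<lambda>z. dens_deriv t z (1, 0)))) (at t within {0..N})"
    by (intro has_vector_derivative_mult_right has_vector_derivative_diff d)
  then have "((\<lambda>s. E s x) has_vector_derivative
      1/2 * (integral ?C1 (\<lambda>z. dens_deriv t z (1, 0)) - integral ?C2 (\<lambda>z. dens_deriv t z (1, 0)))) (at t within {0..N})"
    by (rule has_vector_derivative_transform[OF tN(1), rotated])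
       (use field_as_box_integrals[OF _ _ X(1,2) V(2)] in auto)
  moreover have "at t within {0..N} = at t within {0..}"
    by (rule at_within_nhd[of t "{..<N}"]) (auto simp: N_def)
  moreover have "1/2 * (integral ?C1 (\<lambda>z. dens_deriv t z (1, 0)) - integral ?C2 (\<lambda>z. dens_deriv t z (1, 0))) = - flux t x"
  proof -
    have zero: "dens E t (- X, v) = 0" "dens E t (X, v) = 0" for v
      using dens_vsupp(2)[OF tame t, of "- X" v] dens_vsupp(2)[OF tame t, of X v] X by auto
    show ?thesis
      using V(1) X by (simp add: integral_of_time_derivative[OF t] zero flux_as_box_integral[OF t, of V] integral_neg)
  qed
  ultimately show ?thesis by simp
qed

lemma field_space_derivative:
  assumes t: "0 \<le> t"
  shows "(E t has_real_derivative charge E t x) (at x within S)"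
proof -
  have "(E t has_derivative (\<lambda>h. charge E t x * h)) (at x)"
    by (rule has_derivative_if_quadratic_remainder[OF bounded_linear_mult_right])
       (use induced_remainder[OF tame t, of _ x] in \<open>simp add: consistent[OF t]\<close>)
  then have "(E t has_real_derivative charge E t x) (at x)" by (simp add: has_field_derivative_def)
  then show ?thesis by (rule has_field_derivative_at_within)
qed

lemma field_has_derivative:
  assumes t: "0 \<le> t"
  shows "((\<lambda>(t, x). E t x) has_derivative (\<lambda>(\<tau>, h). \<tau> *\<^sub>R (- flux t x) + blinfun_scaleR_left (charge E t x) h))
    (at (t, x) within {0..} \<times> UNIV)"
proof -
  have cc: "continuous_on ({0..} \<times> UNIV) (\<lambda>p. charge E (fst p) (snd p))"
    using moment_continuous[OF tame, of "\<lambda>_. 1"] by (simp add: case_prod_beta')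
  show ?thesis
    proof (rule has_derivative_partialsI)
      show "((\<lambda>s. E s x) has_derivative (\<lambda>\<tau>. \<tau> *\<^sub>R (- flux t x))) (at t within {0..})"
        using field_time_derivative[OF t, of x] by (simp add: has_vector_derivative_def)
      show "((\<lambda>y. E s y) has_derivative blinfun_scaleR_left (charge E s y)) (at y within UNIV)" if "s \<in> {0..}" for s y
      proof -
        have "(*) (charge E s y) = blinfun_scaleR_left (charge E s y)" by (auto simp: mult.commute)
        then show ?thesis
          using field_space_derivative[of s y UNIV] that by (simp only: has_field_derivative_def atLeast_iff)
      qed
      have "continuous_on ({0..} \<times> UNIV) (\<lambda>(s, y). blinfun_scaleR_left (charge E s y))"
        unfolding case_prod_beta' by (intro continuous_on_blinfun_scaleR_left cc)
      then show "continuous (at (t, x) within {0..} \<times> UNIV) (\<lambda>(s, y). blinfun_scaleR_left (charge E s y))"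
        using t by (simp add: continuous_on_eq_continuous_within)
    qed auto
qed

lemma field_C1: "C1_on ({0..} \<times> UNIV) (\<lambda>(t, x). E t x)"
proof -
  let ?g = "\<lambda>p. (blinfun_scaleR_left (- flux (fst p) (snd p)) o\<^sub>L fst_blinfun)
             + (blinfun_scaleR_left (charge E (fst p) (snd p)) o\<^sub>L snd_blinfun)"
  have cf: "continuous_on ({0..} \<times> UNIV) (\<lambda>p. flux (fst p) (snd p))"
    and cc: "continuous_on ({0..} \<times> UNIV) (\<lambda>p. charge E (fst p) (snd p))"
    using moment_continuous[OF tame vhat1_continuous vhat1_le] moment_continuous[OF tame, of "\<lambda>_. 1"]
    by (simp_all add: case_prod_beta')
  have "((\<lambda>(t, x). E t x) has_derivative ?g (t, x)) (at (t, x) within {0..} \<times> UNIV)" if t: "0 \<le> t" for t x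
  proof -
    have "((\<lambda>(t, x). E t x) has_derivative (\<lambda>(\<tau>, h). \<tau> *\<^sub>R (- flux t x) + blinfun_scaleR_left (charge E t x) h)) (at (t, x) within {0..} \<times> UNIV)"
      by (rule field_has_derivative[OF t])
    moreover have "(\<lambda>(\<tau>, h). \<tau> *\<^sub>R (- flux t x) + blinfun_scaleR_left (charge E t x) h) = ?g (t, x)"
      by (auto simp: blinfun.add_left)
    ultimately show ?thesis by simp
  qed
  moreover have "continuous_on ({0..} \<times> UNIV) ?g"
    by (intro continuous_on_add continuous_on_blinfun_compose continuous_on_blinfun_scaleR_left
        continuous_on_minus cf cc continuous_on_const)
  ultimately show ?thesis unfolding C1_on_def by (intro exI[of _ ?g]) auto
qed

lemma dens_C1: "C1_on ({0..} \<times> UNIV) (\<lambda>(t, x, v). dens E t (x, v))"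
proof -
  have "(\<lambda>(t, x, v). dens E t (x, v)) = (\<lambda>(t, z). dens E t z)" by auto
  then show ?thesis unfolding C1_on_def
    by (intro exI[of _ "\<lambda>(t, z). dens_deriv t z"]) (use dens_has_derivative dens_deriv_continuous in auto)
qed

text \<open>
  Reflection in \<open>v2\<close> maps characteristics to characteristics, because it preserves \<open>|v|\<close>.
\<close>

lemma dens_even:
  assumes t: "0 \<le> t"
  shows "dens E t (x, v1, - v2) = dens E t (x, v1, v2)"
proof -
  let ?S = "\<lambda>z::phase. (fst z, fst (snd z), - snd (snd z))"
  let ?u = "\<lambda>s. E_flow E s t (x, v1, v2)"
  have S: "lorentz E s (?S z) = ?S (lorentz E s z)" for s z
    by (simp add: lorentz_def vhat_def norm_prod_def)
  have "char.solves (\<lambda>s. ?S (?u s))"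
    unfolding char.solves_def
  proof (intro allI impI)
    fix s :: real assume s: "0 \<le> s"
    have "(?u has_vector_derivative lorentz E s (?u s)) (at s within {0..})"
      using char.flow_solves[OF t] s by (simp add: char.solves_def)
    then have "((\<lambda>s. ?S (?u s)) has_vector_derivative ?S (lorentz E s (?u s))) (at s within {0..})"
      unfolding has_vector_derivative_def by (auto intro!: derivative_eq_intros)
    then show "((\<lambda>s. ?S (?u s)) has_vector_derivative lorentz E s (?S (?u s))) (at s within {0..})"
      by (simp only: S)
  qed
  from char.flow_eqI[OF this _ t, of "(x, v1, - v2)" 0] t
  have "E_flow E 0 t (x, v1, - v2) = ?S (?u 0)" by (simp add: char.flow_start)
  then show ?thesis using f0_even[of "fst (?u 0)" "fst (snd (?u 0))" "snd (snd (?u 0))"] by (simp add: dens_def)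
qed

lemma transverse_current_zero:
  assumes t: "0 \<le> t"
  shows "moment E (\<lambda>v. snd (vhat v)) t x = 0"
proof -
  let ?h = "\<lambda>a b. dens E t (x, a, b) * snd (vhat (a, b))"
  have "integrable lborel (\<lambda>v. dens E t (x, v) * snd (vhat v))"
    by (rule moment_integrand(2)[OF tame t]) (use abs_vhat_less_1(2) in \<open>auto intro!: continuous_intros vhat_continuous less_imp_le\<close>)
  then have "integrable (lborel \<Otimes>\<^sub>M lborel) (\<lambda>(a, b). ?h a b)"
    by (simp add: lborel_prod case_prod_beta')
  from lborel_pair.integral_fst[OF this]
  have fub: "moment E (\<lambda>v. snd (vhat v)) t x = (LINT a|lborel. LINT b|lborel. ?h a b)"
    by (simp add: moment_def lborel_prod case_prod_beta')
  have "(LINT b|lborel. ?h a b) = 0" for a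
  proof -
    have "(LINT b|lborel. ?h a b) = (LINT b|lborel. ?h a (- b))"
      using lborel_integral_real_affine[of "-1" "?h a" 0] by simp
    also have "\<dots> = - (LINT b|lborel. ?h a b)"
      by (simp add: dens_even[OF t] vhat_def norm_Pair)
    finally show ?thesis by simp
  qed
  then show ?thesis unfolding fub by simp
qed

abbreviation f :: density where "f \<equiv> \<lambda>t x v. dens E t (x, v)"

lemma rho_eq: "rho f t = charge E t" by (simp add: rho_def moment_def fun_eq_iff)

lemma current_eq: 
  assumes t: "0 \<le> t"
  shows "snd (current f t x) = 0"
proof -
  have int: "integrable lborel (f t x)" using moment_integrand(2)[OF tame t, of "\<lambda>_. 1" x] by simp
  have meas: "(\<lambda>v. f t x v *\<^sub>R vhat v) \<in> borel_measurable lborel"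
    using borel_measurable_continuous_onI[OF continuous_on_scaleR[OF dens_at_x_continuous[OF tame t] vhat_continuous]] by simp
  have "integrable lborel (\<lambda>v. f t x v *\<^sub>R vhat v)"
    by (rule Bochner_Integration.integrable_bound[OF int meas])
       (auto intro!: AE_I2 mult_left_le less_imp_le[OF norm_vhat_less_1])
  from integral_bounded_linear[OF bounded_linear_snd this]
  have "snd (current f t x) = moment E (\<lambda>v. snd (vhat v)) t x"
    by (simp add: current_def moment_def)
  then show ?thesis using transverse_current_zero[OF t] by simp
qed

text \<open>
  With \<open>E2 = B = 0\<close> Maxwell's equations reduce to the vanishing of the transverse current.
\<close>

theorem monocharge_solution: "monocharge_RVM_solution (\<lambda>x v. f0 (x, v)) (\<lambda>_. 0) (\<lambda>_. 0) f E (\<lambda>_ _. 0) (\<lambda>_ _. 0)"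
  unfolding monocharge_RVM_solution_def
proof (intro conjI allI impI)
  show "C1_on ({0..} \<times> UNIV) (\<lambda>(t, x, v). f t x v)" by (rule dens_C1)
  show "C1_on ({0..} \<times> UNIV) (\<lambda>(t, x). E t x)" by (rule field_C1)
  have "C1_on ({0..} \<times> UNIV) (\<lambda>_::real \<times> real. 0)"
    unfolding C1_on_def by (intro exI[of _ "\<lambda>_. 0"]) (auto intro!: continuous_intros simp: zero_blinfun.rep_eq)
  then show "C1_on ({0..} \<times> UNIV) (\<lambda>(t::real, x::real). 0)" "C1_on ({0..} \<times> UNIV) (\<lambda>(t::real, x::real). 0)"
    by (simp_all add: case_prod_beta')
  fix t :: real assume t: "0 \<le> t"
  show "integrable lborel (rho f t)" unfolding rho_eq by (rule charge_integrable[OF tame t])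
  fix x
  show "integrable lborel (f t x)" using moment_integrand(2)[OF tame t, of "\<lambda>_. 1" x] by simp
  show "time_deriv (\<lambda>s. 0) t + deriv (\<lambda>y. 0) x = - snd (current f t x)"
    "time_deriv (\<lambda>s. 0) t + deriv (\<lambda>y. 0) x = 0"
  proof -
    have "time_deriv (\<lambda>s. 0) t = 0"
      unfolding time_deriv_def
      by (rule vector_derivative_within[OF at_within_half_line_nontrivial[OF t]]) simp
    then show "time_deriv (\<lambda>s. 0) t + deriv (\<lambda>y. 0) x = - snd (current f t x)"
      "time_deriv (\<lambda>s. 0) t + deriv (\<lambda>y. 0) x = 0"
      using current_eq[OF t] by simp_all
  qed
  show "E t x = 1/2 * (LINT y:{..x}|lborel. rho f t y) - 1/2 * (LINT y:{x..}|lborel. rho f t y)"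
  proof -
    have i: "integrable lborel (\<lambda>y. indicator S y *\<^sub>R charge E t y)" if "S \<in> sets borel" for S
      by (rule integrable_mult_indicator) (use that charge_integrable[OF tame t] in auto)
    have "E t x = 1/2 * (LINT y|lborel. sgn (x - y) * charge E t y)"
      using induced_charge[OF tame t, of x] by (simp add: consistent[OF t])
    also have "(\<lambda>y. sgn (x - y) * charge E t y) = (\<lambda>y. indicator {..x} y *\<^sub>R charge E t y - indicator {x..} y *\<^sub>R charge E t y)"
      by (auto simp: sgn_real_def indicator_def)
    also have "(LINT y|lborel. indicator {..x} y *\<^sub>R charge E t y - indicator {x..} y *\<^sub>R charge E t y)
        = (LINT y|lborel. indicator {..x} y *\<^sub>R charge E t y) - (LINT y|lborel. indicator {x..} y *\<^sub>R charge E t y)"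
      by (intro Bochner_Integration.integral_diff i) auto
    finally show ?thesis by (simp add: set_lebesgue_integral_def rho_eq right_diff_distrib)
  qed
  fix v1 v2
  show "time_deriv (\<lambda>s. f s x (v1, v2)) t + fst (vhat (v1, v2)) * deriv (\<lambda>y. f t y (v1, v2)) x +
        (E t x + snd (vhat (v1, v2)) * 0) * deriv (\<lambda>u. f t x (u, v2)) v1 +
        (0 - fst (vhat (v1, v2)) * 0) * deriv (\<lambda>u. f t x (v1, u)) v2 = 0"
  proof -
    have "time_deriv (\<lambda>s. f s x (v1, v2)) t = dens_deriv t (x, v1, v2) (1, 0)"
      unfolding time_deriv_def
      by (rule vector_derivative_within[OF at_within_half_line_nontrivial[OF t] dens_time_derivative[OF t]])
    moreover have "deriv (\<lambda>y. f t y (v1, v2)) x = dens_deriv t (x, v1, v2) (0, 1, 0)"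
      by (rule DERIV_imp_deriv[OF dens_x_derivative[OF t]])
    moreover have "deriv (\<lambda>u. f t x (u, v2)) v1 = dens_deriv t (x, v1, v2) (0, 0, 1, 0)"
      by (rule DERIV_imp_deriv[OF dens_v1_derivative[OF t]])
    ultimately show ?thesis using time_derivative_split[of t "(x, v1, v2)"] by simp
  qed
next
  show "f 0 x v = f0 (x, v)" for x v by (simp add: dens_def char.flow_start)
qed simp_all

end

section \<open>No charge crosses a light ray\<close>

context self_consistent_field
begin

lemma flux_le_charge: "0 \<le> t \<Longrightarrow> flux t x \<le> charge E t x"
  unfolding moment_def
proof (rule integral_mono)
  assume t: "0 \<le> t"
  show "integrable lborel (\<lambda>v. dens E t (x, v) * fst (vhat v))"
    by (rule moment_integrand(2)[OF tame t vhat1_continuous vhat1_le])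
  show "integrable lborel (\<lambda>v. dens E t (x, v) * 1)"
    by (rule moment_integrand(2)[OF tame t]) auto
  show "dens E t (x, v) * fst (vhat v) \<le> dens E t (x, v) * 1" for v
    using vhat1_le[of v] dens_nonneg[of E t "(x, v)"] by (intro mult_left_mono) auto
qed

lemma field_on_line_derivative:
  assumes s: "0 \<le> s" "s \<in> S" "S \<subseteq> {0..}"
  shows "((\<lambda>s. E s (x0 + k * s)) has_real_derivative k * charge E s (x0 + k * s) - flux s (x0 + k * s)) (at s within S)"
proof -
  have p: "((\<lambda>s. (s, x0 + k * s)) has_derivative (\<lambda>h. (h, k * h))) (at s within S)"
    by (auto intro!: derivative_eq_intros)
  have "((\<lambda>s. case (s, x0 + k * s) of (t, x) \<Rightarrow> E t x) has_derivative
      (\<lambda>h. case (h, k * h) of (\<tau>, h) \<Rightarrow> \<tau> *\<^sub>R (- flux s (x0 + k * s)) + blinfun_scaleR_left (charge E s (x0 + k * s)) h)) (at s within S)"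
    by (rule has_derivative_in_compose[OF p has_derivative_subset[OF field_has_derivative[OF s(1)]]]) (use s in auto)
  then have "((\<lambda>s. E s (x0 + k * s)) has_derivative
      (\<lambda>h. h *\<^sub>R (- flux s (x0 + k * s)) + blinfun_scaleR_left (charge E s (x0 + k * s)) (k * h))) (at s within S)"
    by (simp only: prod.case)
  then show ?thesis
    unfolding has_field_derivative_def by (rule has_derivative_eq_rhs) (auto simp: algebra_simps)
qed

text \<open>
  The derivative along the ray is charge density minus flux, which is nonnegative since no particle is
  faster than light.
\<close>

lemma field_on_light_ray_increasing:
  assumes t: "0 \<le> t"
  shows "E 0 x0 \<le> E t (x0 + t)"
proof -
  have "E 0 (x0 + 1 * 0) \<le> E t (x0 + 1 * t)"
    by (rule nondecreasing_if_derivative_nonneg[OF t field_on_line_derivative])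
       (use flux_le_charge in auto)
  then show ?thesis by simp
qed

lemma field_ahead_of_light_ray: "0 \<le> t \<Longrightarrow> x0 + t \<le> x \<Longrightarrow> E 0 x0 \<le> E t x"
  using field_on_light_ray_increasing[of t x0] induced_mono[OF tame, of t "x0 + t" x] by (simp add: consistent)

text \<open>
  Used with \<open>k = 1\<close> on the light ray, and with \<open>k = 0\<close> at a point to the right of all charge.
\<close>

lemma field_constant_on_line:
  assumes t: "0 \<le> t" and zero: "\<And>s v. 0 \<le> s \<Longrightarrow> s \<le> t \<Longrightarrow> dens E s (x0 + k * s, v) = 0"
  shows "E t (x0 + k * t) = E 0 x0"
proof -
  have z: "k * charge E s (x0 + k * s) - flux s (x0 + k * s) = 0" if "s \<in> {0..t}" for s
    using zero[of s] that by (simp add: moment_def)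
  have d: "((\<lambda>s. E s (x0 + k * s)) has_real_derivative 0) (at s within {0..t})" if "s \<in> {0..t}" for s
    using field_on_line_derivative[of s "{0..t}" x0 k] that z[OF that] by auto
  have "E 0 (x0 + k * 0) \<le> E t (x0 + k * t)"
    by (rule nondecreasing_if_derivative_nonneg[OF t d]) auto
  moreover have "- E 0 (x0 + k * 0) \<le> - E t (x0 + k * t)"
    by (rule nondecreasing_if_derivative_nonneg[OF t DERIV_minus[OF d]]) auto
  ultimately show ?thesis by simp
qed

lemma charge_ahead_eq_field_difference:
  assumes t: "0 \<le> t" and X: "R + t < X" "a \<le> X"
  shows "(LINT x:{a..}|lborel. charge E t x) = E t X - E t a"
proof -
  have eq: "indicator {a..} y *\<^sub>R charge E t y = indicator (cbox a X) y * charge E t y" for y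
    using charge_supp[OF tame t, of y "\<lambda>_. 1"] X by (auto simp: indicator_def not_le)
  then show ?thesis
    using induced_increment[OF tame t X(2)] by (simp only: set_lebesgue_integral_def consistent[OF t] eq)
qed

text \<open>
  The charge ahead of a point is the difference of the field far to the right and the field at that
  point, and both values are constant in time.
\<close>

lemma charge_ahead_conserved:
  assumes t: "0 \<le> t" and gap: "\<And>s v. 0 \<le> s \<Longrightarrow> dens E s (x0 + s, v) = 0"
  shows "(LINT x:{x0 + t..}|lborel. charge E t x) = (LINT x:{x0..}|lborel. charge E 0 x)"
proof -
  define X where "X = R + t + \<bar>x0\<bar> + 1"
  have X: "R + t < X" "x0 + t \<le> X" "R + 0 < X" "x0 \<le> X" using R t by (auto simp: X_def)
  have "E t (X + 0 * t) = E 0 X"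
  proof (rule field_constant_on_line[OF t])
    show "dens E s (X + 0 * s, v) = 0" if "0 \<le> s" "s \<le> t" for s v
    proof (rule ccontr)
      assume "dens E s (X + 0 * s, v) \<noteq> 0"
      from dens_vsupp(2)[OF tame that(1) this] show False using that X by auto
    qed
  qed
  moreover have "E t (x0 + 1 * t) = E 0 x0"
    by (rule field_constant_on_line[OF t]) (use gap in auto)
  ultimately show ?thesis
    using charge_ahead_eq_field_difference[OF t X(1,2)] charge_ahead_eq_field_difference[OF _ X(3,4)] by simp
qed

text \<open>
  Consider a particle that meets the ray at time \<open>t\<close>. Being slower than light it was on the ray or ahead
  of it at all earlier times, hence in a field of size at least \<open>c\<close>. With \<open>g = sqrt (1 + |V|\<^sup>2)\<close> one has
  \<open>g' = vhat1 E\<close> and \<open>V1' = E\<close>, so the quantity \<open>c (X - s) - g + V1\<close> has derivative \<open>(E - c) (1 - vhat1) \<ge> 0\<close>.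
  Comparing its values at times \<open>0\<close> and \<open>t\<close> gives \<open>c (X 0 - x0) \<le> g 0 - V1 0\<close>, which the gap in the initial
  support excludes.
\<close>

lemma no_charge_on_light_ray:
  assumes t: "0 \<le> t" and c: "0 < c" "c \<le> E 0 x0"
    and gap: "\<And>x v. f0 (x, v) \<noteq> 0 \<Longrightarrow> x < x0 \<or> sqrt (1 + (norm v)\<^sup>2) - fst v < c * (x - x0)"
  shows "dens E t (x0 + t, v) = 0"
proof (rule ccontr)
  assume nz: "dens E t (x0 + t, v) \<noteq> 0"
  define u where "u s = E_flow E s t (x0 + t, v)" for s
  define X where "X s = fst (u s)" for s
  define V where "V s = snd (u s)" for s
  define g where "g s = sqrt (1 + (norm (V s))\<^sup>2)" for s
  have ut: "u t = (x0 + t, v)" using t by (simp add: u_def char.flow_start)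
  have du: "(u has_vector_derivative (fst (vhat (V s)), E s (X s), 0)) (at s within {0..t})" if "s \<in> {0..t}" for s
    using char.solves_within[OF char.flow_solves[OF t], of s "{0..t}" "(x0 + t, v)"] that
    by (simp add: u_def[abs_def] lorentz_def X_def V_def)
  have dX: "(X has_real_derivative fst (vhat (V s))) (at s within {0..t})"
    and dV1: "((\<lambda>s. fst (V s)) has_real_derivative E s (X s)) (at s within {0..t})"
    and dV2: "((\<lambda>s. snd (V s)) has_real_derivative 0) (at s within {0..t})" if "s \<in> {0..t}" for s
    using du[OF that] unfolding has_vector_derivative_def has_field_derivative_def X_def[abs_def] V_def[abs_def]
    by (auto intro!: derivative_eq_intros)
  have g: "g s = sqrt (1 + ((fst (V s))\<^sup>2 + (snd (V s))\<^sup>2))" for s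
    by (simp add: g_def norm_prod_def)
  have gpos: "0 < g s" for s unfolding g_def using sqrt_one_plus_square_ge(1)[of "V s"] by linarith
  have dg: "(g has_real_derivative fst (vhat (V s)) * E s (X s)) (at s within {0..t})" if "s \<in> {0..t}" for s
  proof -
    have pos: "0 < 1 + ((fst (V s))\<^sup>2 + (snd (V s))\<^sup>2)" by (simp add: add_pos_nonneg)
    have "((\<lambda>s. sqrt (1 + ((fst (V s))\<^sup>2 + (snd (V s))\<^sup>2))) has_real_derivative
        (2 * fst (V s) * E s (X s)) * (inverse (sqrt (1 + ((fst (V s))\<^sup>2 + (snd (V s))\<^sup>2))) / 2)) (at s within {0..t})"
      using dV1[OF that] dV2[OF that] pos by (auto intro!: derivative_eq_intros)
    then show ?thesis
      unfolding g[abs_def] by (simp add: vhat_def norm_prod_def mult_ac)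
  qed
  have ahead: "x0 + s \<le> X s" if s: "s \<in> {0..t}" for s
  proof -
    have "s - X s \<le> t - X t"
    proof (rule nondecreasing_if_derivative_nonneg[of s t "\<lambda>r. r - X r" "\<lambda>r. 1 - fst (vhat (V r))"])
      show "((\<lambda>r. r - X r) has_real_derivative 1 - fst (vhat (V r))) (at r within {s..t})" if "r \<in> {s..t}" for r
        using that s by (intro derivative_intros DERIV_subset[OF dX]) auto
      show "0 \<le> 1 - fst (vhat (V r))" for r using vhat1_le[of "V r"] by auto
    qed (use s in auto)
    then show ?thesis by (simp add: X_def ut)
  qed
  \<comment> \<open>The acceleration outweighs the lag.\<close>
  have "c * (X 0 - 0) - g 0 + fst (V 0) \<le> c * (X t - t) - g t + fst (V t)"
  proof (rule nondecreasing_if_derivative_nonneg[OF t, of "\<lambda>s. c * (X s - s) - g s + fst (V s)"])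
    fix s assume s: "s \<in> {0..t}"
    show "((\<lambda>s. c * (X s - s) - g s + fst (V s)) has_real_derivative (E s (X s) - c) * (1 - fst (vhat (V s)))) (at s within {0..t})"
      using dX[OF s] dg[OF s] dV1[OF s] by (auto intro!: derivative_eq_intros simp: algebra_simps)
    have "c \<le> E s (X s)" using field_ahead_of_light_ray[of s x0 "X s"] ahead[OF s] s c by auto
    then show "0 \<le> (E s (X s) - c) * (1 - fst (vhat (V s)))" using vhat1_le[of "V s"] by auto
  qed
  moreover have "fst (V t) \<le> g t"
    using sqrt_one_plus_square_ge(2)[of "V t"] abs_fst_le_norm[of "V t"] by (simp add: g_def)
  ultimately have "c * (X 0 - x0) \<le> g 0 - fst (V 0)"
    by (simp add: X_def ut algebra_simps)
  moreover have "f0 (X 0, V 0) \<noteq> 0" using nz by (simp add: dens_def X_def V_def u_def)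
  ultimately show False using gap[of "X 0" "V 0"] ahead[of 0] t by (auto simp: g_def)
qed

end

section \<open>Two clouds\<close>

context vlasov_data
begin

lemma admissible: "admissible_data (\<lambda>x v. f0 (x, v)) (\<lambda>_. 0) (\<lambda>_. 0)"
proof -
  have "C1_on UNIV f0" unfolding C1_on_def using f0_deriv f0_deriv_cont by blast
  moreover have "compactly_supported f0"
    unfolding compactly_supported_def compact_closure
    by (rule bounded_subset[OF bounded_cbox[of "(-R, -R, -R)" "(R, R, R)"]]) (use f0_supp in blast)
  moreover have "C1_on UNIV (\<lambda>_::real. 0)"
    unfolding C1_on_def by (intro exI[of _ "\<lambda>_. 0"]) (auto simp: zero_blinfun.rep_eq)
  moreover have "(\<lambda>(x, v). f0 (x, v)) = f0" by auto
  ultimately show ?thesis by (simp add: admissible_data_def compactly_supported_def f0_nonneg)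
qed

end

text \<open>
  The square makes the truncated parabola continuously differentiable.
\<close>

definition bump :: "real \<Rightarrow> real" where "bump x = (max 0 (1 - x\<^sup>2))\<^sup>2"
definition bump' :: "real \<Rightarrow> real" where "bump' x = - 4 * x * max 0 (1 - x\<^sup>2)"

text \<open>
  The remainder is quadratic with constant \<open>1\<close> on each of the four sign patterns of \<open>y\<close> and \<open>u\<close>.
\<close>

lemma square_of_positive_part_derivative:
  "((\<lambda>u::real. (max 0 u)\<^sup>2) has_real_derivative 2 * max 0 u) (at u)"
  unfolding has_field_derivative_def
proof (rule has_derivative_if_quadratic_remainder[where Q = 1, OF bounded_linear_mult_right])
  fix y :: real
  have "\<bar>(max 0 y)\<^sup>2 - (max 0 u)\<^sup>2 - 2 * max 0 u * (y - u)\<bar> \<le> (y - u)\<^sup>2"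
  proof (cases "0 \<le> y"; cases "0 \<le> u")
    assume yu: "\<not> 0 \<le> y" "0 \<le> u"
    then have "u * y \<le> 0" by (simp add: mult_nonneg_nonpos)
    moreover have "(max 0 y)\<^sup>2 - (max 0 u)\<^sup>2 - 2 * max 0 u * (y - u) = u * u - 2 * (u * y)"
      using yu by (simp add: max_def power2_eq_square algebra_simps)
    moreover have "(y - u)\<^sup>2 = y * y - 2 * (u * y) + u * u" by (simp add: power2_eq_square algebra_simps)
    ultimately show ?thesis using zero_le_square[of u] zero_le_square[of y] by linarith
  next
    assume yu: "0 \<le> y" "\<not> 0 \<le> u"
    then have "u * y \<le> 0" by (simp add: mult_nonpos_nonneg)
    moreover have "(max 0 y)\<^sup>2 - (max 0 u)\<^sup>2 - 2 * max 0 u * (y - u) = y * y"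
      using yu by (simp add: max_def power2_eq_square algebra_simps)
    moreover have "(y - u)\<^sup>2 = y * y - 2 * (u * y) + u * u" by (simp add: power2_eq_square algebra_simps)
    ultimately show ?thesis using zero_le_square[of u] zero_le_square[of y] by linarith
  next
    assume "0 \<le> y" "0 \<le> u"
    then have "(max 0 y)\<^sup>2 - (max 0 u)\<^sup>2 - 2 * max 0 u * (y - u) = (y - u)\<^sup>2"
      by (simp add: power2_eq_square algebra_simps)
    then show ?thesis by simp
  qed (simp add: max_def)
  then show "norm ((max 0 y)\<^sup>2 - (max 0 u)\<^sup>2 - 2 * max 0 u * (y - u)) \<le> 1 * (norm (y - u))\<^sup>2"
    by simp
qed

lemma bump_derivative: "(bump has_real_derivative bump' x) (at x within S)"
proof -
  have "(bump has_real_derivative (2 * max 0 (1 - x\<^sup>2)) * (- (2 * x))) (at x)"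
    unfolding bump_def[abs_def]
    by (rule DERIV_chain2[OF square_of_positive_part_derivative]) (auto intro!: derivative_eq_intros)
  then have "(bump has_real_derivative bump' x) (at x)" by (simp add: bump'_def mult_ac)
  then show ?thesis by (rule has_field_derivative_at_within)
qed

lemma bump_bounds: "0 \<le> bump x" "bump x \<le> 1" "bump x \<noteq> 0 \<Longrightarrow> \<bar>x\<bar> < 1" "bump (- x) = bump x" "\<bar>bump x\<bar> \<le> 1"
proof -
  show "0 \<le> bump x" "bump (- x) = bump x" by (auto simp: bump_def)
  show "bump x \<le> 1" unfolding bump_def by (rule power_le_one) auto
  then show "\<bar>bump x\<bar> \<le> 1" using \<open>0 \<le> bump x\<close> by simp
  show "\<bar>x\<bar> < 1" if "bump x \<noteq> 0"
  proof -
    have "max 0 (1 - x\<^sup>2) \<noteq> 0" using that by (simp add: bump_def)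
    then have "x\<^sup>2 < 1" by linarith
    then show ?thesis by (simp only: abs_square_less_1)
  qed
qed

lemma bump_lipschitz: "\<bar>bump x - bump y\<bar> \<le> 4 * \<bar>x - y\<bar>"
proof -
  have "\<bar>bump' z\<bar> \<le> 4" for z
  proof (cases "\<bar>z\<bar> < 1")
    case True
    then have "\<bar>z\<bar> * max 0 (1 - z\<^sup>2) \<le> 1 * 1" by (intro mult_mono) auto
    then show ?thesis by (simp add: bump'_def abs_mult)
  next
    case False
    then have "1 \<le> z\<^sup>2" using abs_square_less_1[of z] by linarith
    then show ?thesis by (simp add: bump'_def)
  qed
  then have "norm (bump x - bump y) \<le> 4 * norm (x - y)"
    by (intro field_differentiable_bound[of UNIV bump bump']) (auto intro: bump_derivative)
  then show ?thesis by simp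
qed

lemma bump_continuous: "continuous_on S bump" "continuous_on S bump'"
  unfolding bump_def[abs_def] bump'_def[abs_def] by (intro continuous_intros)+

lemma bump_ge: "\<bar>x\<bar> \<le> 1/2 \<Longrightarrow> 1/2 \<le> bump x"
proof -
  assume "\<bar>x\<bar> \<le> 1/2"
  then have "x\<^sup>2 \<le> (1/2)\<^sup>2" using power_mono[of "\<bar>x\<bar>" "1/2" 2] by simp
  then have "3/4 \<le> 1 - x\<^sup>2" by (simp add: power2_eq_square)
  then have "3/4 \<le> max 0 (1 - x\<^sup>2)" by linarith
  then have "(3/4)\<^sup>2 \<le> bump x" unfolding bump_def by (rule power_mono) simp
  then show ?thesis by (simp add: power2_eq_square)
qed

lemma bump_integrable: "integrable lborel bump"
proof (rule integral_bounded_on_cbox(1)[of _ 1 "-1" 1])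
  show "bump \<in> borel_measurable lborel"
    using borel_measurable_continuous_onI[OF bump_continuous(1)] by simp
  show "\<bar>bump x\<bar> \<le> 1 * indicator (cbox (-1) 1) x" for x
    using bump_bounds(3)[of x] bump_bounds(5)[of x] by (cases "bump x = 0") (auto simp: abs_less_iff)
qed

lemma bump2_integrable: "integrable lborel (\<lambda>v. bump (fst v) * bump (snd v))"
proof (rule integral_bounded_on_cbox(1)[of _ 1 "(-1, -1)" "(1, 1)"])
  show "(\<lambda>v. bump (fst v) * bump (snd v)) \<in> borel_measurable lborel"
    by (auto intro!: borel_measurable_continuous_onI continuous_intros continuous_on_compose2[OF bump_continuous(1)[of UNIV]])
  fix v :: "real \<times> real"
  have "\<bar>bump (fst v)\<bar> * \<bar>bump (snd v)\<bar> \<le> 1 * 1" using bump_bounds by (intro mult_mono) auto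
  then show "\<bar>bump (fst v) * bump (snd v)\<bar> \<le> 1 * indicator (cbox (-1, -1) (1, 1)) v"
    using bump_bounds(3)[of "fst v"] bump_bounds(3)[of "snd v"]
    by (cases v; cases "bump (fst v) * bump (snd v) = 0") (auto simp: cbox_Pair_eq abs_mult abs_less_iff)
qed

definition bump_mass :: real where "bump_mass = (LINT x|lborel. bump x)"
definition bump2_mass :: real where "bump2_mass = (LINT v|lborel. bump (fst v) * bump (snd v))"

lemma bump_mass_pos: "0 < bump_mass"
proof -
  have "(LINT x|lborel. 1/2 * indicator (cbox (-1/2) (1/2 :: real)) x) \<le> bump_mass"
    unfolding bump_mass_def
  proof (rule integral_mono[OF _ bump_integrable])
    show "integrable lborel (\<lambda>x::real. 1/2 * indicator (cbox (-1/2) (1/2 :: real)) x :: real)"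
      by (intro integrable_mult_right integrable_real_indicator) (use emeasure_lborel_cbox_finite[of "-1/2::real" "1/2"] in auto)
    show "1/2 * indicator (cbox (-1/2) (1/2 :: real)) x \<le> bump x" for x
      using bump_ge[of x] bump_bounds(1)[of x] by (auto simp: indicator_def abs_le_iff)
  qed
  then show ?thesis by simp
qed

lemma bump2_mass_pos: "0 < bump2_mass"
proof -
  let ?C = "cbox (-1/2, -1/2) (1/2, 1/2) :: (real \<times> real) set"
  have "(LINT x|lborel. 1/4 * indicator ?C x) \<le> bump2_mass"
    unfolding bump2_mass_def
  proof (rule integral_mono[OF _ bump2_integrable])
    show "integrable lborel (\<lambda>x. 1/4 * indicator ?C x :: real)"
      by (intro integrable_mult_right integrable_real_indicator)
         (use emeasure_lborel_cbox_finite[of "(-1/2, -1/2) :: real \<times> real" "(1/2, 1/2)"] in auto)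
    show "1/4 * indicator ?C v \<le> bump (fst v) * bump (snd v)" for v
    proof (cases "v \<in> ?C")
      case True
      then have "1/2 * (1/2) \<le> bump (fst v) * bump (snd v)"
        by (intro mult_mono bump_ge bump_bounds) (cases v; auto simp: cbox_Pair_eq abs_le_iff)+
      then show ?thesis using True by simp
    next
      case False
      then show ?thesis using bump_bounds(1) by simp
    qed
  qed
  moreover have "measure lborel ?C = 1" by (simp add: content_Pair)
  ultimately show ?thesis by simp
qed

text \<open>
  The cloud around \<open>0\<close> has twice the charge of the cloud around \<open>D\<close>, so the field between them is positive
  and does not depend on their distance.
\<close>

definition two_bumps :: "real \<Rightarrow> real \<Rightarrow> real" where "two_bumps D x = 2 * bump x + bump (x - D)"

definition two_clouds :: "real \<Rightarrow> phase \<Rightarrow> real" where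
  "two_clouds D z = two_bumps D (fst z) * (bump (fst (snd z)) * bump (snd (snd z)))"

definition two_clouds' :: "real \<Rightarrow> phase \<Rightarrow> phase \<Rightarrow>\<^sub>L real" where
  "two_clouds' D z =
     ((2 * bump' (fst z) + bump' (fst z - D)) * (bump (fst (snd z)) * bump (snd (snd z)))) *\<^sub>R fst_blinfun
   + (two_bumps D (fst z) * (bump' (fst (snd z)) * bump (snd (snd z)))) *\<^sub>R (fst_blinfun o\<^sub>L snd_blinfun)
   + (two_bumps D (fst z) * (bump (fst (snd z)) * bump' (snd (snd z)))) *\<^sub>R (snd_blinfun o\<^sub>L snd_blinfun)"

lemma two_bumps_bounds: "0 \<le> two_bumps D x" "\<bar>two_bumps D x\<bar> \<le> 3" "\<bar>two_bumps D x - two_bumps D y\<bar> \<le> 12 * \<bar>x - y\<bar>"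
  using bump_bounds[of x] bump_bounds[of "x - D"] bump_lipschitz[of x y] bump_lipschitz[of "x - D" "y - D"]
  by (auto simp: two_bumps_def)

lemma two_clouds_vlasov_data:
  assumes D: "0 \<le> D"
  shows "vlasov_data (two_clouds D) (two_clouds' D) 3 36 (D + 1)"
proof
  show "0 \<le> two_clouds D z" for z
    unfolding two_clouds_def by (intro mult_nonneg_nonneg two_bumps_bounds bump_bounds)
  have ab: "\<bar>bump a * bump b\<bar> \<le> 1" for a b
    unfolding abs_mult using bump_bounds(5)[of a] bump_bounds(5)[of b] by (intro mult_le_one) auto
  show "two_clouds D z \<le> 3" for z
  proof -
    have "\<bar>two_clouds D z\<bar> \<le> 3 * 1"
      unfolding two_clouds_def abs_mult[of "two_bumps D _"] by (intro mult_mono two_bumps_bounds ab) auto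
    then show ?thesis by simp
  qed
  show "\<bar>two_clouds D y - two_clouds D z\<bar> \<le> 36 * norm (y - z)" for y z
  proof -
    obtain x a b where y: "y = (x, a, b)" by (metis prod.collapse)
    obtain x' a' b' where z: "z = (x', a', b')" by (metis prod.collapse)
    have le: "\<bar>x - x'\<bar> \<le> norm (y - z)" "\<bar>a - a'\<bar> \<le> norm (y - z)" "\<bar>b - b'\<bar> \<le> norm (y - z)"
      using abs_fst_le_norm[of "y - z"] order_trans[OF abs_fst_le_norm[of "snd (y - z)"] norm_snd_le_norm]
        order_trans[OF norm_snd_le_norm[of "snd (y - z)"] norm_snd_le_norm] by (auto simp: y z)
    have "two_clouds D y - two_clouds D z = (two_bumps D x - two_bumps D x') * (bump a * bump b)
        + two_bumps D x' * ((bump a - bump a') * bump b) + two_bumps D x' * (bump a' * (bump b - bump b'))"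
      by (simp add: two_clouds_def y z algebra_simps)
    moreover have "\<bar>(two_bumps D x - two_bumps D x') * (bump a * bump b)\<bar> \<le> (12 * norm (y - z)) * 1"
      unfolding abs_mult[of "_ - _"] using le(1) two_bumps_bounds(3)[of D x x'] ab[of a b] by (intro mult_mono) auto
    moreover have "\<bar>two_bumps D x' * ((bump a - bump a') * bump b)\<bar> \<le> 3 * ((4 * norm (y - z)) * 1)"
      unfolding abs_mult using two_bumps_bounds(2) bump_bounds(5) bump_lipschitz[of a a'] le(2) by (intro mult_mono) auto
    moreover have "\<bar>two_bumps D x' * (bump a' * (bump b - bump b'))\<bar> \<le> 3 * (1 * (4 * norm (y - z)))"
      unfolding abs_mult using two_bumps_bounds(2) bump_bounds(5) bump_lipschitz[of b b'] le(3) by (intro mult_mono) auto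
    ultimately show ?thesis by linarith
  qed
  show "z \<in> cbox (- (D + 1), - (D + 1), - (D + 1)) (D + 1, D + 1, D + 1)" if "two_clouds D z \<noteq> 0" for z
  proof -
    obtain x a b where z: "z = (x, a, b)" by (metis prod.collapse)
    have "bump x \<noteq> 0 \<or> bump (x - D) \<noteq> 0" "bump a \<noteq> 0" "bump b \<noteq> 0"
      using that by (auto simp: two_clouds_def two_bumps_def z)
    then show ?thesis using bump_bounds(3)[of x] bump_bounds(3)[of "x - D"] bump_bounds(3)[of a] bump_bounds(3)[of b] D
      by (auto simp: z cbox_Pair_eq abs_less_iff)
  qed
  show "(two_clouds D has_derivative two_clouds' D z) (at z)" for z
  proof -
    have b: "((\<lambda>z. bump (c z)) has_derivative (\<lambda>h. c' h * bump' (c z))) (at z)" if "(c has_derivative c') (at z)" for c c'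
      using has_derivative_compose[OF that, of bump "(*) (bump' (c z))"] bump_derivative[of "c z" UNIV]
      by (simp add: has_field_derivative_def mult.commute)
    show ?thesis
      unfolding two_clouds_def[abs_def] two_bumps_def[abs_def]
      by (rule has_derivative_eq_rhs, (rule derivative_intros b)+)
         (auto simp: two_clouds'_def two_bumps_def blinfun.add_left blinfun.scaleR_left algebra_simps fun_eq_iff)
  qed
  have c: "continuous_on UNIV (\<lambda>z. bump (c z))" "continuous_on UNIV (\<lambda>z. bump' (c z))" if "continuous_on UNIV c" for c :: "phase \<Rightarrow> real"
    using continuous_on_compose2[OF bump_continuous(1)[of UNIV] that] continuous_on_compose2[OF bump_continuous(2)[of UNIV] that] by auto
  show "continuous_on UNIV (two_clouds' D)"
    unfolding two_clouds'_def[abs_def] two_bumps_def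
    by (intro continuous_intros c)
  show "two_clouds D (x, v1, - v2) = two_clouds D (x, v1, v2)" for x v1 v2
    by (simp add: two_clouds_def bump_bounds(4))
qed (use D in auto)

text \<open>
  The light ray starts at \<open>x0 = 1\<close>, the right end of the larger cloud. The field there is half the charge of
  the smaller cloud, whatever \<open>D\<close> is; therefore \<open>D\<close> can be chosen afterwards so large that the smaller
  cloud escapes.
\<close>

theorem solution_with_mass_ahead:
  "\<exists>f0 E20 B0 f E1 E2 B. admissible_data f0 E20 B0 \<and> monocharge_RVM_solution f0 E20 B0 f E1 E2 B \<and> mass_stays_ahead f"
proof -
  define c where "c = bump2_mass * bump_mass / 2"
  \<comment> \<open>The smaller cloud has \<open>x - 1 > D - 2\<close> and \<open>sqrt (1 + |v|\<^sup>2) - v1 < 4\<close> on its support.\<close>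
  define D where "D = 2 + 4 / c"
  have c: "0 < c" using bump_mass_pos bump2_mass_pos by (simp add: c_def)
  then have D: "2 \<le> D" "c * (D - 2) = 4" by (auto simp: D_def)
  interpret vlasov_data "two_clouds D" "two_clouds' D" 3 36 "D + 1"
    by (rule two_clouds_vlasov_data) (use D in simp)
  obtain E where "tame E" "\<forall>t\<ge>0. \<forall>x. induced E t x = E t x" using self_consistent_field_exists by blast
  then interpret self_consistent_field "two_clouds D" "two_clouds' D" 3 36 "D + 1" E
    by unfold_locales auto
  have rho0: "charge E 0 x = two_bumps D x * bump2_mass" for x
    by (simp add: moment_def dens_def char.flow_start two_clouds_def bump2_mass_def)
  have int: "integrable lborel (\<lambda>y. bump (y - D))"
    using lborel_integrable_real_affine[OF bump_integrable, of 1 "- D"] by simp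
  have shift: "(LINT y|lborel. bump (y - D)) = bump_mass"
    using lborel_integral_real_affine[of 1 bump "- D"] by (simp add: bump_mass_def)
  have bump0: "1 \<le> y \<Longrightarrow> bump y = 0" and bumpD: "y \<le> 1 \<Longrightarrow> bump (y - D) = 0" for y
    using bump_bounds(3)[of y] bump_bounds(3)[of "y - D"] D by force+
  have left: "y < 1" if "bump y \<noteq> 0" for y using bump_bounds(3)[OF that] by auto
  have right: "1 < y" if "bump (y - D) \<noteq> 0" for y using bump_bounds(3)[OF that] D by auto
  have "E 0 1 = 1/2 * (LINT y|lborel. sgn (1 - y) * charge E 0 y)"
    using induced_charge[OF tame order_refl, of 1] by (simp add: consistent)
  also have "(\<lambda>y. sgn (1 - y) * charge E 0 y) = (\<lambda>y. bump2_mass * (2 * bump y - bump (y - D)))"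
  proof
    fix y
    show "sgn (1 - y) * charge E 0 y = bump2_mass * (2 * bump y - bump (y - D))"
      by (cases y "1::real" rule: linorder_cases) (auto simp: rho0 two_bumps_def bump0 bumpD)
  qed
  also have "1/2 * (LINT y|lborel. bump2_mass * (2 * bump y - bump (y - D))) = c"
    using bump_integrable int shift by (simp add: c_def bump_mass_def)
  finally have E01: "E 0 1 = c" .
  have gap: "dens E t (1 + t, v) = 0" if t: "0 \<le> t" for t v
  proof (rule no_charge_on_light_ray[OF t c])
    fix x v assume nz: "two_clouds D (x, v) \<noteq> 0"
    obtain v1 v2 where v: "v = (v1, v2)" by force
    have b: "bump v1 \<noteq> 0" "bump v2 \<noteq> 0" "bump x \<noteq> 0 \<or> bump (x - D) \<noteq> 0"
      using nz by (auto simp: two_clouds_def two_bumps_def v)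
    have v12: "\<bar>v1\<bar> < 1" "\<bar>v2\<bar> < 1" using bump_bounds(3) b by auto
    have "norm v \<le> 2" using norm_Pair_le[of v1 v2] v12 by (simp add: v)
    moreover have "sqrt (1 + (norm v)\<^sup>2) \<le> 1 + norm v"
      unfolding sqrt_one_plus_square_eq_norm using norm_Pair_le[of "1::real" v] by simp
    ultimately have "sqrt (1 + (norm v)\<^sup>2) - fst v < 4" using v12 by (auto simp: v)
    moreover have "4 < c * (x - 1)" if "bump (x - D) \<noteq> 0"
    proof -
      have "D - 2 < x - 1" using bump_bounds(3)[OF that] by auto
      then show ?thesis using c D(2) by (metis mult_strict_left_mono)
    qed
    ultimately show "x < 1 \<or> sqrt (1 + (norm v)\<^sup>2) - fst v < c * (x - 1)"
      using b(3) left[of x] by auto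
  qed (use E01 in simp)
  have "(LINT x:{1 + t..}|lborel. rho f t x) = bump2_mass * bump_mass" if t: "0 \<le> t" for t
  proof -
    have "(LINT x:{1 + t..}|lborel. rho f t x) = (LINT x:{1..}|lborel. charge E 0 x)"
      unfolding rho_eq by (rule charge_ahead_conserved[OF t gap])
    also have "\<dots> = (LINT y|lborel. bump2_mass * bump (y - D))"
    proof -
      have "indicator {1..} y *\<^sub>R charge E 0 y = bump2_mass * bump (y - D)" for y
        by (cases "1 \<le> y") (auto simp: rho0 two_bumps_def bump0 bumpD)
      then show ?thesis by (simp add: set_lebesgue_integral_def)
    qed
    also have "\<dots> = bump2_mass * bump_mass" using shift by simp
    finally show ?thesis .
  qed
  then have "mass_stays_ahead f"
    unfolding mass_stays_ahead_def using bump_mass_pos bump2_mass_pos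
    by (intro exI[of _ 1] exI[of _ "bump2_mass * bump_mass / 2"]) auto
  then show ?thesis using admissible monocharge_solution by blast
qed

theorem theorem1p3:
  shows "(\<exists>f0 E20 B0 f E1 E2 B.
            admissible_data f0 E20 B0 \<and>
            monocharge_RVM_solution f0 E20 B0 f E1 E2 B \<and>
            mass_stays_ahead f) \<and>
         (\<forall>f0 E20 B0 f E1 E2 B.
            admissible_data f0 E20 B0 \<and>
            monocharge_RVM_solution f0 E20 B0 f E1 E2 B \<and>
            mass_stays_ahead f \<longrightarrow>
            (\<exists>C::real. C > 0 \<and> (\<forall>t\<ge>0. \<forall>p\<ge>1. Lp_norm p (rho f t) > ennreal C)))"
  using solution_with_mass_ahead mass_ahead_bounds_Lp_norms by blast

end
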